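(* Let $U\subset\mathbb R^n$ be open, $0\le k\le n$, and $\mathcal P_k=\mathcal P_k(U)$, $\mathcal B_k=\mathcal B_k(U)$. The Mackey topology $\tau(\mathcal P_k,\mathcal B_k)$ is the finest locally convex topology $\mu$ on $\mathcal P_k$ such that: (1) bounded linear mappings $(\mathcal P_k,\mu)\to F$ are continuous whenever $F$ is a locally convex space; (2) $K^0=\{(p;\alpha)\in\mathcal P_k:\|\alpha\|=1\}$ is bounded in $(\mathcal P_k,\mu)$, where $\|\alpha\|$ is the mass norm of $\alpha\in\Lambda_k(\mathbb R^n)$; (3) for every vector $v\in\mathbb R^n$, the linear map $P_v:(\mathcal P_k,\mu)\to\overline{(\mathcal P_k,\mu)}$ given by $P_v(p;\alpha):=\lim_{t\to0}\big((p+tv;\alpha/t)-(p;\alpha/t)\big)$ is well-defined and bounded.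
   Context: $\mathcal P_k(U)$ is the real vector space of pointed $k$-chains in $U$: finite formal sums $A=\sum_{i=1}^s (p_i;\alpha_i)$ with $p_i\in U$, $\alpha_i\in\Lambda_k(\mathbb R^n)$ (finitely supported sections of $\Lambda_k(TU)$), with $(p;\cdot)$ linear. For a $k$-form $\omega$ on $U$ put $\int_A\omega:=\sum_{i=1}^s\omega(p_i;\alpha_i)$. $\mathcal B_k(U)$ is the space of smooth $k$-forms on $U$ all of whose Lie derivatives $L_{v_1}\cdots L_{v_j}\omega$ ($j\ge 0$) along constant unit vector fields are bounded on $U$. $(\mathcal P_k,\mathcal B_k)$ is a dual pair under $(A,\omega)\mapsto\int_A\omega$; the Mackey topology $\tau(\mathcal P_k,\mathcal B_k)$ is the finest locally convex topology on $\mathcal P_k$ whose continuous dual is $\mathcal B_k$. $\overline{(\mathcal P_k,\mu)}$ denotes the completion of $(\mathcal P_k,\mu)$, in which the limit in (3) is taken. A linear map is bounded if it sends bounded sets to bounded sets. The mass norm on $\Lambda_k(\mathbb R^n)$ is $\|\alpha\|=\inf\{\sum_i|\alpha_i|:\alpha=\sum_i\alpha_i,\ \alpha_i \text{ simple}\}$, with $|\alpha_i|$ the Euclidean $k$-volume of a simple $k$-vector. *)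

theory Defs
  imports "HOL-Analysis.Analysis" "HOL-Library.Function_Algebras"
begin

section \<open>Pointwise real vector space structure on functions\<close>

instantiation "fun" :: (type, real_vector) real_vector
begin

definition scaleR_fun :: "real \<Rightarrow> ('a \<Rightarrow> 'b) \<Rightarrow> 'a \<Rightarrow> 'b"
  where "scaleR_fun c f = (\<lambda>x. c *\<^sub>R f x)"

instance
  by standard (auto simp: scaleR_fun_def fun_eq_iff scaleR_add_right scaleR_add_left)

end

lemma scaleR_fun_apply [simp]: "(c *\<^sub>R f) x = c *\<^sub>R f x"
  by (simp add: scaleR_fun_def)


section \<open>Locally convex spaces\<close>

definition linear_on :: "'a::real_vector set \<Rightarrow> ('a \<Rightarrow> 'b::real_vector) \<Rightarrow> bool" where
  "linear_on S f \<longleftrightarrow>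
     (\<forall>x\<in>S. \<forall>y\<in>S. f (x + y) = f x + f y) \<and> (\<forall>c. \<forall>x\<in>S. f (c *\<^sub>R x) = c *\<^sub>R f x)"

text \<open>The carrier \<^term>\<open>topspace X\<close> is a linear subspace of the ambient type.
  Local convexity does not include the Hausdorff axiom.\<close>

definition locally_convex_space :: "'v::real_vector topology \<Rightarrow> bool" where
  "locally_convex_space X \<longleftrightarrow>
     subspace (topspace X) \<and>
     continuous_map (prod_topology X X) X (\<lambda>(x, y). x + y) \<and>
     continuous_map (prod_topology euclideanreal X) X (\<lambda>(c, x). c *\<^sub>R x) \<and>
     (\<forall>W. openin X W \<and> 0 \<in> W \<longrightarrow> (\<exists>C. openin X C \<and> 0 \<in> C \<and> convex C \<and> C \<subseteq> W))"

definition vn_bounded :: "'v::real_vector topology \<Rightarrow> 'v set \<Rightarrow> bool" where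
  "vn_bounded X S \<longleftrightarrow> S \<subseteq> topspace X \<and>
     (\<forall>W. openin X W \<and> 0 \<in> W \<longrightarrow> (\<exists>r>0. \<forall>c. \<bar>c\<bar> \<ge> r \<longrightarrow> S \<subseteq> (\<lambda>w. c *\<^sub>R w) ` W))"

definition bounded_map ::
  "'v::real_vector topology \<Rightarrow> 'w::real_vector topology \<Rightarrow> ('v \<Rightarrow> 'w) \<Rightarrow> bool" where
  "bounded_map X Y T \<longleftrightarrow> (\<forall>S. vn_bounded X S \<longrightarrow> vn_bounded Y (T ` S))"

text \<open>The spaces \<open>F\<close> range over the locally convex spaces carried by subspaces of the type
  \<open>'f\<close>, which has to appear as a parameter. Taking \<open>'f\<close> to be the type of \<open>X\<close> itself is no
  restriction, see \<open>bounded_maps_continuous_any_type\<close> below.\<close>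

definition bounded_maps_continuous ::
  "'f::real_vector itself \<Rightarrow> 'v::real_vector topology \<Rightarrow> bool" where
  "bounded_maps_continuous _ X \<longleftrightarrow>
     (\<forall>(F :: 'f topology) T. locally_convex_space F \<and> linear_on (topspace X) T \<and>
        bounded_map X F T \<longrightarrow> continuous_map X F T)"

lemma linear_onD:
  assumes "linear_on S f"
  shows linear_on_add: "\<And>x y. x \<in> S \<Longrightarrow> y \<in> S \<Longrightarrow> f (x + y) = f x + f y"
    and linear_on_scaleR: "\<And>c x. x \<in> S \<Longrightarrow> f (c *\<^sub>R x) = c *\<^sub>R f x"
  using assms by (auto simp: linear_on_def)

lemma locally_convex_space_absorbing:
  assumes "locally_convex_space X" "openin X W" "0 \<in> W" "x \<in> topspace X"
  shows "\<exists>r>0. \<forall>c. \<bar>c\<bar> \<le> r \<longrightarrow> c *\<^sub>R x \<in> W"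
proof -
  have "continuous_map (prod_topology euclideanreal X) X (\<lambda>(c, x). c *\<^sub>R x)"
    using assms(1) by (simp add: locally_convex_space_def)
  moreover have "continuous_map euclideanreal (prod_topology euclideanreal X) (\<lambda>c. (c, x))"
    using assms(4) by (intro continuous_map_pairedI) auto
  ultimately have "continuous_map euclideanreal X ((\<lambda>(c, x). c *\<^sub>R x) \<circ> (\<lambda>c. (c, x)))"
    by (rule continuous_map_compose[rotated])
  then have "open {c. c *\<^sub>R x \<in> W}"
    using assms(2) by (force simp: continuous_map_def o_def)
  moreover have "0 \<in> {c. c *\<^sub>R x \<in> W}" using assms(3) by simp
  ultimately obtain e where e: "e > 0" "ball 0 e \<subseteq> {c. c *\<^sub>R x \<in> W}"
    using open_contains_ball by blast
  then have "c *\<^sub>R x \<in> W" if "\<bar>c\<bar> \<le> e / 2" for c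
    using that by (auto simp: subset_iff dist_norm)
  then show ?thesis using e(1) by (intro exI[of _ "e / 2"]) auto
qed

lemma vn_bounded_singleton:
  assumes "locally_convex_space X" "x \<in> topspace X"
  shows "vn_bounded X {x}"
  unfolding vn_bounded_def
proof (intro conjI allI impI)
  fix W assume W: "openin X W \<and> 0 \<in> W"
  obtain r where r: "r > 0" "\<And>c. \<bar>c\<bar> \<le> r \<Longrightarrow> c *\<^sub>R x \<in> W"
    using locally_convex_space_absorbing[of X W x] assms W by blast
  have "{x} \<subseteq> (\<lambda>w. c *\<^sub>R w) ` W" if "1 / r \<le> \<bar>c\<bar>" for c
  proof -
    have "c \<noteq> 0" using that r by auto
    then have "\<bar>1 / c\<bar> \<le> r" using that r by (simp add: field_simps)
    then have "(1 / c) *\<^sub>R x \<in> W" by (rule r)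
    then show ?thesis using \<open>c \<noteq> 0\<close> by (auto intro!: image_eqI[of _ _ "(1 / c) *\<^sub>R x"])
  qed
  then show "\<exists>r>0. \<forall>c. r \<le> \<bar>c\<bar> \<longrightarrow> {x} \<subseteq> (\<lambda>w. c *\<^sub>R w) ` W"
    using r(1) by (intro exI[of _ "1 / r"]) auto
qed (use assms in auto)

lemma locally_convex_space_pullback:
  assumes F: "locally_convex_space F" and E: "subspace E"
    and T: "linear_on E T" and TE: "T ` E \<subseteq> topspace F"
  shows "locally_convex_space (pullback_topology E T F)"
    and "topspace (pullback_topology E T F) = E"
    and "continuous_map (pullback_topology E T F) F T"
proof -
  let ?G = "pullback_topology E T F"
  show top: "topspace ?G = E"
    using TE by (auto simp: topspace_pullback_topology)
  show cont: "continuous_map ?G F T"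
    using continuous_map_pullback[OF continuous_map_id, of E T F] by simp
  have T0: "T 0 = 0"
    using linear_on_scaleR[OF T subspace_0[OF E], of 0] by simp
  show "locally_convex_space ?G"
    unfolding locally_convex_space_def
  proof (intro conjI allI impI)
    show "subspace (topspace ?G)" using E top by simp
    have "continuous_map (prod_topology ?G ?G) F ((\<lambda>(x, y). x + y) \<circ> (\<lambda>(x, y). (T x, T y)))"
    proof (rule continuous_map_compose[of _ "prod_topology F F"])
      show "continuous_map (prod_topology ?G ?G) (prod_topology F F) (\<lambda>(x, y). (T x, T y))"
        using cont by (simp add: continuous_map_prod_top)
      show "continuous_map (prod_topology F F) F (\<lambda>(x, y). x + y)"
        using F by (simp add: locally_convex_space_def)
    qed
    then have "continuous_map (prod_topology ?G ?G) F (T \<circ> (\<lambda>(x, y). x + y))"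
      by (rule continuous_map_eq) (auto simp: top linear_on_add[OF T])
    then show "continuous_map (prod_topology ?G ?G) ?G (\<lambda>(x, y). x + y)"
      by (rule continuous_map_pullback') (auto simp: top subspace_add[OF E])
    have "continuous_map (prod_topology euclideanreal ?G) F
        ((\<lambda>(c, x). c *\<^sub>R x) \<circ> (\<lambda>(c, x). (id c, T x)))"
    proof (rule continuous_map_compose[of _ "prod_topology euclideanreal F"])
      show "continuous_map (prod_topology euclideanreal ?G) (prod_topology euclideanreal F)
          (\<lambda>(c, x). (id c, T x))"
        using cont by (simp only: continuous_map_prod_top continuous_map_id simp_thms)
      show "continuous_map (prod_topology euclideanreal F) F (\<lambda>(c, x). c *\<^sub>R x)"
        using F by (simp add: locally_convex_space_def)
    qed
    then have "continuous_map (prod_topology euclideanreal ?G) F (T \<circ> (\<lambda>(c, x). c *\<^sub>R x))"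
      by (rule continuous_map_eq) (auto simp: top linear_on_scaleR[OF T])
    then show "continuous_map (prod_topology euclideanreal ?G) ?G (\<lambda>(c, x). c *\<^sub>R x)"
      by (rule continuous_map_pullback') (auto simp: top subspace_scale[OF E])
    fix W assume W: "openin ?G W \<and> 0 \<in> W"
    then obtain W' where W': "openin F W'" "W = T -` W' \<inter> E"
      by (auto simp: openin_pullback_topology)
    then have "0 \<in> W'" using W T0 by auto
    then obtain C where C: "openin F C" "0 \<in> C" "convex C" "C \<subseteq> W'"
      using F W'(1) unfolding locally_convex_space_def by blast
    have "convex (T -` C \<inter> E)"
      unfolding convex_def
    proof (intro ballI allI impI)
      fix x y and u v :: real
      assume xy: "x \<in> T -` C \<inter> E" "y \<in> T -` C \<inter> E" and uv: "0 \<le> u" "0 \<le> v" "u + v = 1"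
      have "T (u *\<^sub>R x + v *\<^sub>R y) = u *\<^sub>R T x + v *\<^sub>R T y"
        using xy by (simp add: linear_on_add[OF T] linear_on_scaleR[OF T] subspace_scale[OF E])
      also have "\<dots> \<in> C" using C(3) xy uv by (auto simp: convex_def)
      finally show "u *\<^sub>R x + v *\<^sub>R y \<in> T -` C \<inter> E"
        using xy by (auto intro!: subspace_add[OF E] subspace_scale[OF E])
    qed
    moreover have "openin ?G (T -` C \<inter> E)" using C by (auto simp: openin_pullback_topology)
    ultimately show "\<exists>C. openin ?G C \<and> 0 \<in> C \<and> convex C \<and> C \<subseteq> W"
      using C W' T0 subspace_0[OF E] by (intro exI[of _ "T -` C \<inter> E"]) auto
  qed
qed

lemma bounded_maps_continuous_any_type:
  fixes X :: "'v::real_vector topology"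
  assumes X: "locally_convex_space X" and bmc: "bounded_maps_continuous TYPE('v) X"
  shows "bounded_maps_continuous TYPE('f::real_vector) X"
  unfolding bounded_maps_continuous_def
proof (intro allI impI, elim conjE)
  fix F :: "'f topology" and T
  assume F: "locally_convex_space F" and T: "linear_on (topspace X) T" and bd: "bounded_map X F T"
  let ?E = "topspace X" let ?G = "pullback_topology ?E T F"
  have E: "subspace ?E" using X by (simp add: locally_convex_space_def)
  have TE: "T ` ?E \<subseteq> topspace F"
  proof
    fix y assume "y \<in> T ` ?E"
    then obtain x where "x \<in> ?E" "y = T x" by blast
    then have "vn_bounded F (T ` {x})"
      using vn_bounded_singleton[OF X] bd by (simp only: bounded_map_def)
    then show "y \<in> topspace F" using \<open>y = T x\<close> by (simp add: vn_bounded_def)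
  qed
  note G = locally_convex_space_pullback[OF F E T TE]
  have "bounded_map X ?G (\<lambda>x. x)"
    unfolding bounded_map_def
  proof (intro allI impI)
    fix S assume S: "vn_bounded X S"
    then have SE: "S \<subseteq> ?E" by (simp add: vn_bounded_def)
    have TS: "vn_bounded F (T ` S)" using S bd by (simp add: bounded_map_def)
    have "vn_bounded ?G S"
      unfolding vn_bounded_def
    proof (intro conjI allI impI)
      show "S \<subseteq> topspace ?G" using SE G(2) by simp
      fix W assume W: "openin ?G W \<and> 0 \<in> W"
      then obtain W' where W': "openin F W'" "W = T -` W' \<inter> ?E"
        by (auto simp: openin_pullback_topology)
      have "T 0 = 0" using linear_on_scaleR[OF T subspace_0[OF E], of 0] by simp
      then have "0 \<in> W'" using W W' by auto
      then obtain r where r: "r > 0" "\<And>c. r \<le> \<bar>c\<bar> \<Longrightarrow> T ` S \<subseteq> (\<lambda>w. c *\<^sub>R w) ` W'"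
        using TS W'(1) by (auto simp: vn_bounded_def)
      have "S \<subseteq> (\<lambda>w. c *\<^sub>R w) ` W" if c: "r \<le> \<bar>c\<bar>" for c
      proof
        fix x assume x: "x \<in> S"
        have c0: "c \<noteq> 0" using c r by auto
        obtain w where w: "w \<in> W'" "T x = c *\<^sub>R w" using r(2)[OF c] x by auto
        have "T ((1 / c) *\<^sub>R x) = w"
          using linear_on_scaleR[OF T, of x "1 / c"] x SE w c0 by auto
        then have "(1 / c) *\<^sub>R x \<in> W"
          using w x SE W' by (auto intro: subspace_scale[OF E])
        then show "x \<in> (\<lambda>w. c *\<^sub>R w) ` W"
          using c0 by (auto intro!: image_eqI[of _ _ "(1 / c) *\<^sub>R x"])
      qed
      then show "\<exists>r>0. \<forall>c. r \<le> \<bar>c\<bar> \<longrightarrow> S \<subseteq> (\<lambda>w. c *\<^sub>R w) ` W" using r(1) by blast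
    qed
    then show "vn_bounded ?G ((\<lambda>x. x) ` S)" by simp
  qed
  moreover have "linear_on ?E (\<lambda>x. x)" by (simp add: linear_on_def)
  ultimately have "continuous_map X ?G (\<lambda>x. x)"
    using bmc G(1) by (auto simp: bounded_maps_continuous_def)
  from continuous_map_compose[OF this G(3)] show "continuous_map X F T" by (simp add: o_def)
qed

definition coarser :: "'v topology \<Rightarrow> 'v topology \<Rightarrow> bool" where
  "coarser X Y \<longleftrightarrow> (\<forall>S. openin X S \<longrightarrow> openin Y S)"

text \<open>Functionals are extended by \<^term>\<open>undefined\<close> off the carrier, so that two of them are
  equal iff they agree on the carrier.\<close>

definition continuous_dual :: "'v::real_vector topology \<Rightarrow> ('v \<Rightarrow> real) set" where
  "continuous_dual X =
     {f \<in> extensional (topspace X). linear_on (topspace X) f \<and> continuous_map X euclideanreal f}"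

definition compatible_topology :: "'v::real_vector set \<Rightarrow> ('v \<Rightarrow> real) set \<Rightarrow> 'v topology \<Rightarrow> bool" where
  "compatible_topology E D X \<longleftrightarrow>
     locally_convex_space X \<and> topspace X = E \<and> continuous_dual X = D"

text \<open>The finest compatible topology is unique, as \<^const>\<open>coarser\<close> is antisymmetric.\<close>

definition mackey_topology :: "'v::real_vector set \<Rightarrow> ('v \<Rightarrow> real) set \<Rightarrow> 'v topology" where
  "mackey_topology E D =
     (THE X. compatible_topology E D X \<and> (\<forall>Y. compatible_topology E D Y \<longrightarrow> coarser Y X))"

definition cauchy_filter_in :: "'v::real_vector topology \<Rightarrow> 'v filter \<Rightarrow> bool" where
  "cauchy_filter_in X \<F> \<longleftrightarrow> \<F> \<noteq> bot \<and> eventually (\<lambda>x. x \<in> topspace X) \<F> \<and>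
     (\<forall>W. openin X W \<and> 0 \<in> W \<longrightarrow>
        (\<exists>S. eventually (\<lambda>x. x \<in> S) \<F> \<and> (\<forall>x\<in>S. \<forall>y\<in>S. x - y \<in> W)))"

definition complete_lcs :: "'v::real_vector topology \<Rightarrow> bool" where
  "complete_lcs X \<longleftrightarrow> locally_convex_space X \<and>
     (\<forall>\<F>. cauchy_filter_in X \<F> \<longrightarrow> (\<exists>l. limitin X (\<lambda>x. x) l \<F>))"

text \<open>The Hausdorff completion up to isomorphism. If \<open>X\<close> is Hausdorff, the
  pullback condition says that \<open>\<iota>\<close> is a linear topological embedding.\<close>

definition is_completion ::
  "'v::real_vector topology \<Rightarrow> 'c::real_vector topology \<Rightarrow> ('v \<Rightarrow> 'c) \<Rightarrow> bool" where
  "is_completion X Y \<iota> \<longleftrightarrow>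
     complete_lcs Y \<and> Hausdorff_space Y \<and>
     linear_on (topspace X) \<iota> \<and> \<iota> ` topspace X \<subseteq> topspace Y \<and>
     X = pullback_topology (topspace X) \<iota> Y \<and>
     Y closure_of (\<iota> ` topspace X) = topspace Y"


lemma locally_convex_space_from_base:
  fixes S :: "'v::real_vector set" and B :: "'v set set"
  assumes S: "subspace S" and ne: "B \<noteq> {}"
    and base: "\<And>A. A \<in> B \<Longrightarrow> A \<subseteq> S \<and> 0 \<in> A \<and> convex A \<and> (\<forall>x\<in>A. - x \<in> A)"
    and directed: "\<And>A A'. A \<in> B \<Longrightarrow> A' \<in> B \<Longrightarrow> \<exists>C\<in>B. C \<subseteq> A \<and> C \<subseteq> A'"
    and halves: "\<And>A. A \<in> B \<Longrightarrow> \<exists>C\<in>B. \<forall>x\<in>C. \<forall>y\<in>C. x + y \<in> A"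
    and absorbing: "\<And>A x. A \<in> B \<Longrightarrow> x \<in> S \<Longrightarrow> \<exists>r>0. r *\<^sub>R x \<in> A"
  defines "T \<equiv> topology (\<lambda>G. G \<subseteq> S \<and> (\<forall>x\<in>G. \<exists>A\<in>B. \<forall>a\<in>A. x + a \<in> G))"
  shows "openin T G \<longleftrightarrow> G \<subseteq> S \<and> (\<forall>x\<in>G. \<exists>A\<in>B. \<forall>a\<in>A. x + a \<in> G)"
    and "topspace T = S"
    and "\<And>x A. x \<in> S \<Longrightarrow> A \<in> B \<Longrightarrow> \<exists>G. openin T G \<and> x \<in> G \<and> (\<forall>g\<in>G. g - x \<in> A)"
    and "locally_convex_space T"
proof -
  have "istopology (\<lambda>G. G \<subseteq> S \<and> (\<forall>x\<in>G. \<exists>A\<in>B. \<forall>a\<in>A. x + a \<in> G))"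
    unfolding istopology_def
  proof (intro conjI allI impI)
    fix G H assume G: "G \<subseteq> S \<and> (\<forall>x\<in>G. \<exists>A\<in>B. \<forall>a\<in>A. x + a \<in> G)"
      and H: "H \<subseteq> S \<and> (\<forall>x\<in>H. \<exists>A\<in>B. \<forall>a\<in>A. x + a \<in> H)"
    show "G \<inter> H \<subseteq> S" using G by blast
    show "\<forall>x\<in>G \<inter> H. \<exists>A\<in>B. \<forall>a\<in>A. x + a \<in> G \<inter> H"
    proof
      fix x assume "x \<in> G \<inter> H"
      then obtain A A' where "A \<in> B" "A' \<in> B" "\<forall>a\<in>A. x + a \<in> G" "\<forall>a\<in>A'. x + a \<in> H"
        using G H by blast
      with directed[of A A'] show "\<exists>A\<in>B. \<forall>a\<in>A. x + a \<in> G \<inter> H" by blast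
    qed
  next
    fix K assume K: "\<forall>G\<in>K. G \<subseteq> S \<and> (\<forall>x\<in>G. \<exists>A\<in>B. \<forall>a\<in>A. x + a \<in> G)"
    show "\<Union>K \<subseteq> S" using K by blast
    show "\<forall>x\<in>\<Union>K. \<exists>A\<in>B. \<forall>a\<in>A. x + a \<in> \<Union>K" using K by (meson UnionE UnionI)
  qed
  then show op: "openin T G \<longleftrightarrow> G \<subseteq> S \<and> (\<forall>x\<in>G. \<exists>A\<in>B. \<forall>a\<in>A. x + a \<in> G)" for G
    unfolding T_def by (simp add: topology_inverse')
  have "openin T S"
    unfolding op
  proof (intro conjI ballI order_refl)
    fix x assume x: "x \<in> S"
    obtain A where A: "A \<in> B" using ne by blast
    then have "\<forall>a\<in>A. x + a \<in> S" using base[OF A] x subspace_add[OF S] by blast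
    then show "\<exists>A\<in>B. \<forall>a\<in>A. x + a \<in> S" using A by blast
  qed
  then show top: "topspace T = S"
    using op[of "topspace T"] openin_subset[of T S] openin_topspace[of T] by blast
  define I where "I A = {x\<in>S. \<exists>C\<in>B. \<forall>c\<in>C. x + c \<in> A}" for A
  have IA: "I A \<subseteq> A" if "A \<in> B" for A
  proof
    fix x assume "x \<in> I A"
    then obtain C where "C \<in> B" "\<forall>c\<in>C. x + c \<in> A" by (auto simp: I_def)
    then show "x \<in> A" using base[of C] by (metis add.right_neutral)
  qed
  have I0: "0 \<in> I A" if "A \<in> B" for A
    using that subspace_0[OF S] by (auto simp: I_def)
  have Istep: "\<exists>C\<in>B. \<forall>c\<in>C. x + c \<in> I A" if xA: "A \<in> B" "x \<in> I A" for A x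
  proof -
    obtain C where C: "C \<in> B" "\<forall>c\<in>C. x + c \<in> A" "x \<in> S" using xA unfolding I_def by blast
    obtain D where D: "D \<in> B" "\<forall>u\<in>D. \<forall>w\<in>D. u + w \<in> C" using halves[OF C(1)] by blast
    have "x + d \<in> I A" if "d \<in> D" for d
    proof -
      have "x + d \<in> S" using base[OF D(1)] that C subspace_add[OF S] by blast
      moreover have "\<forall>c\<in>D. x + d + c \<in> A" using C D that by (simp add: add.assoc)
      ultimately show ?thesis using D by (auto simp: I_def)
    qed
    then show ?thesis using D by blast
  qed
  have Iopen: "openin T ((\<lambda>a. x + a) ` I A)" if AB: "A \<in> B" and xS: "x \<in> S" for A x
    unfolding op
  proof (intro conjI ballI)
    show "(\<lambda>a. x + a) ` I A \<subseteq> S" using xS subspace_add[OF S] by (auto simp: I_def)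
    fix y assume "y \<in> (\<lambda>a. x + a) ` I A"
    then obtain a where a: "a \<in> I A" "y = x + a" by blast
    obtain C where "C \<in> B" "\<forall>c\<in>C. a + c \<in> I A" using Istep[OF AB a(1)] by blast
    then show "\<exists>C\<in>B. \<forall>c\<in>C. y + c \<in> (\<lambda>a. x + a) ` I A"
      using a by (intro bexI[of _ C]) (auto simp: add.assoc)
  qed
  show nb: "\<exists>G. openin T G \<and> x \<in> G \<and> (\<forall>g\<in>G. g - x \<in> A)" if "x \<in> S" "A \<in> B" for x A
  proof (intro exI conjI ballI)
    show "openin T ((\<lambda>a. x + a) ` I A)" by (rule Iopen[OF that(2,1)])
    show "x \<in> (\<lambda>a. x + a) ` I A"
      by (rule image_eqI[of _ _ 0]) (simp_all add: I0[OF that(2)])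
    fix g assume "g \<in> (\<lambda>a. x + a) ` I A"
    then show "g - x \<in> A" using IA[OF that(2)] by auto
  qed
  have bal: "c *\<^sub>R a \<in> A" if "A \<in> B" "a \<in> A" "\<bar>c\<bar> \<le> 1" for A a c
  proof -
    have A: "0 \<in> A" "convex A" "- a \<in> A" using base that by auto
    have *: "d *\<^sub>R b \<in> A" if "b \<in> A" "0 \<le> d" "d \<le> 1" for b d
      using convexD[OF A(2) that(1) A(1), of d "1 - d"] that by simp
    show ?thesis
    proof (cases "c \<ge> 0")
      case True then show ?thesis using * that by simp
    next
      case False then show ?thesis using *[OF A(3), of "- c"] that by simp
    qed
  qed
  have mult: "\<exists>C\<in>B. \<forall>x\<in>C. \<forall>c. \<bar>c\<bar> \<le> 2 ^ m \<longrightarrow> c *\<^sub>R x \<in> A" if "A \<in> B" for A and m :: nat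
    using that
  proof (induction m arbitrary: A)
    case 0
    then show ?case using bal by auto
  next
    case (Suc m)
    obtain D where D: "D \<in> B" "\<forall>x\<in>D. \<forall>y\<in>D. x + y \<in> A" using halves[OF Suc.prems] by blast
    obtain C where C: "C \<in> B" "\<forall>x\<in>C. \<forall>c. \<bar>c\<bar> \<le> 2 ^ m \<longrightarrow> c *\<^sub>R x \<in> D"
      using Suc.IH[OF D(1)] by blast
    have "c *\<^sub>R x \<in> A" if "x \<in> C" "\<bar>c\<bar> \<le> 2 ^ Suc m" for x c
    proof -
      have "(c / 2) *\<^sub>R x \<in> D" using C that by auto
      then have "(c / 2) *\<^sub>R x + (c / 2) *\<^sub>R x \<in> A" using D by blast
      then show ?thesis by (simp flip: scaleR_add_left)
    qed
    then show ?case using C by blast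
  qed
  show "locally_convex_space T"
    unfolding locally_convex_space_def
  proof (intro conjI allI impI)
    show "subspace (topspace T)" using S top by simp
    show "continuous_map (prod_topology T T) T (\<lambda>(x, y). x + y)"
      unfolding continuous_map_def
    proof (intro conjI allI impI)
      show "(\<lambda>(x, y). x + y) \<in> topspace (prod_topology T T) \<rightarrow> topspace T"
        using top subspace_add[OF S] by auto
      fix G assume G: "openin T G"
      show "openin (prod_topology T T)
          {z \<in> topspace (prod_topology T T). (case z of (x, y) \<Rightarrow> x + y) \<in> G}"
        unfolding openin_prod_topology_alt
      proof (intro allI impI)
        fix x y assume "(x, y) \<in> {z \<in> topspace (prod_topology T T). (case z of (x, y) \<Rightarrow> x + y) \<in> G}"
        then have xy: "x \<in> S" "y \<in> S" "x + y \<in> G" using top by auto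
        then obtain A where A: "A \<in> B" "\<forall>a\<in>A. x + y + a \<in> G" using G op by blast
        obtain D where D: "D \<in> B" "\<forall>u\<in>D. \<forall>w\<in>D. u + w \<in> A" using halves[OF A(1)] by blast
        obtain U where U: "openin T U" "x \<in> U" "\<forall>g\<in>U. g - x \<in> D" using nb[OF xy(1) D(1)] by blast
        obtain V where V: "openin T V" "y \<in> V" "\<forall>g\<in>V. g - y \<in> D" using nb[OF xy(2) D(1)] by blast
        have "x' + y' \<in> G" if "x' \<in> U" "y' \<in> V" for x' y'
        proof -
          have "(x' - x) + (y' - y) \<in> A" using D U V that by blast
          then have "x + y + ((x' - x) + (y' - y)) \<in> G" using A by blast
          then show ?thesis by (simp add: algebra_simps)
        qed
        then show "\<exists>U V. openin T U \<and> openin T V \<and> x \<in> U \<and> y \<in> V \<and>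
            U \<times> V \<subseteq> {z \<in> topspace (prod_topology T T). (case z of (x, y) \<Rightarrow> x + y) \<in> G}"
          using U V openin_subset[OF U(1)] openin_subset[OF V(1)]
          by (intro exI[of _ U] exI[of _ V]) auto
      qed
    qed
    show "continuous_map (prod_topology euclideanreal T) T (\<lambda>(c, x). c *\<^sub>R x)"
      unfolding continuous_map_def
    proof (intro conjI allI impI)
      show "(\<lambda>(c, x). c *\<^sub>R x) \<in> topspace (prod_topology euclideanreal T) \<rightarrow> topspace T"
        using top subspace_scale[OF S] by auto
      fix G assume G: "openin T G"
      show "openin (prod_topology euclideanreal T)
          {z \<in> topspace (prod_topology euclideanreal T). (case z of (c, x) \<Rightarrow> c *\<^sub>R x) \<in> G}"
        unfolding openin_prod_topology_alt
      proof (intro allI impI)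
        fix c x
        assume "(c, x) \<in> {z \<in> topspace (prod_topology euclideanreal T). (case z of (c, x) \<Rightarrow> c *\<^sub>R x) \<in> G}"
        then have cx: "x \<in> S" "c *\<^sub>R x \<in> G" using top by auto
        then obtain A where A: "A \<in> B" "\<forall>a\<in>A. c *\<^sub>R x + a \<in> G" using G op by blast
        obtain D where D: "D \<in> B" "\<forall>u\<in>D. \<forall>w\<in>D. u + w \<in> A" using halves[OF A(1)] by blast
        obtain r where r: "r > 0" "r *\<^sub>R x \<in> D" using absorbing[OF D(1) cx(1)] by blast
        obtain m :: nat where m: "\<bar>c\<bar> + r \<le> 2 ^ m"
          using real_arch_pow[of 2 "\<bar>c\<bar> + r"] by (auto intro: less_imp_le)
        obtain E where E: "E \<in> B" "\<forall>x\<in>E. \<forall>c. \<bar>c\<bar> \<le> 2 ^ m \<longrightarrow> c *\<^sub>R x \<in> D"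
          using mult[OF D(1), of m] by blast
        obtain V where V: "openin T V" "x \<in> V" "\<forall>g\<in>V. g - x \<in> E" using nb[OF cx(1) E(1)] by blast
        have "c' *\<^sub>R x' \<in> G" if "c' \<in> ball c r" "x' \<in> V" for c' x'
        proof -
          have c': "\<bar>c' - c\<bar> \<le> r" using that by (auto simp: dist_real_def)
          have "((c' - c) / r) *\<^sub>R (r *\<^sub>R x) \<in> D" using bal[OF D(1) r(2), of "(c' - c) / r"] c' r by simp
          then have "(c' - c) *\<^sub>R x \<in> D" using r by simp
          moreover have "c' *\<^sub>R (x' - x) \<in> D" using E V that c' m by auto
          ultimately have "(c' - c) *\<^sub>R x + c' *\<^sub>R (x' - x) \<in> A" using D by blast
          then have "c *\<^sub>R x + ((c' - c) *\<^sub>R x + c' *\<^sub>R (x' - x)) \<in> G" using A by blast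
          then show ?thesis by (simp add: algebra_simps)
        qed
        then show "\<exists>U V. openin euclideanreal U \<and> openin T V \<and> c \<in> U \<and> x \<in> V \<and>
            U \<times> V \<subseteq> {z \<in> topspace (prod_topology euclideanreal T). (case z of (c, x) \<Rightarrow> c *\<^sub>R x) \<in> G}"
          using V r openin_subset[OF V(1)]
          by (intro exI[of _ "ball c r"] exI[of _ V]) auto
      qed
    qed
    fix W assume W: "openin T W \<and> 0 \<in> W"
    then obtain A where A: "A \<in> B" "\<forall>a\<in>A. 0 + a \<in> W" using op by blast
    have "convex (I A)"
      unfolding convex_def
    proof (intro ballI allI impI)
      fix x y and u v :: real assume xy: "x \<in> I A" "y \<in> I A" and uv: "0 \<le> u" "0 \<le> v" "u + v = 1"
      obtain C where C: "C \<in> B" "\<forall>c\<in>C. x + c \<in> A" "x \<in> S" using xy unfolding I_def by blast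
      obtain D where D: "D \<in> B" "\<forall>c\<in>D. y + c \<in> A" "y \<in> S" using xy unfolding I_def by blast
      obtain E where E: "E \<in> B" "E \<subseteq> C" "E \<subseteq> D" using directed[OF C(1) D(1)] by blast
      have "u *\<^sub>R x + v *\<^sub>R y + e \<in> A" if "e \<in> E" for e
      proof -
        have "u *\<^sub>R (x + e) + v *\<^sub>R (y + e) \<in> A"
          using base[OF A(1)] C D E that uv by (intro convexD) auto
        moreover have "u *\<^sub>R (x + e) + v *\<^sub>R (y + e) = u *\<^sub>R x + v *\<^sub>R y + (u + v) *\<^sub>R e"
          by (simp add: algebra_simps)
        ultimately show ?thesis using uv by simp
      qed
      then show "u *\<^sub>R x + v *\<^sub>R y \<in> I A"
        using E C D by (auto simp: I_def intro!: subspace_add[OF S] subspace_scale[OF S])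
    qed
    moreover have "openin T (I A)" using Iopen[OF A(1) subspace_0[OF S]] by simp
    ultimately show "\<exists>C. openin T C \<and> 0 \<in> C \<and> convex C \<and> C \<subseteq> W"
      using I0[OF A(1)] IA[OF A(1)] A by (intro exI[of _ "I A"]) auto
  qed
qed

lemma completion_exists:
  fixes X :: "'v::real_vector topology"
  assumes X: "locally_convex_space X"
  shows "\<exists>(Y :: ('v set \<Rightarrow> 'v) topology) \<iota>. is_completion X Y \<iota>"
proof -
  define E where "E = topspace X"
  define N where "N = {W. openin X W \<and> 0 \<in> W \<and> convex W \<and> (\<forall>x\<in>W. - x \<in> W)}"
  have E: "subspace E" using X by (simp add: locally_convex_space_def E_def)
  note Eadd = subspace_add[OF E] and Ediff = subspace_diff[OF E] and Escale = subspace_scale[OF E]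
  have plus: "continuous_map (prod_topology X X) X (\<lambda>(x, y). x + y)"
    and scale: "continuous_map (prod_topology euclideanreal X) X (\<lambda>(c, x). c *\<^sub>R x)"
    using X by (simp_all add: locally_convex_space_def)
  have scale_c: "continuous_map X X (\<lambda>x. c *\<^sub>R x)" for c
  proof -
    have "continuous_map X (prod_topology euclideanreal X) (\<lambda>x. (c, x))"
      by (intro continuous_map_pairedI) auto
    from continuous_map_compose[OF this scale] show ?thesis by (simp add: o_def)
  qed
  have plus_c: "continuous_map X X (\<lambda>y. x + y)" if "x \<in> E" for x
  proof -
    have "continuous_map X (prod_topology X X) (\<lambda>y. (x, y))"
      using that by (intro continuous_map_pairedI) (auto simp: E_def)
    from continuous_map_compose[OF this plus] show ?thesis by (simp add: o_def)
  qed
  have NE: "W \<subseteq> E" if "W \<in> N" for W using that openin_subset by (auto simp: N_def E_def)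
  have N0: "0 \<in> W" if "W \<in> N" for W using that by (auto simp: N_def)
  have Nneg: "- x \<in> W" if "W \<in> N" "x \<in> W" for W x using that by (auto simp: N_def)
  have Nconvex: "convex W" if "W \<in> N" for W using that by (auto simp: N_def)
  have Nopen: "openin X W" if "W \<in> N" for W using that by (auto simp: N_def)
  have EN: "E \<in> N"
    using E by (auto simp: N_def E_def subspace_0 subspace_imp_convex subspace_neg)
  have Nsub: "\<exists>V\<in>N. V \<subseteq> W" if W: "openin X W" "0 \<in> W" for W
  proof -
    obtain C where C: "openin X C" "0 \<in> C" "convex C" "C \<subseteq> W"
      using X W unfolding locally_convex_space_def by blast
    define D where "D = {x \<in> topspace X. (-1) *\<^sub>R x \<in> C}"
    have D: "openin X D" unfolding D_def
      using scale_c[of "-1"] C(1) unfolding continuous_map_def by blast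
    have Dm: "x \<in> D \<longleftrightarrow> x \<in> E \<and> - x \<in> C" for x by (simp add: D_def E_def)
    have CE: "C \<subseteq> E" using C(1) openin_subset E_def by blast
    have "convex D"
      unfolding convex_def
    proof (intro ballI allI impI)
      fix x y and u v :: real assume *: "x \<in> D" "y \<in> D" "0 \<le> u" "0 \<le> v" "u + v = 1"
      have "u *\<^sub>R (- x) + v *\<^sub>R (- y) \<in> C" using * Dm by (intro convexD[OF C(3)]) auto
      then show "u *\<^sub>R x + v *\<^sub>R y \<in> D" using * by (auto simp: Dm intro: Eadd Escale)
    qed
    moreover have "- x \<in> C \<inter> D" if "x \<in> C \<inter> D" for x
      using that CE Dm subspace_neg[OF E] by auto
    ultimately have "C \<inter> D \<in> N"
      using C D subspace_0[OF E] by (auto simp: N_def Dm intro: convex_Int)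
    then show ?thesis using C(4) by blast
  qed
  have Nint: "W \<inter> W' \<in> N" if "W \<in> N" "W' \<in> N" for W W'
    using that by (auto simp: N_def intro: convex_Int)
  have Nhalf: "\<exists>V\<in>N. \<forall>x\<in>V. \<forall>y\<in>V. x + y \<in> W" if W: "W \<in> N" for W
  proof -
    have "openin (prod_topology X X) {z \<in> topspace (prod_topology X X). (case z of (x, y) \<Rightarrow> x + y) \<in> W}"
      using plus Nopen[OF W] unfolding continuous_map_def by blast
    moreover have "(0, 0) \<in> {z \<in> topspace (prod_topology X X). (case z of (x, y) \<Rightarrow> x + y) \<in> W}"
      using N0[OF W] subspace_0[OF E] by (simp add: E_def)
    ultimately obtain U V where UV: "openin X U" "openin X V" "0 \<in> U" "0 \<in> V"
      "U \<times> V \<subseteq> {z \<in> topspace (prod_topology X X). (case z of (x, y) \<Rightarrow> x + y) \<in> W}"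
      unfolding openin_prod_topology_alt by meson
    obtain D where D: "D \<in> N" "D \<subseteq> U \<inter> V" using Nsub[of "U \<inter> V"] UV by auto
    have "x + y \<in> W" if "x \<in> D" "y \<in> D" for x y
    proof -
      have "(x, y) \<in> U \<times> V" using D(2) that by auto
      from subsetD[OF UV(5) this] show ?thesis by simp
    qed
    then show ?thesis using D by blast
  qed
  have Nfour: "\<exists>V\<in>N. \<forall>x\<in>V. \<forall>y\<in>V. \<forall>z\<in>V. \<forall>w\<in>V. x + y + z + w \<in> W" if W: "W \<in> N" for W
  proof -
    obtain V where V: "V \<in> N" "\<forall>x\<in>V. \<forall>y\<in>V. x + y \<in> W" using Nhalf[OF W] by blast
    obtain D where D: "D \<in> N" "\<forall>x\<in>D. \<forall>y\<in>D. x + y \<in> V" using Nhalf[OF V(1)] by blast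
    have "x + y + z + w \<in> W" if "x \<in> D" "y \<in> D" "z \<in> D" "w \<in> D" for x y z w
    proof -
      have "x + y \<in> V" "z + w \<in> V" using D(2) that by simp_all
      then have "(x + y) + (z + w) \<in> W" using V(2) by simp
      then show ?thesis by (simp add: add.assoc)
    qed
    then show ?thesis using D by blast
  qed
  have Nscale: "\<exists>V\<in>N. \<forall>x\<in>V. c *\<^sub>R x \<in> W" if W: "W \<in> N" for W c
  proof -
    have "openin X {x \<in> topspace X. c *\<^sub>R x \<in> W}"
      using scale_c[of c] Nopen[OF W] unfolding continuous_map_def by blast
    then obtain V where "V \<in> N" "V \<subseteq> {x \<in> topspace X. c *\<^sub>R x \<in> W}"
      using Nsub N0[OF W] subspace_0[OF E] by (force simp: E_def)
    then show ?thesis by blast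
  qed
  have Nshrink: "c *\<^sub>R x \<in> W" if "W \<in> N" "x \<in> W" "0 \<le> c" "c \<le> 1" for W x c
    using convexD[OF Nconvex[OF that(1)] that(2) N0[OF that(1)], of c "1 - c"] that by simp

  define ev where "ev P \<longleftrightarrow> (\<exists>W\<in>N. \<forall>A\<in>N. A \<subseteq> W \<longrightarrow> P A)" for P
  have ev_all: "ev P" if "\<And>A. P A" for P using EN that by (auto simp: ev_def)
  have ev_ex: "\<exists>A\<in>N. P A" if "ev P" for P using that by (auto simp: ev_def)
  have ev_mono: "ev Q" if "ev P" "\<And>A. P A \<Longrightarrow> Q A" for P Q
    using that unfolding ev_def by blast
  have ev_conj: "ev (\<lambda>A. P A \<and> Q A)" if P: "ev P" and Q: "ev Q" for P Q
  proof -
    obtain W where W: "W \<in> N" "\<forall>A\<in>N. A \<subseteq> W \<longrightarrow> P A" using P unfolding ev_def by blast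
    obtain W' where W': "W' \<in> N" "\<forall>A\<in>N. A \<subseteq> W' \<longrightarrow> Q A" using Q unfolding ev_def by blast
    have "\<forall>A\<in>N. A \<subseteq> W \<inter> W' \<longrightarrow> P A \<and> Q A" using W W' by blast
    then show ?thesis unfolding ev_def using Nint[OF W(1) W'(1)] by blast
  qed
  have ev_two: "ev R" if "ev P" "ev Q" "\<And>A. P A \<Longrightarrow> Q A \<Longrightarrow> R A" for P Q R
    using ev_mono[OF ev_conj[OF that(1,2)]] that(3) by blast

  define CC where "CC = {c::'v set \<Rightarrow> 'v. (\<forall>A. c A \<in> E) \<and>
    (\<forall>W\<in>N. \<exists>V\<in>N. \<forall>A\<in>N. A \<subseteq> V \<longrightarrow> ev (\<lambda>B. c B - c A \<in> W))}"
  define NN where "NN = {c::'v set \<Rightarrow> 'v. (\<forall>A. c A \<in> E) \<and> (\<forall>W\<in>N. ev (\<lambda>A. c A \<in> W))}"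
  have CCE: "c A \<in> E" if "c \<in> CC" for c A using that by (simp add: CC_def)
  have NNev: "ev (\<lambda>A. c A \<in> W)" if "c \<in> NN" "W \<in> N" for c W using that by (simp add: NN_def)
  have NNE: "c A \<in> E" if "c \<in> NN" for c A using that by (simp add: NN_def)
  have CCev: "\<exists>V\<in>N. \<forall>A\<in>N. A \<subseteq> V \<longrightarrow> ev (\<lambda>B. c B - c A \<in> W)" if "c \<in> CC" "W \<in> N" for c W
    using that by (simp add: CC_def)
  have subNN: "subspace NN"
    unfolding subspace_def
  proof (intro conjI ballI allI)
    show "0 \<in> NN" using subspace_0[OF E] N0 by (auto simp: NN_def intro: ev_all)
    fix c d assume cd: "c \<in> NN" "d \<in> NN"
    have "ev (\<lambda>A. (c + d) A \<in> W)" if W: "W \<in> N" for W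
    proof -
      obtain V where V: "V \<in> N" "\<forall>x\<in>V. \<forall>y\<in>V. x + y \<in> W" using Nhalf[OF W] by blast
      show ?thesis
        by (rule ev_two[OF NNev[OF cd(1) V(1)] NNev[OF cd(2) V(1)]]) (use V(2) in simp)
    qed
    then show "c + d \<in> NN" using cd by (simp add: NN_def Eadd)
  next
    fix c and r :: real assume c: "c \<in> NN"
    have "ev (\<lambda>A. (r *\<^sub>R c) A \<in> W)" if W: "W \<in> N" for W
    proof -
      obtain V where V: "V \<in> N" "\<forall>x\<in>V. r *\<^sub>R x \<in> W" using Nscale[OF W] by blast
      show ?thesis by (rule ev_mono[OF NNev[OF c V(1)]]) (use V(2) in simp)
    qed
    then show "r *\<^sub>R c \<in> NN" using c by (simp add: NN_def Escale)
  qed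
  have NNCC: "c \<in> CC" if c: "c \<in> NN" for c
  proof -
    have "\<exists>V\<in>N. \<forall>A\<in>N. A \<subseteq> V \<longrightarrow> ev (\<lambda>B. c B - c A \<in> W)" if W: "W \<in> N" for W
    proof -
      obtain V where V: "V \<in> N" "\<forall>x\<in>V. \<forall>y\<in>V. x + y \<in> W" using Nhalf[OF W] by blast
      obtain V0 where V0: "V0 \<in> N" "\<forall>A\<in>N. A \<subseteq> V0 \<longrightarrow> c A \<in> V"
        using NNev[OF c V(1)] unfolding ev_def by blast
      have "ev (\<lambda>B. c B - c A \<in> W)" if A: "A \<in> N" "A \<subseteq> V0" for A
      proof (rule ev_mono[OF NNev[OF c V(1)]])
        fix B assume "c B \<in> V"
        then have "c B + - c A \<in> W" using V V0 A Nneg[OF V(1)] by blast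
        then show "c B - c A \<in> W" by simp
      qed
      then show ?thesis using V0 by blast
    qed
    then show ?thesis using c by (simp add: CC_def NN_def)
  qed
  have subCC: "subspace CC"
    unfolding subspace_def
  proof (intro conjI ballI allI)
    show "0 \<in> CC" using NNCC subspace_0[OF subNN] by blast
    fix c d assume cd: "c \<in> CC" "d \<in> CC"
    have "\<exists>V\<in>N. \<forall>A\<in>N. A \<subseteq> V \<longrightarrow> ev (\<lambda>B. (c + d) B - (c + d) A \<in> W)" if W: "W \<in> N" for W
    proof -
      obtain V where V: "V \<in> N" "\<forall>x\<in>V. \<forall>y\<in>V. x + y \<in> W" using Nhalf[OF W] by blast
      obtain C where C: "C \<in> N" "\<forall>A\<in>N. A \<subseteq> C \<longrightarrow> ev (\<lambda>B. c B - c A \<in> V)"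
        using CCev[OF cd(1) V(1)] by blast
      obtain D where D: "D \<in> N" "\<forall>A\<in>N. A \<subseteq> D \<longrightarrow> ev (\<lambda>B. d B - d A \<in> V)"
        using CCev[OF cd(2) V(1)] by blast
      have "ev (\<lambda>B. (c + d) B - (c + d) A \<in> W)" if A: "A \<in> N" "A \<subseteq> C \<inter> D" for A
      proof (rule ev_two)
        show "ev (\<lambda>B. c B - c A \<in> V)" "ev (\<lambda>B. d B - d A \<in> V)" using A C D by auto
        fix B assume "c B - c A \<in> V" "d B - d A \<in> V"
        then have "(c B - c A) + (d B - d A) \<in> W" using V by blast
        then show "(c + d) B - (c + d) A \<in> W" by (simp add: algebra_simps)
      qed
      then show ?thesis using Nint[OF C(1) D(1)] by blast
    qed
    then show "c + d \<in> CC" using cd by (simp add: CC_def Eadd)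
  next
    fix c and r :: real assume c: "c \<in> CC"
    have "\<exists>V\<in>N. \<forall>A\<in>N. A \<subseteq> V \<longrightarrow> ev (\<lambda>B. (r *\<^sub>R c) B - (r *\<^sub>R c) A \<in> W)" if W: "W \<in> N" for W
    proof -
      obtain V where V: "V \<in> N" "\<forall>x\<in>V. r *\<^sub>R x \<in> W" using Nscale[OF W] by blast
      obtain C where C: "C \<in> N" "\<forall>A\<in>N. A \<subseteq> C \<longrightarrow> ev (\<lambda>B. c B - c A \<in> V)"
        using CCev[OF c V(1)] by blast
      have "ev (\<lambda>B. (r *\<^sub>R c) B - (r *\<^sub>R c) A \<in> W)" if A: "A \<in> N" "A \<subseteq> C" for A
      proof (rule ev_mono)
        show "ev (\<lambda>B. c B - c A \<in> V)" using A C by auto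
        fix B assume "c B - c A \<in> V"
        then have "r *\<^sub>R (c B - c A) \<in> W" using V by blast
        then show "(r *\<^sub>R c) B - (r *\<^sub>R c) A \<in> W" by (simp add: scaleR_diff_right)
      qed
      then show ?thesis using C by blast
    qed
    then show "r *\<^sub>R c \<in> CC" using c by (simp add: CC_def Escale)
  qed

  obtain g :: "('v set \<Rightarrow> 'v) \<Rightarrow> ('v set \<Rightarrow> 'v)" where g: "linear g" "\<And>c. g c \<in> NN" "\<And>c. c \<in> NN \<Longrightarrow> g c = c"
    using linear_exists_left_inverse_on[OF linear_id subNN inj_on_id] by (auto simp: id_def)
  define L where "L = {c \<in> CC. g c = 0}"
  define pr where "pr c = c - g c" for c
  have g0: "g 0 = 0" by (simp add: linear_0[OF g(1)])
  have prL: "pr c \<in> L" if "c \<in> CC" for c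
    using that subspace_diff[OF subCC] NNCC g by (simp add: L_def pr_def linear_diff)
  have subL: "subspace L"
    using subCC g0 by (auto simp: L_def subspace_def linear_add[OF g(1)] linear_scale[OF g(1)])
  have LCC: "c \<in> CC" if "c \<in> L" for c using that by (simp add: L_def)
  have LNN: "c = 0" if "c \<in> L" "c \<in> NN" for c using that g(3)[of c] by (simp add: L_def)
  define Wt where "Wt W = {c \<in> L. ev (\<lambda>A. c A \<in> W)}" for W
  have WtI: "c \<in> Wt W" if "c \<in> L" "ev (\<lambda>A. c A \<in> W)" for c W using that by (simp add: Wt_def)
  have Wtev: "ev (\<lambda>A. c A \<in> W)" if "c \<in> Wt W" for c W using that by (simp add: Wt_def)
  have WtL: "c \<in> L" if "c \<in> Wt W" for c W using that by (simp add: Wt_def)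
  define T where "T = topology (\<lambda>G. G \<subseteq> L \<and> (\<forall>x\<in>G. \<exists>A\<in>Wt ` N. \<forall>a\<in>A. x + a \<in> G))"

  have b1: "Wt ` N \<noteq> {}" using EN by blast
  have b2: "A \<subseteq> L \<and> 0 \<in> A \<and> convex A \<and> (\<forall>x\<in>A. - x \<in> A)" if "A \<in> Wt ` N" for A
  proof -
    obtain W where W: "W \<in> N" "A = Wt W" using \<open>A \<in> Wt ` N\<close> by blast
    have "Wt W \<subseteq> L" by (auto simp: Wt_def)
    moreover have "0 \<in> Wt W"
      using subspace_0[OF subL] N0[OF W(1)] by (auto intro!: WtI ev_all)
    moreover have "convex (Wt W)"
      unfolding convex_def
    proof (intro ballI allI impI)
      fix x y and u v :: real assume *: "x \<in> Wt W" "y \<in> Wt W" "0 \<le> u" "0 \<le> v" "u + v = 1"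
      have "ev (\<lambda>A. (u *\<^sub>R x + v *\<^sub>R y) A \<in> W)"
        by (rule ev_two[OF Wtev[OF *(1)] Wtev[OF *(2)]])
          (use convexD[OF Nconvex[OF W(1)]] * in simp)
      then show "u *\<^sub>R x + v *\<^sub>R y \<in> Wt W"
        using * WtL by (intro WtI) (auto intro!: subspace_add[OF subL] subspace_scale[OF subL])
    qed
    moreover have "- x \<in> Wt W" if "x \<in> Wt W" for x
    proof (rule WtI)
      show "- x \<in> L" using that WtL subspace_neg[OF subL] by blast
      show "ev (\<lambda>A. (- x) A \<in> W)"
        by (rule ev_mono[OF Wtev[OF that]]) (use Nneg[OF W(1)] in simp)
    qed
    ultimately show ?thesis using W by blast
  qed
  have Wtmono: "Wt W \<subseteq> Wt W'" if "W \<subseteq> W'" for W W'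
    unfolding Wt_def using that by (auto elim: ev_mono)
  have b3: "\<exists>C\<in>Wt ` N. C \<subseteq> A \<and> C \<subseteq> A'" if AA': "A \<in> Wt ` N" "A' \<in> Wt ` N" for A A'
  proof -
    obtain W W' where W: "W \<in> N" "A = Wt W" "W' \<in> N" "A' = Wt W'" using AA' by blast
    show ?thesis
      using Nint[OF W(1,3)] Wtmono[of "W \<inter> W'" W] Wtmono[of "W \<inter> W'" W'] W by blast
  qed
  have Wthalf: "x + y \<in> Wt W" if "x \<in> Wt V" "y \<in> Wt V" "\<forall>x\<in>V. \<forall>y\<in>V. x + y \<in> W" for x y V W
  proof (rule WtI)
    show "x + y \<in> L" using that WtL subspace_add[OF subL] by blast
    show "ev (\<lambda>A. (x + y) A \<in> W)"
      by (rule ev_two[OF Wtev[OF that(1)] Wtev[OF that(2)]]) (use that(3) in simp)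
  qed
  have b4: "\<exists>C\<in>Wt ` N. \<forall>x\<in>C. \<forall>y\<in>C. x + y \<in> A" if A: "A \<in> Wt ` N" for A
  proof -
    obtain W where W: "W \<in> N" "A = Wt W" using A by blast
    obtain V where V: "V \<in> N" "\<forall>x\<in>V. \<forall>y\<in>V. x + y \<in> W" using Nhalf[OF W(1)] by blast
    have "\<forall>x\<in>Wt V. \<forall>y\<in>Wt V. x + y \<in> A" using Wthalf V(2) W(2) by blast
    then show ?thesis using V(1) by blast
  qed
  have b5: "\<exists>r>0. r *\<^sub>R x \<in> A" if A: "A \<in> Wt ` N" and x: "x \<in> L" for A x
  proof -
    obtain W where W: "W \<in> N" "A = Wt W" using A by blast
    obtain V where V: "V \<in> N" "\<forall>x\<in>V. \<forall>y\<in>V. x + y \<in> W" using Nhalf[OF W(1)] by blast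
    obtain C where C: "C \<in> N" "\<forall>A\<in>N. A \<subseteq> C \<longrightarrow> ev (\<lambda>B. x B - x A \<in> V)"
      using CCev[OF LCC[OF x] V(1)] by blast
    have xC: "x C \<in> topspace X" using CCE[OF LCC[OF x]] by (simp add: E_def)
    obtain r where r: "r > 0" "\<forall>c. \<bar>c\<bar> \<le> r \<longrightarrow> c *\<^sub>R x C \<in> V"
      using locally_convex_space_absorbing[OF X Nopen[OF V(1)] N0[OF V(1)] xC] by blast
    define s where "s = min r 1"
    have s: "0 < s" "s \<le> 1" "s *\<^sub>R x C \<in> V" using r by (auto simp: s_def)
    have "ev (\<lambda>B. x B - x C \<in> V)" using C by blast
    then have "ev (\<lambda>B. (s *\<^sub>R x) B \<in> W)"
    proof (rule ev_mono)
      fix B assume "x B - x C \<in> V"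
      then have "s *\<^sub>R (x B - x C) \<in> V" using s V(1) by (intro Nshrink) auto
      then have "s *\<^sub>R (x B - x C) + s *\<^sub>R x C \<in> W" using V(2) s by blast
      then show "(s *\<^sub>R x) B \<in> W" by (simp add: scaleR_diff_right)
    qed
    then have "s *\<^sub>R x \<in> Wt W" using x subspace_scale[OF subL] by (intro WtI) auto
    then show ?thesis using s W by blast
  qed
  note base = locally_convex_space_from_base[OF subL b1 b2 b3 b4 b5, folded T_def]
  have opT: "openin T G \<longleftrightarrow> G \<subseteq> L \<and> (\<forall>x\<in>G. \<exists>W\<in>N. \<forall>a\<in>Wt W. x + a \<in> G)" for G
    using base(1)[of G] by simp
  have topT: "topspace T = L" using base(2) by simp
  have nbT: "\<exists>G. openin T G \<and> x \<in> G \<and> (\<forall>h\<in>G. h - x \<in> Wt W)" if "x \<in> L" "W \<in> N" for x W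
    using base(3)[of x "Wt W"] that by blast
  have lcsT: "locally_convex_space T" using base(4) by simp

  have "Hausdorff_space T"
    unfolding Hausdorff_space_def
  proof (intro allI impI)
    fix x y assume "x \<in> topspace T \<and> y \<in> topspace T \<and> x \<noteq> y"
    then have xy: "x \<in> L" "y \<in> L" "x \<noteq> y" using topT by auto
    have dL: "x - y \<in> L" using subspace_diff[OF subL] xy by blast
    then have "x - y \<notin> NN" using LNN[of "x - y"] xy(3) right_minus_eq[of x y] by blast
    moreover have "\<forall>A. (x - y) A \<in> E" using CCE[OF LCC[OF dL]] by blast
    ultimately obtain W where W: "W \<in> N" "\<not> ev (\<lambda>A. (x - y) A \<in> W)"
      unfolding NN_def by blast
    obtain V where V: "V \<in> N" "\<forall>x\<in>V. \<forall>y\<in>V. x + y \<in> W" using Nhalf[OF W(1)] by blast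
    obtain G where G: "openin T G" "x \<in> G" "\<forall>h\<in>G. h - x \<in> Wt V" using nbT[OF xy(1) V(1)] by blast
    obtain H where H: "openin T H" "y \<in> H" "\<forall>h\<in>H. h - y \<in> Wt V" using nbT[OF xy(2) V(1)] by blast
    have "disjnt G H"
      unfolding disjnt_iff
    proof (intro allI notI)
      fix z assume "z \<in> G \<and> z \<in> H"
      then have z: "z - x \<in> Wt V" "z - y \<in> Wt V" using G H by auto
      have "ev (\<lambda>A. (x - y) A \<in> W)"
      proof (rule ev_two[OF Wtev[OF z(1)] Wtev[OF z(2)]])
        fix A assume "(z - x) A \<in> V" "(z - y) A \<in> V"
        then have "(z - y) A + - ((z - x) A) \<in> W" using V Nneg[OF V(1)] by blast
        then show "(x - y) A \<in> W" by simp
      qed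
      then show False using W by blast
    qed
    then show "\<exists>U V. openin T U \<and> openin T V \<and> x \<in> U \<and> y \<in> V \<and> disjnt U V"
      using G H by blast
  qed

  define j where "j x = pr (\<lambda>_::'v set. x)" for x :: 'v
  have constCC: "(\<lambda>_. x) \<in> CC" if "x \<in> E" for x
    using that N0 EN by (auto simp: CC_def intro!: ev_all)
  have jL: "j x \<in> L" if "x \<in> E" for x using prL constCC[OF that] by (simp add: j_def)
  have jA: "j x A = x - g (\<lambda>_. x) A" for x A by (simp add: j_def pr_def)
  have jadd: "j (x + y) = j x + j y" for x y
  proof -
    have "(\<lambda>_::'v set. x + y) = (\<lambda>_. x) + (\<lambda>_. y)" by (simp add: fun_eq_iff)
    then show ?thesis by (simp add: j_def pr_def linear_add[OF g(1)])
  qed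
  have jscale: "j (c *\<^sub>R x) = c *\<^sub>R j x" for c x
  proof -
    have "(\<lambda>_::'v set. c *\<^sub>R x) = c *\<^sub>R (\<lambda>_. x)" by (simp add: fun_eq_iff)
    then show ?thesis by (simp add: j_def pr_def linear_scale[OF g(1)] scaleR_diff_right)
  qed
  have jdiff: "j (x - y) = j x - j y" for x y
    using jadd[of "x - y" y] by simp
  have K1: "j x \<in> Wt W" if V: "V \<in> N" "\<forall>x\<in>V. \<forall>y\<in>V. x + y \<in> W" "x \<in> V" for x V W
  proof (rule WtI)
    show "j x \<in> L" using jL NE V by blast
    show "ev (\<lambda>A. j x A \<in> W)"
    proof (rule ev_mono[OF NNev[OF g(2)[of "\<lambda>_. x"] V(1)]])
      fix A assume "g (\<lambda>_. x) A \<in> V"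
      then have "x + - g (\<lambda>_. x) A \<in> W" using V Nneg[OF V(1)] by blast
      then show "j x A \<in> W" by (simp add: jA)
    qed
  qed
  have K2: "x \<in> W" if V: "V \<in> N" "\<forall>x\<in>V. \<forall>y\<in>V. x + y \<in> W" and x: "j x \<in> Wt V" for x V W
  proof -
    have "ev (\<lambda>A. x \<in> W)"
    proof (rule ev_two[OF NNev[OF g(2)[of "\<lambda>_. x"] V(1)] Wtev[OF x]])
      fix A assume "g (\<lambda>_. x) A \<in> V" "j x A \<in> V"
      then have "j x A + g (\<lambda>_. x) A \<in> W" using V by blast
      then show "x \<in> W" by (simp add: jA)
    qed
    then show ?thesis using ev_ex by blast
  qed
  have trans: "openin X {y \<in> E. y - x \<in> W}" if "x \<in> E" "openin X W" for x W
  proof -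
    have "openin X {y \<in> topspace X. - x + y \<in> W}"
      using plus_c[of "- x"] that subspace_neg[OF E] unfolding continuous_map_def by blast
    then show ?thesis by (simp add: E_def)
  qed

  have "X = pullback_topology E j T"
    unfolding topology_eq openin_pullback_topology
  proof (intro allI iffI)
    fix G assume G: "openin X G"
    have GE: "G \<subseteq> E" using G openin_subset E_def by blast
    define H where "H = \<Union>{U. openin T U \<and> j -` U \<inter> E \<subseteq> G}"
    have "openin T H" unfolding H_def by (rule openin_Union) blast
    moreover have "G = j -` H \<inter> E"
    proof
      show "j -` H \<inter> E \<subseteq> G" unfolding H_def by blast
      show "G \<subseteq> j -` H \<inter> E"
      proof
        fix x assume x: "x \<in> G"
        then have xE: "x \<in> E" using GE by blast
        have "openin X {y \<in> E. x + y \<in> G}"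
          using plus_c[OF xE] G unfolding continuous_map_def E_def by blast
        then obtain W where W: "W \<in> N" "W \<subseteq> {y \<in> E. x + y \<in> G}"
          using Nsub[of "{y \<in> E. x + y \<in> G}"] x subspace_0[OF E] by auto
        obtain V where V: "V \<in> N" "\<forall>x\<in>V. \<forall>y\<in>V. x + y \<in> W" using Nhalf[OF W(1)] by blast
        obtain U where U: "openin T U" "j x \<in> U" "\<forall>h\<in>U. h - j x \<in> Wt V"
          using nbT[OF jL[OF xE] V(1)] by blast
        have "y \<in> G" if y: "j y \<in> U" for y
        proof -
          have "j (y - x) \<in> Wt V" using U y by (simp add: jdiff)
          then have "y - x \<in> W" using K2[OF V] by blast
          then have "x + (y - x) \<in> G" using W by blast
          then show ?thesis by simp
        qed
        then have "U \<subseteq> H" using U(1) unfolding H_def by blast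
        then show "x \<in> j -` H \<inter> E" using U xE by blast
      qed
    qed
    ultimately show "\<exists>U. openin T U \<and> G = j -` U \<inter> E" by blast
  next
    fix G assume "\<exists>U. openin T U \<and> G = j -` U \<inter> E"
    then obtain U where U: "openin T U" "G = j -` U \<inter> E" by blast
    show "openin X G"
    proof (subst openin_subopen, intro ballI)
      fix x assume x: "x \<in> G"
      then have xE: "x \<in> E" and "j x \<in> U" using U by auto
      then obtain W where W: "W \<in> N" "\<forall>a\<in>Wt W. j x + a \<in> U" using U(1) opT by blast
      obtain V where V: "V \<in> N" "\<forall>x\<in>V. \<forall>y\<in>V. x + y \<in> W" using Nhalf[OF W(1)] by blast
      have "y \<in> G" if y: "y \<in> E" "y - x \<in> V" for y
      proof -
        have "j (y - x) \<in> Wt W" using K1[OF V y(2)] .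
        then have "j x + j (y - x) \<in> U" using W by blast
        then show ?thesis using U y by (simp add: jdiff)
      qed
      then show "\<exists>S. openin X S \<and> x \<in> S \<and> S \<subseteq> G"
        using trans[OF xE Nopen[OF V(1)]] xE N0[OF V(1)]
        by (intro exI[of _ "{y \<in> E. y - x \<in> V}"]) auto
    qed
  qed
  moreover have dense: "\<exists>x\<in>E. j x - c \<in> Wt W" if c: "c \<in> L" and W: "W \<in> N" for c W
  proof -
    obtain V where V: "V \<in> N" "\<forall>x\<in>V. \<forall>y\<in>V. x + y \<in> W" using Nhalf[OF W] by blast
    obtain C where C: "C \<in> N" "\<forall>A\<in>N. A \<subseteq> C \<longrightarrow> ev (\<lambda>B. c B - c A \<in> V)"
      using CCev[OF LCC[OF c] V(1)] by blast
    have xE: "c C \<in> E" using CCE[OF LCC[OF c]] .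
    have "ev (\<lambda>A. (j (c C) - c) A \<in> W)"
    proof (rule ev_two[OF NNev[OF g(2)[of "\<lambda>_. c C"] V(1)]])
      show "ev (\<lambda>B. c B - c C \<in> V)" using C by blast
      fix A assume "g (\<lambda>_. c C) A \<in> V" "c A - c C \<in> V"
      then have "- g (\<lambda>_. c C) A + - (c A - c C) \<in> W" using V Nneg[OF V(1)] by blast
      then show "(j (c C) - c) A \<in> W" by (simp add: jA algebra_simps)
    qed
    then have "j (c C) - c \<in> Wt W" using jL[OF xE] c subspace_diff[OF subL] by (intro WtI) auto
    then show ?thesis using xE by blast
  qed
  have "T closure_of (j ` E) = topspace T"
  proof
    show "T closure_of (j ` E) \<subseteq> topspace T" by (rule closure_of_subset_topspace)
    show "topspace T \<subseteq> T closure_of (j ` E)"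
    proof
      fix c assume c: "c \<in> topspace T"
      have "\<exists>y\<in>j ` E. y \<in> U" if U: "c \<in> U" "openin T U" for U
      proof -
        obtain W where W: "W \<in> N" "\<forall>a\<in>Wt W. c + a \<in> U" using U opT by blast
        obtain x where x: "x \<in> E" "j x - c \<in> Wt W" using dense[of c W] c topT W(1) by blast
        have "c + (j x - c) \<in> U" using W x by blast
        then show ?thesis using x by auto
      qed
      then show "c \<in> T closure_of (j ` E)" using c by (auto simp: in_closure_of)
    qed
  qed
  moreover have "complete_lcs T"
    unfolding complete_lcs_def
  proof (intro conjI allI impI lcsT)
    fix \<F> assume F: "cauchy_filter_in T \<F>"
    have Fbot: "\<F> \<noteq> bot" and FL: "eventually (\<lambda>x. x \<in> L) \<F>"
      using F by (auto simp: cauchy_filter_in_def topT)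
    have "\<exists>S. eventually (\<lambda>x. x \<in> S) \<F> \<and> S \<subseteq> L \<and> (\<forall>x\<in>S. \<forall>y\<in>S. x - y \<in> Wt W)" if W: "W \<in> N" for W
    proof -
      obtain G where G: "openin T G" "0 \<in> G" "\<forall>h\<in>G. h - 0 \<in> Wt W"
        using nbT[OF subspace_0[OF subL] W] by blast
      obtain S where S: "eventually (\<lambda>x. x \<in> S) \<F>" "\<forall>x\<in>S. \<forall>y\<in>S. x - y \<in> G"
        using F G(1,2) unfolding cauchy_filter_in_def by blast
      have "eventually (\<lambda>x. x \<in> S \<inter> L) \<F>" using eventually_conj[OF S(1) FL] by simp
      moreover have "\<forall>x\<in>S \<inter> L. \<forall>y\<in>S \<inter> L. x - y \<in> Wt W" using S(2) G(3) by (metis IntD1 diff_zero)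
      ultimately show ?thesis by blast
    qed
    then obtain S where S: "\<And>W. W \<in> N \<Longrightarrow> eventually (\<lambda>x. x \<in> S W) \<F>"
      "\<And>W. W \<in> N \<Longrightarrow> S W \<subseteq> L" "\<And>W x y. W \<in> N \<Longrightarrow> x \<in> S W \<Longrightarrow> y \<in> S W \<Longrightarrow> x - y \<in> Wt W"
      by metis
    have "\<exists>c x. c \<in> S W \<and> x \<in> E \<and> j x - c \<in> Wt W" if W: "W \<in> N" for W
    proof -
      obtain c where c: "c \<in> S W" using eventually_happens'[OF Fbot S(1)[OF W]] by blast
      then show ?thesis using dense[of c W] S(2)[OF W] W by blast
    qed
    then obtain c x0 where cx: "\<And>W. W \<in> N \<Longrightarrow> c W \<in> S W" "\<And>W. W \<in> N \<Longrightarrow> x0 W \<in> E"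
      "\<And>W. W \<in> N \<Longrightarrow> j (x0 W) - c W \<in> Wt W"
      by metis
    define xx where "xx A = (if A \<in> N then x0 A else 0)" for A
    have xxE: "xx A \<in> E" for A using cx(2) subspace_0[OF E] by (simp add: xx_def)
    have near: "\<exists>V\<in>N. \<forall>A\<in>N. \<forall>B\<in>N. A \<subseteq> V \<longrightarrow> B \<subseteq> V \<longrightarrow> xx B - xx A \<in> W" if W: "W \<in> N" for W
    proof -
      obtain V where V: "V \<in> N" "\<forall>x\<in>V. \<forall>y\<in>V. x + y \<in> W" using Nhalf[OF W] by blast
      obtain D where D: "D \<in> N" "\<forall>x\<in>D. \<forall>y\<in>D. \<forall>z\<in>D. \<forall>w\<in>D. x + y + z + w \<in> V"
        using Nfour[OF V(1)] by blast
      have "xx B - xx A \<in> W" if AB: "A \<in> N" "B \<in> N" "A \<subseteq> D" "B \<subseteq> D" for A B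
      proof -
        obtain z where z: "z \<in> S A" "z \<in> S B"
          using eventually_happens'[OF Fbot eventually_conj[OF S(1)[OF AB(1)] S(1)[OF AB(2)]]] by blast
        have t: "j (x0 B) - c B \<in> Wt D" "c B - z \<in> Wt D" "z - c A \<in> Wt D" "j (x0 A) - c A \<in> Wt D"
          using Wtmono[OF AB(3)] Wtmono[OF AB(4)] cx(3) S(3) AB(1,2) cx(1) z by blast+
        have "j (x0 B - x0 A) \<in> Wt V"
        proof (rule WtI)
          show "j (x0 B - x0 A) \<in> L" using cx(2) AB Ediff by (intro jL) blast
          show "ev (\<lambda>K. j (x0 B - x0 A) K \<in> V)"
          proof (rule ev_two[OF ev_conj[OF Wtev[OF t(1)] Wtev[OF t(2)]] ev_conj[OF Wtev[OF t(3)] Wtev[OF t(4)]]])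
            fix K assume k: "(j (x0 B) - c B) K \<in> D \<and> (c B - z) K \<in> D"
              "(z - c A) K \<in> D \<and> (j (x0 A) - c A) K \<in> D"
            then have "(j (x0 B) - c B) K + (c B - z) K + (z - c A) K + - ((j (x0 A) - c A) K) \<in> V"
              using D Nneg[OF D(1)] by blast
            then show "j (x0 B - x0 A) K \<in> V" by (simp add: jdiff)
          qed
        qed
        then show ?thesis using K2[OF V] AB by (simp add: xx_def)
      qed
      then show ?thesis using D(1) by blast
    qed
    have "xx \<in> CC"
    proof -
      have "\<exists>V\<in>N. \<forall>A\<in>N. A \<subseteq> V \<longrightarrow> ev (\<lambda>B. xx B - xx A \<in> W)" if W: "W \<in> N" for W
        using near[OF W] unfolding ev_def by meson
      then show ?thesis using xxE by (simp add: CC_def)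
    qed
    then have lL: "pr xx \<in> L" by (rule prL)
    have "limitin T (\<lambda>x. x) (pr xx) \<F>"
      unfolding limitin_def
    proof (intro conjI allI impI)
      show "pr xx \<in> topspace T" using lL topT by simp
      fix U assume U: "openin T U \<and> pr xx \<in> U"
      then obtain W where W: "W \<in> N" "\<forall>a\<in>Wt W. pr xx + a \<in> U" using opT by blast
      obtain V where V: "V \<in> N" "\<forall>x\<in>V. \<forall>y\<in>V. \<forall>z\<in>V. \<forall>w\<in>V. x + y + z + w \<in> W"
        using Nfour[OF W(1)] by blast
      obtain D where D: "D \<in> N" "\<forall>x\<in>D. \<forall>y\<in>D. \<forall>z\<in>D. \<forall>w\<in>D. x + y + z + w \<in> V"
        using Nfour[OF V(1)] by blast
      obtain Q where Q: "Q \<in> N" "\<forall>A\<in>N. \<forall>B\<in>N. A \<subseteq> Q \<longrightarrow> B \<subseteq> Q \<longrightarrow> xx B - xx A \<in> D"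
        using near[OF D(1)] by blast
      define A where "A = Q \<inter> V"
      have A: "A \<in> N" "A \<subseteq> Q" "A \<subseteq> V" using Nint Q(1) V(1) by (auto simp: A_def)
      have evx: "ev (\<lambda>B. xx B - xx A \<in> D)" unfolding ev_def using Q A by blast
      have "z \<in> U" if z: "z \<in> S A" for z
      proof -
        have t: "z - c A \<in> Wt V" "j (x0 A) - c A \<in> Wt V"
          using S(3)[OF A(1) z cx(1)[OF A(1)]] cx(3)[OF A(1)] Wtmono[OF A(3)] by blast+
        have "ev (\<lambda>B. (j (x0 A) - pr xx) B \<in> V)"
        proof (rule ev_two[OF evx ev_conj[OF NNev[OF g(2)[of "\<lambda>_. x0 A"] D(1)] NNev[OF g(2)[of xx] D(1)]]])
          fix B assume k: "xx B - xx A \<in> D" "g (\<lambda>_. x0 A) B \<in> D \<and> g xx B \<in> D"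
          have "- (xx B - xx A) + - g (\<lambda>_. x0 A) B + g xx B + 0 \<in> V"
            using D(2) k Nneg[OF D(1)] N0[OF D(1)] by blast
          then show "(j (x0 A) - pr xx) B \<in> V"
            using A(1) by (simp add: jA pr_def xx_def algebra_simps)
        qed
        then have "ev (\<lambda>B. (z - pr xx) B \<in> W)"
        proof (rule ev_two[OF _ ev_conj[OF Wtev[OF t(1)] Wtev[OF t(2)]]])
          fix B assume k: "(j (x0 A) - pr xx) B \<in> V" "(z - c A) B \<in> V \<and> (j (x0 A) - c A) B \<in> V"
          have "(j (x0 A) - pr xx) B + (z - c A) B + - ((j (x0 A) - c A) B) + 0 \<in> W"
            using V(2) k Nneg[OF V(1)] N0[OF V(1)] by blast
          then show "(z - pr xx) B \<in> W" by simp
        qed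
        moreover have "z - pr xx \<in> L" using S(2)[OF A(1)] z lL subspace_diff[OF subL] by blast
        ultimately have "pr xx + (z - pr xx) \<in> U" using W(2) WtI by blast
        then show ?thesis by simp
      qed
      then show "eventually (\<lambda>x. x \<in> U) \<F>"
        by (rule eventually_mono[OF S(1)[OF A(1)]])
    qed
    then show "\<exists>l. limitin T (\<lambda>x. x) l \<F>" by blast
  qed
  moreover have "linear_on (topspace X) j" by (simp add: linear_on_def jadd jscale)
  moreover have "j ` topspace X \<subseteq> topspace T" using jL topT by (auto simp: E_def)
  ultimately show ?thesis
    using \<open>Hausdorff_space T\<close> unfolding is_completion_def E_def
    by (intro exI[of _ T] exI[of _ j] conjI) auto
qed


section \<open>The exterior powers\<close>

text \<open>\<^typ>\<open>real^('n set)\<close> is the exterior algebra of \<^typ>\<open>real^'n\<close>: the coordinate at \<open>I\<close>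
  belongs to the basis element \<open>e\<^sub>I = e\<^bsub>i\<^sub>0\<^esub> \<and> \<dots> \<and> e\<^bsub>i\<^sub>m\<^esub>\<close>, where the elements of \<open>I\<close> are listed in the
  order induced by \<^const>\<open>to_nat\<close>. Another ordering of the index type only changes signs of
  basis elements.\<close>

definition kvectors :: "nat \<Rightarrow> (real^('n::finite set)) set" where
  "kvectors k = {\<alpha>. \<forall>I. card I \<noteq> k \<longrightarrow> \<alpha> $ I = 0}"

definition nat_det :: "nat \<Rightarrow> (nat \<Rightarrow> nat \<Rightarrow> real) \<Rightarrow> real" where
  "nat_det k A = (\<Sum>\<pi> | \<pi> permutes {..<k}. of_int (sign \<pi>) * (\<Prod>i<k. A i (\<pi> i)))"

definition wedge :: "nat \<Rightarrow> (nat \<Rightarrow> real^'n) \<Rightarrow> real^('n::finite set)" where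
  "wedge k v = (\<chi> I. if card I = k
     then nat_det k (\<lambda>i j. v i $ (sorted_key_list_of_set to_nat I ! j)) else 0)"

text \<open>The simple \<open>k\<close>-vectors are the \<open>c *\<^sub>R wedge k v\<close>; the scalar \<open>c\<close> only matters for
  \<open>k = 0\<close>, where the empty wedge is \<open>1\<close> and every scalar is simple.
  The Euclidean \<open>k\<close>-volume is given by the Gram determinant.\<close>

definition kvolume :: "nat \<Rightarrow> (nat \<Rightarrow> real^'n::finite) \<Rightarrow> real" where
  "kvolume k v = sqrt (nat_det k (\<lambda>i j. v i \<bullet> v j))"

definition mass_norm :: "nat \<Rightarrow> real^('n::finite set) \<Rightarrow> real" where
  "mass_norm k \<alpha> = Inf {\<Sum>i<m. \<bar>c i\<bar> * kvolume k (v i) | (m::nat) c v.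
     \<alpha> = (\<Sum>i<m. c i *\<^sub>R wedge k (v i))}"


section \<open>Pointed chains and differential forms\<close>

type_synonym 'n chain = "real^'n \<Rightarrow> real^('n set)"

definition pointed_chains :: "nat \<Rightarrow> (real^'n::finite) set \<Rightarrow> 'n chain set" where
  "pointed_chains k U = {A. finite {p. A p \<noteq> 0} \<and> {p. A p \<noteq> 0} \<subseteq> U \<and> range A \<subseteq> kvectors k}"

definition element :: "real^'n::finite \<Rightarrow> real^('n set) \<Rightarrow> 'n chain" where
  "element p \<alpha> = (\<lambda>q. if q = p then \<alpha> else 0)"

type_synonym 'n form = "real^'n \<Rightarrow> real^('n set) \<Rightarrow> real"

definition chain_integral :: "'n::finite chain \<Rightarrow> 'n form \<Rightarrow> real" where
  "chain_integral A \<omega> = (\<Sum>p | A p \<noteq> 0. \<omega> p (A p))"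

primrec Ck_on :: "nat \<Rightarrow> 'a::real_normed_vector set \<Rightarrow> ('a \<Rightarrow> real) \<Rightarrow> bool" where
  "Ck_on 0 U f \<longleftrightarrow> continuous_on U f"
| "Ck_on (Suc r) U f \<longleftrightarrow> (\<forall>x\<in>U. f differentiable (at x)) \<and>
     (\<forall>v. Ck_on r U (\<lambda>x. frechet_derivative f (at x) v))"

text \<open>Only the values \<open>\<omega> p \<alpha>\<close> for \<open>p \<in> U\<close> and \<open>\<alpha> \<in> kvectors k\<close> matter.\<close>

definition smooth_form :: "nat \<Rightarrow> (real^'n::finite) set \<Rightarrow> 'n form \<Rightarrow> bool" where
  "smooth_form k U \<omega> \<longleftrightarrow> (\<forall>p\<in>U. linear_on (kvectors k) (\<omega> p)) \<and>
     (\<forall>\<alpha>\<in>kvectors k. \<forall>r. Ck_on r U (\<lambda>p. \<omega> p \<alpha>))"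

text \<open>The flow of a constant field \<open>v\<close> is translation by \<open>t *\<^sub>R v\<close>, which acts trivially on
  \<open>k\<close>-vectors.\<close>

definition lie_deriv :: "real^'n::finite \<Rightarrow> 'n form \<Rightarrow> 'n form" where
  "lie_deriv v \<omega> = (\<lambda>p \<alpha>. deriv (\<lambda>t::real. \<omega> (p + t *\<^sub>R v) \<alpha>) 0)"

definition bounded_form :: "nat \<Rightarrow> (real^'n::finite) set \<Rightarrow> 'n form \<Rightarrow> bool" where
  "bounded_form k U \<omega> \<longleftrightarrow>
     (\<exists>C. \<forall>p\<in>U. \<forall>\<alpha>\<in>kvectors k. mass_norm k \<alpha> = 1 \<longrightarrow> \<bar>\<omega> p \<alpha>\<bar> \<le> C)"

definition B_forms :: "nat \<Rightarrow> (real^'n::finite) set \<Rightarrow> 'n form set" where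
  "B_forms k U = {\<omega>. smooth_form k U \<omega> \<and>
     (\<forall>vs. (\<forall>v\<in>set vs. norm v = 1) \<longrightarrow> bounded_form k U (foldr lie_deriv vs \<omega>))}"

text \<open>\<open>\<tau>(\<P>\<^sub>k, \<B>\<^sub>k)\<close>, where a form is regarded as a functional on chains.\<close>

definition mackey_chain_topology :: "nat \<Rightarrow> (real^'n::finite) set \<Rightarrow> 'n chain topology" where
  "mackey_chain_topology k U = mackey_topology (pointed_chains k U)
     ((\<lambda>\<omega>. restrict (\<lambda>A. chain_integral A \<omega>) (pointed_chains k U)) ` B_forms k U)"


section \<open>The characterising conditions\<close>

definition unit_elements :: "nat \<Rightarrow> (real^'n::finite) set \<Rightarrow> 'n chain set" where
  "unit_elements k U = {element p \<alpha> | p \<alpha>. p \<in> U \<and> \<alpha> \<in> kvectors k \<and> mass_norm k \<alpha> = 1}"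

definition is_prederivative ::
  "nat \<Rightarrow> (real^'n::finite) set \<Rightarrow> 'c::real_vector topology \<Rightarrow> ('n chain \<Rightarrow> 'c) \<Rightarrow>
   real^'n \<Rightarrow> ('n chain \<Rightarrow> 'c) \<Rightarrow> bool" where
  "is_prederivative k U Y \<iota> v P \<longleftrightarrow> linear_on (pointed_chains k U) P \<and>
     (\<forall>p\<in>U. \<forall>\<alpha>\<in>kvectors k.
        limitin Y (\<lambda>t::real. \<iota> (element (p + t *\<^sub>R v) (\<alpha> /\<^sub>R t) - element p (\<alpha> /\<^sub>R t)))
          (P (element p \<alpha>)) (at 0))"

text \<open>Completions are unique up to isomorphism, so it does not matter which one is used.
  By \<open>completion_exists\<close> there is always one inside the chosen type.\<close>

definition prederivatives_bounded ::
  "nat \<Rightarrow> (real^'n::finite) set \<Rightarrow> 'n chain topology \<Rightarrow> bool" where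
  "prederivatives_bounded k U \<mu> \<longleftrightarrow>
     (\<exists>(Y :: ('n chain set \<Rightarrow> 'n chain) topology) \<iota>. is_completion \<mu> Y \<iota> \<and>
        (\<forall>v. \<exists>P. is_prederivative k U Y \<iota> v P \<and> bounded_map \<mu> Y P))"

text \<open>That \<open>\<tau>\<close> is the finest topology with these properties is expressed by letting \<open>'f\<close> be
  arbitrary in the claim that \<open>\<tau>\<close> has them, and the type of chains in the hypothesis on a
  competing topology; by \<open>bounded_maps_continuous_any_type\<close> the latter yields every other \<open>'f\<close>.\<close>

definition chain_topology_conditions ::
  "'f::real_vector itself \<Rightarrow> nat \<Rightarrow> (real^'n::finite) set \<Rightarrow> 'n chain topology \<Rightarrow> bool" where
  "chain_topology_conditions F k U \<mu> \<longleftrightarrow>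
     locally_convex_space \<mu> \<and> topspace \<mu> = pointed_chains k U \<and>
     bounded_maps_continuous F \<mu> \<and>
     vn_bounded \<mu> (unit_elements k U) \<and>
     prederivatives_bounded k U \<mu>"

end

theory Submission
  imports Defs
begin

text \<open>Let \<open>\<tau>\<close> be the finest locally convex topology for which all weakly bounded sets of chains are
  bounded: its neighbourhoods of \<open>0\<close> are the absolutely convex sets that absorb the weakly bounded
  sets. By Mackey's theorem (weakly bounded sets are bounded in every locally convex space) \<open>\<tau>\<close> is
  finer than every topology whose dual is contained in \<open>\<B>\<^sub>k\<close>.

  For a topology \<open>\<mu>\<close> with (1), (2), (3) and a \<open>\<mu>\<close>-continuous functional \<open>f\<close>, property (3) makes
  \<open>f \<circ> P\<^sub>v\<close> a bounded functional, which is continuous by (1), and property (2) bounds all functionals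
  on \<open>K\<^sup>0\<close>. Hence the forms \<open>(p, \<alpha>) \<mapsto> f (p; \<alpha>)\<close> are a family of bounded forms closed under directional
  derivatives, and the members of such a family are in \<open>\<B>\<^sub>k\<close>. So \<open>\<mu>\<close> is coarser than \<open>\<tau>\<close>.

  Finally \<open>\<tau>\<close> itself satisfies (1), (2), (3). For (3), Taylor's formula bounds the integral of a form
  over the difference between two difference quotients, with a constant depending on the form times
  \<open>(|s| + |t|)\<close> times the mass of the chain; this gives the limit in the completion. The image \<open>P\<^sub>v S\<close> of
  a bounded set \<open>S\<close> is bounded because each \<open>P\<^sub>v A\<close> may be replaced by a difference quotient of \<open>A\<close>
  whose step is chosen depending on \<open>A\<close>. Consequently the dual of \<open>\<tau>\<close> is \<open>\<B>\<^sub>k\<close>, and \<open>\<tau>\<close> is the Mackey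
  topology.\<close>

section \<open>Sublinear functionals\<close>

text \<open>The Mackey topology enters only as the finest compatible topology, so the work lies in
  computing the dual of \<open>bornological_topology\<close>. A functional that is bounded on weakly
  bounded sets shows no smoothness of its own. Therefore (1), (2), (3) are verified for this
  topology before its dual is known, and the dual then comes from the argument for a general \<mu>,
  applied to \<tau> itself.

  Two failures of uniformity shape the estimates. A weakly bounded set may have unbounded mass, as
  the difference quotients of a single element do, and its supports may approach the boundary of U;
  no step t is small enough for the whole set. So the steps have to vary with the chain, tied to its
  mass and to the room that it has in U. Secondly, (3) treats each direction v on its own: neither
  linearity in v nor a bound uniform in v comes with it. A form has at first only directional
  derivatives, and differentiability is recovered along the coordinate axes from bounds on the next
  derivatives.\<close>

definition sublinear :: "('v::real_vector \<Rightarrow> real) \<Rightarrow> bool" where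
  "sublinear q \<longleftrightarrow> (\<forall>x y. q (x + y) \<le> q x + q y) \<and> (\<forall>c\<ge>0. \<forall>x. q (c *\<^sub>R x) = c * q x)"

lemma sublinear_zero: "sublinear q \<Longrightarrow> q 0 = 0"
  unfolding sublinear_def by (metis mult_zero_left order_refl scale_zero_right)

lemma sublinear_lower: "sublinear q \<Longrightarrow> - q (- x) \<le> q x"
  using sublinear_zero[of q] unfolding sublinear_def by (smt (verit) add.right_inverse)

text \<open>Provides lower bounds in the Zorn argument for \<open>hahn_banach\<close>. Finiteness of
  the infimum comes from - q (- x) \<le> - p (- x) \<le> p x. Comparability of members enters in
  subadditivity: p x + p' y is bounded below by the value at x + y of the smaller of p and
  p'.\<close>

lemma sublinear_Inf_chain:
  assumes C: "C \<noteq> {}" "\<And>p. p \<in> C \<Longrightarrow> sublinear p \<and> p \<le> q"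
    and q: "sublinear q"
    and chain: "\<And>p p'. p \<in> C \<Longrightarrow> p' \<in> C \<Longrightarrow> p \<le> p' \<or> p' \<le> p"
  defines "u \<equiv> \<lambda>x. INF p\<in>C. p x"
  shows "sublinear u" and "\<And>p. p \<in> C \<Longrightarrow> u \<le> p"
proof -
  have bdd: "bdd_below ((\<lambda>p. p x) ` C)" for x
  proof (rule bdd_belowI2)
    fix p assume "p \<in> C"
    then have "- p (- x) \<le> p x" "p (- x) \<le> q (- x)"
      using C(2)[of p] sublinear_lower by (auto simp: le_fun_def)
    then show "- q (- x) \<le> p x" by linarith
  qed
  have low: "u x \<le> p x" if "p \<in> C" for p x
    unfolding u_def using bdd that by (rule cINF_lower)
  show "\<And>p. p \<in> C \<Longrightarrow> u \<le> p" using low by (simp add: le_fun_def)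
  have add: "u (x + y) \<le> u x + u y" for x y
  proof -
    have "u (x + y) \<le> p x + p' y" if pp: "p \<in> C" "p' \<in> C" for p p'
    proof -
      obtain r where r: "r \<in> C" "r \<le> p" "r \<le> p'" using chain[OF pp] pp by blast
      have "u (x + y) \<le> r (x + y)" using low r by simp
      also have "\<dots> \<le> r x + r y" using C(2)[OF r(1)] by (simp add: sublinear_def)
      also have "\<dots> \<le> p x + p' y" using r by (simp add: le_fun_def add_mono)
      finally show ?thesis .
    qed
    then have "u (x + y) - p' y \<le> u x" if "p' \<in> C" for p'
      using cINF_greatest[OF C(1), of "u (x + y) - p' y" "\<lambda>p. p x"] that
      by (force simp: u_def algebra_simps)
    then have "u (x + y) - u x \<le> u y"
      using cINF_greatest[OF C(1), of "u (x + y) - u x" "\<lambda>p. p y"]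
      by (force simp: u_def algebra_simps)
    then show ?thesis by simp
  qed
  have le: "c * u x \<le> u (c *\<^sub>R x)" if "c \<ge> 0" for c x
  proof -
    have "c * u x \<le> p (c *\<^sub>R x)" if p: "p \<in> C" for p
      using mult_left_mono[OF low[OF p] \<open>c \<ge> 0\<close>] C(2)[OF p] \<open>c \<ge> 0\<close> by (simp add: sublinear_def)
    then show ?thesis
      using cINF_greatest[OF C(1), of "c * u x" "\<lambda>p. p (c *\<^sub>R x)"] by (simp add: u_def)
  qed
  have "u (c *\<^sub>R x) = c * u x" if c: "c \<ge> 0" for c x
  proof (cases "c = 0")
    case True
    have "p 0 = 0" if "p \<in> C" for p using C(2)[OF that] sublinear_zero by blast
    then have "u 0 = (INF p\<in>C. 0)" unfolding u_def by (intro INF_cong) auto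
    then show ?thesis using True C(1) by simp
  next
    case False
    have "inverse c * u (c *\<^sub>R x) \<le> u x" using le[of "inverse c" "c *\<^sub>R x"] False c by simp
    then show ?thesis using le[OF c, of x] False c by (simp add: field_simps)
  qed
  then show "sublinear u" using add by (simp add: sublinear_def)
qed

text \<open>The witness is the infimum over t \<ge> 0 of q (x + t a) - t q a, the largest sublinear
  functional below q that satisfies the last inequality. If q is minimal, it must coincide with q,
  and then q (- a) \<le> - q a makes q odd at a.\<close>

lemma sublinear_shift:
  assumes q: "sublinear q"
  shows "\<exists>p. sublinear p \<and> p \<le> q \<and> p (- a) \<le> - q a"
proof -
  define F where "F x = (\<lambda>t. q (x + t *\<^sub>R a) - t * q a) ` {0..}" for x
  define p where "p x = Inf (F x)" for x
  have qadd: "q (x + y) \<le> q x + q y" for x y using q by (simp add: sublinear_def)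
  have qs: "c \<ge> 0 \<Longrightarrow> q (c *\<^sub>R x) = c * q x" for c x using q by (simp add: sublinear_def)
  have bdd: "bdd_below (F x)" for x
    unfolding F_def
  proof (rule bdd_belowI2)
    fix t :: real assume "t \<in> {0..}"
    then have "t * q a = q (t *\<^sub>R a)" using qs by simp
    also have "\<dots> \<le> q (x + t *\<^sub>R a) + q (- x)" using qadd[of "x + t *\<^sub>R a" "- x"] by simp
    finally show "- q (- x) \<le> q (x + t *\<^sub>R a) - t * q a" by simp
  qed
  have low: "p x \<le> q (x + t *\<^sub>R a) - t * q a" if "t \<ge> 0" for t x
    unfolding p_def using that by (intro cInf_lower bdd) (auto simp: F_def)
  have great: "m \<le> p x" if "\<And>t. t \<ge> 0 \<Longrightarrow> m \<le> q (x + t *\<^sub>R a) - t * q a" for m x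
    unfolding p_def by (rule cInf_greatest) (use that in \<open>auto simp: F_def\<close>)
  have add: "p (x + y) \<le> p x + p y" for x y
  proof -
    have "p (x + y) \<le> (q (x + s *\<^sub>R a) - s * q a) + (q (y + t *\<^sub>R a) - t * q a)"
      if "s \<ge> 0" "t \<ge> 0" for s t
    proof -
      have "p (x + y) \<le> q (x + y + (s + t) *\<^sub>R a) - (s + t) * q a" using that by (intro low) simp
      moreover have "q (x + y + (s + t) *\<^sub>R a) \<le> q (x + s *\<^sub>R a) + q (y + t *\<^sub>R a)"
        using qadd[of "x + s *\<^sub>R a" "y + t *\<^sub>R a"] by (simp add: algebra_simps)
      ultimately show ?thesis by (simp add: algebra_simps)
    qed
    then have "p (x + y) - (q (y + t *\<^sub>R a) - t * q a) \<le> p x" if "t \<ge> 0" for t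
      using that by (intro great) (simp add: algebra_simps)
    then have "p (x + y) - p x \<le> p y" by (intro great) (simp add: algebra_simps)
    then show ?thesis by simp
  qed
  have le: "c * p x \<le> p (c *\<^sub>R x)" if c: "c > 0" for c x
  proof (rule great)
    fix t :: real assume t: "t \<ge> 0"
    have "c * p x \<le> c * (q (x + (t / c) *\<^sub>R a) - (t / c) * q a)"
      using c t by (intro mult_left_mono low) auto
    also have "\<dots> = q (c *\<^sub>R (x + (t / c) *\<^sub>R a)) - t * q a" using c
      by (subst qs) (simp_all add: right_diff_distrib)
    finally show "c * p x \<le> q (c *\<^sub>R x + t *\<^sub>R a) - t * q a" using c by (simp add: scaleR_add_right)
  qed
  have "p 0 = 0"
  proof (rule antisym)
    show "p 0 \<le> 0" using low[of 0 0] sublinear_zero[OF q] by simp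
    show "0 \<le> p 0" by (rule great) (simp add: qs)
  qed
  moreover have "p (c *\<^sub>R x) = c * p x" if c: "c > 0" for c x
  proof -
    have "inverse c * p (c *\<^sub>R x) \<le> p x" using le[of "inverse c" "c *\<^sub>R x"] c by simp
    then show ?thesis using le[OF c, of x] c by (simp add: field_simps)
  qed
  ultimately have "p (c *\<^sub>R x) = c * p x" if "c \<ge> 0" for c x
    using that by (cases "c = 0") auto
  then have "sublinear p" using add by (simp add: sublinear_def)
  moreover have "p \<le> q" using low[of 0] by (simp add: le_fun_def)
  moreover have "p (- a) \<le> - q a" using low[of 1 "- a"] sublinear_zero[OF q] by simp
  ultimately show ?thesis by blast
qed

text \<open>Hahn--Banach: a minimal sublinear functional is linear, since it cannot be lowered by
  \<open>sublinear_shift\<close>.\<close>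

theorem hahn_banach:
  fixes q :: "'v::real_vector \<Rightarrow> real"
  assumes q: "sublinear q"
  shows "\<exists>f. linear f \<and> f \<le> q \<and> f a = q a"
proof -
  \<comment> \<open>Shifting once before Zorn's lemma fixes the value at a: a linear f below
    \<open>q'\<close> has - f a = f (- a) \<le> - q a, so f a \<ge> q a.\<close>
  obtain q' where q': "sublinear q'" "q' \<le> q" "q' (- a) \<le> - q a"
    using sublinear_shift[OF q] by blast
  define \<A> where "\<A> = {p. sublinear p \<and> p \<le> q'}"
  have "\<exists>m\<in>\<A>. \<forall>p\<in>\<A>. p \<le> m \<longrightarrow> p = m"
  \<comment> \<open>The order is reversed, so a maximal element is a minimal functional.\<close>
  proof (rule predicate_Zorn)
    show "partial_order_on \<A> (relation_of (\<lambda>p p'. p' \<le> p) \<A>)"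
      by (rule partial_order_on_relation_ofI) auto
    fix C assume C: "C \<in> Chains (relation_of (\<lambda>p p'. p' \<le> p) \<A>)"
    then have CA: "p \<in> \<A>" if "p \<in> C" for p using that by (auto simp: Chains_def relation_of_def)
    have chain: "p \<le> p' \<or> p' \<le> p" if "p \<in> C" "p' \<in> C" for p p'
      using C that by (auto simp: Chains_def relation_of_def)
    show "\<exists>u\<in>\<A>. \<forall>p\<in>C. u \<le> p"
    proof (cases "C = {}")
      case True then show ?thesis using q' by (auto simp: \<A>_def)
    next
      case False
      have s: "sublinear p \<and> p \<le> q'" if "p \<in> C" for p using CA[OF that] by (simp add: \<A>_def)
      have u: "sublinear (\<lambda>x. INF p\<in>C. p x)" "\<And>p. p \<in> C \<Longrightarrow> (\<lambda>x. INF p\<in>C. p x) \<le> p"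
        by (rule sublinear_Inf_chain[OF False _ q'(1)]; use s chain in blast)+
      obtain p where p: "p \<in> C" using False by blast
      have "(\<lambda>x. INF p\<in>C. p x) \<in> \<A>"
        using u(1) order_trans[OF u(2)[OF p]] s[OF p] by (simp add: \<A>_def)
      then show ?thesis using u(2) by blast
    qed
  qed
  then obtain m where m: "sublinear m" "m \<le> q'" and min: "\<And>p. sublinear p \<Longrightarrow> p \<le> m \<Longrightarrow> p = m"
    unfolding \<A>_def by (metis (mono_tags, lifting) mem_Collect_eq order_trans)
  have neg: "m (- x) = - m x" for x
    using sublinear_shift[OF m(1), of x] min sublinear_lower[OF m(1), of x] by fastforce
  have add: "m (x + y) = m x + m y" for x y
  proof (rule antisym)
    have "m (- x + - y) \<le> m (- x) + m (- y)" using m(1) unfolding sublinear_def by blast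
    then show "m x + m y \<le> m (x + y)" using neg[of "x + y"] neg by simp
  qed (use m(1) in \<open>simp add: sublinear_def\<close>)
  have "linear m"
  proof (rule linearI[OF add])
    fix c x
    have "m (d *\<^sub>R x) = d * m x" if "d \<ge> 0" for d using m(1) that by (simp add: sublinear_def)
    from this[of c] this[of "- c"] show "m (c *\<^sub>R x) = c *\<^sub>R m x"
      using neg[of "c *\<^sub>R x"] by (cases "c \<ge> 0") auto
  qed
  moreover have "m \<le> q" using m(2) q'(2) by (rule order_trans)
  moreover have "q a \<le> m a" using le_funD[OF m(2), of "- a"] q'(3) neg[of a] by linarith
  then have "m a = q a" using \<open>m \<le> q\<close> by (simp add: antisym le_fun_def)
  ultimately show ?thesis by blast
qed

section \<open>Continuity and boundedness in locally convex spaces\<close>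

lemma convex_symmetric_scale:
  assumes "convex V" "\<forall>x\<in>V. - x \<in> V" "x \<in> V" "\<bar>c\<bar> \<le> 1"
  shows "c *\<^sub>R x \<in> V"
proof -
  have "((1 + c) / 2) *\<^sub>R x + ((1 - c) / 2) *\<^sub>R (- x) \<in> V"
    using assms by (intro convexD[OF assms(1)]) (auto simp: field_simps)
  moreover have "((1 + c) / 2) *\<^sub>R x + ((1 - c) / 2) *\<^sub>R (- x) = c *\<^sub>R x"
    by (simp add: scaleR_left_diff_distrib[symmetric] field_simps)
  ultimately show ?thesis by simp
qed

lemma openin_translate:
  assumes "locally_convex_space X" "x \<in> topspace X" "openin X W"
  shows "openin X {y \<in> topspace X. x + y \<in> W}"
proof -
  have "continuous_map X (prod_topology X X) (\<lambda>y. (x, y))"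
    using assms by (intro continuous_map_pairedI) auto
  then have "continuous_map X X ((\<lambda>(x, y). x + y) \<circ> (\<lambda>y. (x, y)))"
    using assms by (auto simp: locally_convex_space_def intro: continuous_map_compose)
  then show ?thesis using assms by (simp add: continuous_map_def o_def)
qed

lemma openin_scale:
  assumes "locally_convex_space X" "openin X W"
  shows "openin X {x \<in> topspace X. c *\<^sub>R x \<in> W}"
proof -
  have "continuous_map X (prod_topology euclideanreal X) (\<lambda>x. (c, x))"
    by (intro continuous_map_pairedI) auto
  then have "continuous_map X X ((\<lambda>(c, x). c *\<^sub>R x) \<circ> (\<lambda>x. (c, x)))"
    using assms by (auto simp: locally_convex_space_def intro: continuous_map_compose)
  then show ?thesis using assms by (simp add: continuous_map_def o_def)
qed

lemma locally_convex_space_subspace: "locally_convex_space X \<Longrightarrow> subspace (topspace X)"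
  by (simp add: locally_convex_space_def)

lemma locally_convex_space_absconvex_nbhd:
  assumes X: "locally_convex_space X" and W: "openin X W" "0 \<in> W"
  obtains V where "openin X V" "0 \<in> V" "convex V" "\<forall>x\<in>V. - x \<in> V" "V \<subseteq> W"
    "\<And>x y. x \<in> V \<Longrightarrow> y \<in> V \<Longrightarrow> x + y \<in> W"
proof -
  note sub = locally_convex_space_subspace[OF X]
  \<comment> \<open>Asking for 2 x \<in> W as well gives the sum condition: x + y is twice a
    midpoint, and midpoints remain in the convex set C.\<close>
  have "openin X (W \<inter> {x \<in> topspace X. 2 *\<^sub>R x \<in> W})" using openin_scale[OF X W(1)] W by blast
  moreover have "0 \<in> W \<inter> {x \<in> topspace X. 2 *\<^sub>R x \<in> W}" using W subspace_0[OF sub] by simp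
  ultimately obtain C where C: "openin X C" "0 \<in> C" "convex C" "C \<subseteq> W \<inter> {x \<in> topspace X. 2 *\<^sub>R x \<in> W}"
    using X unfolding locally_convex_space_def by metis
  let ?V = "C \<inter> {x \<in> topspace X. (- 1) *\<^sub>R x \<in> C}"
  have "openin X ?V" using openin_scale[OF X C(1)] C(1) by blast
  moreover have "0 \<in> ?V" using C subspace_0[OF sub] by simp
  moreover have cv: "convex ?V"
    unfolding convex_def
  proof (intro ballI allI impI)
    fix x y and u v :: real assume *: "x \<in> ?V" "y \<in> ?V" "0 \<le> u" "0 \<le> v" "u + v = 1"
    have "u *\<^sub>R x + v *\<^sub>R y \<in> C" using * by (intro convexD[OF C(3)]) auto
    moreover have "u *\<^sub>R (- x) + v *\<^sub>R (- y) \<in> C" using * by (intro convexD[OF C(3)]) auto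
    moreover have "u *\<^sub>R x + v *\<^sub>R y \<in> topspace X"
      using * by (auto intro!: subspace_add[OF sub] subspace_scale[OF sub])
    ultimately show "u *\<^sub>R x + v *\<^sub>R y \<in> ?V" by simp
  qed
  moreover have "\<forall>x\<in>?V. - x \<in> ?V" using openin_subset[OF C(1)] by (auto simp: subspace_neg[OF sub])
  moreover have "x + y \<in> W" if "x \<in> ?V" "y \<in> ?V" for x y
  proof -
    have "(1 / 2) *\<^sub>R x + (1 / 2) *\<^sub>R y \<in> C" using that by (intro convexD[OF C(3)]) auto
    then have "2 *\<^sub>R ((1 / 2) *\<^sub>R x + (1 / 2) *\<^sub>R y) \<in> W" using C(4) by blast
    then show ?thesis by (simp add: scaleR_add_right)
  qed
  ultimately show thesis using that C(4) by blast
qed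

lemma continuous_map_linear:
  assumes X: "locally_convex_space X" and F: "locally_convex_space F"
    and T: "linear_on (topspace X) T" "T ` topspace X \<subseteq> topspace F"
    and nbhd: "\<And>W. openin F W \<Longrightarrow> 0 \<in> W \<Longrightarrow> \<exists>V. openin X V \<and> 0 \<in> V \<and> T ` V \<subseteq> W"
  shows "continuous_map X F T"
  unfolding continuous_map_def
proof (intro conjI allI impI)
  note sub = locally_convex_space_subspace[OF X]
  show "T \<in> topspace X \<rightarrow> topspace F" using T by blast
  fix G assume G: "openin F G"
  show "openin X {x \<in> topspace X. T x \<in> G}"
  proof (subst openin_subopen, intro ballI)
    fix x assume "x \<in> {x \<in> topspace X. T x \<in> G}"
    then have x: "x \<in> topspace X" "T x \<in> G" by auto
    have "openin F {y \<in> topspace F. T x + y \<in> G}" using F T x G by (intro openin_translate) auto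
    moreover have "0 \<in> {y \<in> topspace F. T x + y \<in> G}"
      using x subspace_0[OF locally_convex_space_subspace[OF F]] by simp
    ultimately obtain V where V: "openin X V" "0 \<in> V" "T ` V \<subseteq> {y \<in> topspace F. T x + y \<in> G}"
      using nbhd by blast
    let ?U = "{z \<in> topspace X. - x + z \<in> V}"
    have "openin X ?U" using x by (intro openin_translate[OF X] V) (simp add: subspace_neg[OF sub])
    moreover have "x \<in> ?U" using x V by simp
    moreover have "T z \<in> G" if z: "z \<in> ?U" for z
    proof -
      have "T z = T (x + (- x + z))" by simp
      also have "\<dots> = T x + T (- x + z)"
        using x z openin_subset[OF V(1)] by (intro linear_on_add[OF T(1)]) auto
      also have "\<dots> \<in> G" using V(3) z by auto
      finally show ?thesis .
    qed
    ultimately show "\<exists>U. openin X U \<and> x \<in> U \<and> U \<subseteq> {x \<in> topspace X. T x \<in> G}"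
      by (intro exI[of _ ?U]) auto
  qed
qed

lemma locally_convex_space_euclideanreal: "locally_convex_space euclideanreal"
  unfolding locally_convex_space_def
proof (intro conjI allI impI)
  show "continuous_map (prod_topology euclideanreal euclideanreal) euclideanreal (\<lambda>(x, y). x + y)"
    unfolding case_prod_unfold by (intro continuous_map_add continuous_map_fst continuous_map_snd)
  show "continuous_map (prod_topology euclideanreal euclideanreal) euclideanreal (\<lambda>(c, x). c *\<^sub>R x)"
    unfolding case_prod_unfold real_scaleR_def
    by (intro continuous_map_real_mult continuous_map_fst continuous_map_snd)
  fix W :: "real set" assume "openin euclideanreal W \<and> 0 \<in> W"
  then obtain e where "e > 0" "ball 0 e \<subseteq> W" by (auto elim: openE)
  then show "\<exists>C. openin euclideanreal C \<and> 0 \<in> C \<and> convex C \<and> C \<subseteq> W"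
    by (intro exI[of _ "ball 0 e"]) auto
qed simp

lemma vn_bounded_euclideanreal:
  assumes "\<And>x. x \<in> S \<Longrightarrow> \<bar>x\<bar> \<le> C"
  shows "vn_bounded euclideanreal S"
  unfolding vn_bounded_def
proof (intro conjI allI impI)
  fix W :: "real set" assume "openin euclideanreal W \<and> 0 \<in> W"
  then obtain e where e: "e > 0" "ball 0 e \<subseteq> W" by (auto elim: openE)
  define r where "r = (\<bar>C\<bar> + 1) / e"
  have r: "r > 0" using e by (simp add: r_def)
  have "x \<in> (\<lambda>w. c *\<^sub>R w) ` W" if c: "r \<le> \<bar>c\<bar>" and x: "x \<in> S" for c x
  proof (rule image_eqI[of _ _ "x / c"])
    have "\<bar>x\<bar> < e * r" using assms[OF x] e by (simp add: r_def)
    also have "\<dots> \<le> e * \<bar>c\<bar>" using c e by simp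
    finally show "x / c \<in> W" using e c r by (auto simp: dist_real_def field_simps)
    show "x = c *\<^sub>R (x / c)" using c r by auto
  qed
  then show "\<exists>r>0. \<forall>c. r \<le> \<bar>c\<bar> \<longrightarrow> S \<subseteq> (\<lambda>w. c *\<^sub>R w) ` W" using r by blast
qed simp

lemma continuous_functional_nbhd:
  assumes "locally_convex_space X" "linear_on (topspace X) f" "continuous_map X euclideanreal f" "e > 0"
  shows "openin X {x \<in> topspace X. \<bar>f x\<bar> < e}" and "0 \<in> {x \<in> topspace X. \<bar>f x\<bar> < e}"
proof -
  have "openin X {x \<in> topspace X. f x \<in> {-e<..<e}}"
    using assms(3) by (rule openin_continuous_map_preimage) simp
  then show "openin X {x \<in> topspace X. \<bar>f x\<bar> < e}" by (simp add: abs_less_iff conj_commute minus_less_iff)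
  show "0 \<in> {x \<in> topspace X. \<bar>f x\<bar> < e}"
    using linear_on_scaleR[OF assms(2), of 0 0] subspace_0[OF locally_convex_space_subspace[OF assms(1)]] assms(4)
    by simp
qed

lemma vn_bounded_functional:
  assumes "locally_convex_space X" "linear_on (topspace X) f" "continuous_map X euclideanreal f"
    and "vn_bounded X S"
  shows "\<exists>C. \<forall>x\<in>S. \<bar>f x\<bar> \<le> C"
proof -
  obtain r where r: "r > 0" "S \<subseteq> (\<lambda>w. r *\<^sub>R w) ` {x \<in> topspace X. \<bar>f x\<bar> < 1}"
    using assms(4) continuous_functional_nbhd[OF assms(1-3), of 1] unfolding vn_bounded_def
    by (metis (mono_tags, lifting) abs_ge_self zero_less_one)
  have "\<bar>f x\<bar> \<le> r" if "x \<in> S" for x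
  proof -
    obtain w where "w \<in> topspace X" "\<bar>f w\<bar> < 1" "x = r *\<^sub>R w" using r(2) \<open>x \<in> S\<close> by blast
    then show ?thesis using linear_on_scaleR[OF assms(2)] r(1) by (simp add: abs_mult)
  qed
  then show ?thesis by blast
qed

section \<open>Gauges of absolutely convex sets and the boundedness of weakly bounded sets\<close>

definition minkowski :: "'v::real_vector set \<Rightarrow> 'v \<Rightarrow> real" where
  "minkowski V x = Inf {r. 0 < r \<and> (1 / r) *\<^sub>R x \<in> V}"

text \<open>The set V need not be open, so the unit ball of its gauge is located only up to its
  boundary: membership gives \<open>\<le> 1\<close>, and only \<open>< 1\<close> gives
  membership.\<close>

lemma minkowski_seminorm:
  assumes V: "convex V" "\<forall>x\<in>V. - x \<in> V" and absorbing: "\<And>x. \<exists>r>0. r *\<^sub>R x \<in> V"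
  shows "sublinear (minkowski V)" "\<And>x. minkowski V (- x) = minkowski V x"
    "\<And>x. x \<in> V \<Longrightarrow> minkowski V x \<le> 1" "\<And>x. minkowski V x < 1 \<Longrightarrow> x \<in> V" "\<And>x. minkowski V x \<ge> 0"
proof -
  let ?q = "minkowski V" and ?R = "\<lambda>x. {r. 0 < r \<and> (1 / r) *\<^sub>R x \<in> V}"
  have bdd: "bdd_below (?R x)" for x by (rule bdd_belowI[of _ 0]) simp
  have ne: "?R x \<noteq> {}" for x
  proof -
    obtain r where "r > 0" "r *\<^sub>R x \<in> V" using absorbing by blast
    then have "1 / r \<in> ?R x" by simp
    then show ?thesis by blast
  qed
  have V0: "0 \<in> V" using absorbing[of 0] by auto
  have low: "?q x \<le> r" if "r \<in> ?R x" for x r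
    unfolding minkowski_def using that bdd by (rule cInf_lower)
  show nonneg: "?q x \<ge> 0" for x
    unfolding minkowski_def by (rule cInf_greatest[OF ne]) simp
  have lt: "r \<in> ?R x" if r: "?q x < r" for x r
  proof -
    obtain s where s: "s > 0" "(1 / s) *\<^sub>R x \<in> V" "s < r"
      using cInf_lessD[OF ne, of x r] r unfolding minkowski_def by blast
    from V s(2) have "(s / r) *\<^sub>R ((1 / s) *\<^sub>R x) \<in> V"
      by (rule convex_symmetric_scale) (use s in simp)
    then show ?thesis using s by simp
  qed
  show "x \<in> V" if "?q x < 1" for x using lt[OF that] by simp
  show "?q x \<le> 1" if "x \<in> V" for x using low[of 1 x] that by simp
  have "?R (- x) = ?R x" for x using V(2) by force
  then show "?q (- x) = ?q x" for x by (simp add: minkowski_def)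
  have add: "?q (x + y) \<le> ?q x + ?q y" for x y
  proof (rule field_le_epsilon)
    fix e :: real assume e: "e > 0"
    define r s where "r = ?q x + e / 2" and "s = ?q y + e / 2"
    have r: "r > 0" "(1 / r) *\<^sub>R x \<in> V" and s: "s > 0" "(1 / s) *\<^sub>R y \<in> V"
      using lt[of x r] lt[of y s] e by (auto simp: r_def s_def)
    have "(r / (r + s)) *\<^sub>R ((1 / r) *\<^sub>R x) + (s / (r + s)) *\<^sub>R ((1 / s) *\<^sub>R y) \<in> V"
      using r s by (intro convexD[OF V(1)]) (auto simp flip: add_divide_distrib)
    then have "r + s \<in> ?R (x + y)" using r s by (simp add: scaleR_add_right)
    from low[OF this] show "?q (x + y) \<le> ?q x + ?q y + e" by (simp add: r_def s_def)
  qed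
  have q0: "?q 0 = 0"
  proof (rule antisym[OF field_le_epsilon nonneg])
    fix e :: real assume "e > 0"
    then show "?q 0 \<le> 0 + e" using low[of e 0] V0 by simp
  qed
  have le: "?q (c *\<^sub>R x) \<le> c * ?q x" if c: "c > 0" for c x
  proof (rule field_le_epsilon)
    fix e :: real assume e: "e > 0"
    define r where "r = ?q x + e / c"
    have r: "r > 0" "(1 / r) *\<^sub>R x \<in> V" using lt[of x r] e c by (auto simp: r_def)
    then have "c * r \<in> ?R (c *\<^sub>R x)" using c by simp
    from low[OF this] show "?q (c *\<^sub>R x) \<le> c * ?q x + e" using c by (simp add: r_def algebra_simps)
  qed
  have "?q (c *\<^sub>R x) = c * ?q x" if c: "c > 0" for c x
  proof -
    have "?q x \<le> inverse c * ?q (c *\<^sub>R x)" using le[of "inverse c" "c *\<^sub>R x"] c by simp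
    then show ?thesis using le[OF c, of x] c by (simp add: field_simps)
  qed
  then have "?q (c *\<^sub>R x) = c * ?q x" if "c \<ge> 0" for c x
    using that q0 by (cases "c = 0") auto
  then show "sublinear ?q" using add by (simp add: sublinear_def)
qed

text \<open>Gliding hump without completeness: the signs of the terms \<open>\<plusminus>3\<^sup>-\<^sup>n f\<^sub>n\<close> are chosen one after
  the other such that the \<open>n\<close>-th partial sum is large at \<open>x\<^sub>n\<close>; the remaining terms are too small
  to destroy this.\<close>

lemma seminorm_resonance:
  fixes q :: "'v::real_vector \<Rightarrow> real"
  assumes q: "sublinear q" and sym: "\<And>x. q (- x) = q x"
    and unbounded: "\<And>C. \<exists>x\<in>S. C < q x"
  shows "\<exists>f. linear f \<and> (\<forall>x. \<bar>f x\<bar> \<le> 2 * q x) \<and> (\<forall>C. \<exists>x\<in>S. C < \<bar>f x\<bar>)"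
proof -
  \<comment> \<open>After damping by 3^-n the term at \<open>x n\<close> still exceeds 3^n. The
    later terms add up to at most the sum of 3^-m over m > n times \<open>q (x n)\<close>, which is
    half of that term, so more than 3^n / 2 survives.\<close>
  have "\<forall>n::nat. \<exists>x. x \<in> S \<and> 9 ^ n < q x" using unbounded by blast
  then obtain x where x: "\<And>n. x n \<in> S" "\<And>n::nat. 9 ^ n < q (x n)" by metis
  have "\<forall>n. \<exists>f. linear f \<and> f \<le> q \<and> f (x n) = q (x n)" using hahn_banach[OF q] by blast
  then obtain g where g: "\<And>n::nat. linear (g n)" "\<And>n. g n \<le> q" "\<And>n. g n (x n) = q (x n)"
    by metis
  have gq: "\<bar>g n y\<bar> \<le> q y" for n y
    using g(2)[of n] sym[of y] linear_neg[OF g(1)[of n], of y] by (metis abs_le_iff le_fun_def)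
  have q0: "q y \<ge> 0" for y using gq[of 0 y] by linarith
  \<comment> \<open>\<open>s n\<close> contains the terms with index below n. For c \<ge> 0 one of a
    + c and a - c has absolute value at least c; the sign is chosen by this with a =
    \<open>s n (x n)\<close> and c = \<open>(1/3)^n * q (x n)\<close>.\<close>
  define s where "s = rec_nat (\<lambda>_. 0)
    (\<lambda>n f y. f y + (if \<bar>f (x n) + (1/3)^n * q (x n)\<bar> \<ge> (1/3)^n * q (x n) then (1/3)^n * g n y else - ((1/3)^n * g n y)))"
  have s0: "s 0 y = 0" for y by (simp add: s_def)
  have sS: "s (Suc n) y = s n y + (if \<bar>s n (x n) + (1/3)^n * q (x n)\<bar> \<ge> (1/3)^n * q (x n)
      then (1/3)^n * g n y else - ((1/3)^n * g n y))" for n y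
    by (simp add: s_def)
  have step: "\<bar>s (Suc n) y - s n y\<bar> \<le> (1/3)^n * q y" for n y
    using gq[of n y] by (auto simp: sS abs_mult)
  have hump: "\<bar>s (Suc n) (x n)\<bar> \<ge> (1/3)^n * q (x n)" for n
  proof -
    have "0 \<le> (1/3)^n * q (x n)" using q0[of "x n"] by simp
    then show ?thesis unfolding sS g(3) by (smt (verit))
  qed
  have lin: "linear (s n)" for n
  proof (induction n)
    case 0 then show ?case by (auto simp: s0 intro!: linearI)
  next
    case (Suc n)
    show ?case
      by (auto simp: sS linear_add[OF Suc] linear_scale[OF Suc] linear_add[OF g(1)] linear_scale[OF g(1)]
          algebra_simps intro!: linearI)
  qed
  have tail: "\<bar>s (n + m) y - s n y\<bar> \<le> 3/2 * ((1/3)^n - (1/3)^(n + m)) * q y" for n m y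
  proof (induction m)
    case (Suc m)
    have "\<bar>s (n + Suc m) y - s n y\<bar> \<le> (1/3)^(n + m) * q y + 3/2 * ((1/3)^n - (1/3)^(n + m)) * q y"
      using step[of "n + m" y] Suc unfolding add_Suc_right by linarith
    then show ?case by (simp add: algebra_simps)
  qed simp
  have conv: "convergent (\<lambda>n. s n y)" for y
  proof -
    have "summable (\<lambda>n. s (Suc n) y - s n y)"
      by (rule summable_comparison_test[of _ "\<lambda>n. (1/3)^n * q y"])
        (use step in \<open>auto intro!: summable_mult2 summable_geometric\<close>)
    then show ?thesis by (simp add: summable_iff_convergent sum_lessThan_telescope[of "\<lambda>n. s n y"] s0)
  qed
  define f where "f y = lim (\<lambda>n. s n y)" for y
  have f: "(\<lambda>n. s n y) \<longlonglongrightarrow> f y" for y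
    using conv by (simp add: f_def convergent_LIMSEQ_iff)
  have near: "\<bar>f y - s n y\<bar> \<le> 3/2 * (1/3)^n * q y" for n y
  proof (rule LIMSEQ_le_const2)
    show "(\<lambda>m. \<bar>s (m + n) y - s n y\<bar>) \<longlonglongrightarrow> \<bar>f y - s n y\<bar>"
      by (intro tendsto_intros LIMSEQ_ignore_initial_segment f)
    have "3/2 * ((1/3)^n - (1/3)^(n + m)) * q y \<le> 3/2 * (1/3)^n * q y" for m
      using q0[of y] by (intro mult_right_mono) auto
    then show "\<exists>N. \<forall>m\<ge>N. \<bar>s (m + n) y - s n y\<bar> \<le> 3/2 * (1/3)^n * q y"
      using order_trans[OF tail] by (metis add.commute)
  qed
  have "linear f"
  proof (rule linearI)
    fix a b and c :: real
    have "(\<lambda>n. s n (a + b)) \<longlonglongrightarrow> f a + f b" unfolding linear_add[OF lin] by (intro tendsto_add f)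
    then show "f (a + b) = f a + f b" using f LIMSEQ_unique by blast
    have "(\<lambda>n. s n (c *\<^sub>R a)) \<longlonglongrightarrow> c *\<^sub>R f a" unfolding linear_scale[OF lin] by (intro tendsto_scaleR tendsto_const f)
    then show "f (c *\<^sub>R a) = c *\<^sub>R f a" using f LIMSEQ_unique by blast
  qed
  moreover have "\<bar>f y\<bar> \<le> 2 * q y" for y using near[of y 0] q0[of y] by (simp add: s0)
  moreover have "\<exists>y\<in>S. C < \<bar>f y\<bar>" for C
  proof -
    obtain n :: nat where n: "2 * \<bar>C\<bar> < 3 ^ n" using real_arch_pow[of 3 "2 * \<bar>C\<bar>"] by auto
    have "(1/3)^n * 9^n < (1/3)^n * q (x n)" using x(2)[of n] by (intro mult_strict_left_mono) auto
    then have "3 ^ n < (1/3)^n * q (x n)" by (simp flip: power_mult_distrib)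
    moreover have "\<bar>f (x n) - s (Suc n) (x n)\<bar> \<le> 1/2 * ((1/3)^n * q (x n))"
      using near[of "x n" "Suc n"] by simp
    ultimately have "C < \<bar>f (x n)\<bar>" using hump[of n] n by linarith
    then show ?thesis using x(1) by blast
  qed
  ultimately show ?thesis by blast
qed

text \<open>This is Mackey's theorem. Were the gauge of a neighbourhood unbounded on S,
  \<open>seminorm_resonance\<close> would merge the functionals that detect this into a single one;
  it is dominated by twice the gauge, hence continuous, yet unbounded on S.\<close>

theorem weakly_bounded_imp_vn_bounded:
  fixes X :: "'v::real_vector topology"
  assumes X: "locally_convex_space X" and S: "S \<subseteq> topspace X"
    and weak: "\<And>f. linear_on (topspace X) f \<Longrightarrow> continuous_map X euclideanreal f \<Longrightarrow> \<exists>C. \<forall>x\<in>S. \<bar>f x\<bar> \<le> C"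
  shows "vn_bounded X S"
  unfolding vn_bounded_def
proof (intro conjI allI impI S)
  fix W assume W: "openin X W \<and> 0 \<in> W"
  note sub = locally_convex_space_subspace[OF X]
  obtain V where V: "openin X V" "0 \<in> V" "convex V" "\<forall>x\<in>V. - x \<in> V" "V \<subseteq> W"
    using locally_convex_space_absconvex_nbhd[OF X] W by metis
  \<comment> \<open>A linear projection onto the carrier, which extends the gauge of V to the whole
    type, where \<open>minkowski_seminorm\<close> and \<open>seminorm_resonance\<close>
    live.\<close>
  obtain g :: "'v \<Rightarrow> 'v" where g: "linear g" "\<And>x. g x \<in> topspace X" "\<And>x. x \<in> topspace X \<Longrightarrow> g x = x"
    using linear_exists_left_inverse_on[OF linear_id sub inj_on_id] by (auto simp: id_def)
  define q where "q = minkowski (g -` V)"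
  have "\<exists>r>0. r *\<^sub>R x \<in> g -` V" for x
  proof -
    obtain r where "r > 0" "\<forall>c. \<bar>c\<bar> \<le> r \<longrightarrow> c *\<^sub>R g x \<in> V"
      using locally_convex_space_absorbing[OF X V(1,2) g(2)] by blast
    then show ?thesis by (intro exI[of _ r]) (simp add: linear_scale[OF g(1)])
  qed
  then have q: "sublinear q" "\<And>x. q (- x) = q x" "\<And>x. g x \<in> V \<Longrightarrow> q x \<le> 1" "\<And>x. q x < 1 \<Longrightarrow> g x \<in> V"
    "\<And>x. q x \<ge> 0"
    using minkowski_seminorm[of "g -` V"] V(4) convex_linear_vimage[OF g(1) V(3)]
    by (auto simp: q_def linear_neg[OF g(1)])
  have qs: "q (c *\<^sub>R x) = \<bar>c\<bar> * q x" for c x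
    using q(1) q(2)[of "c *\<^sub>R x"] unfolding sublinear_def
    by (metis abs_if abs_ge_zero scaleR_minus_left)
  have "\<exists>C. \<forall>x\<in>S. q x \<le> C"
  proof (rule ccontr)
    assume "\<nexists>C. \<forall>x\<in>S. q x \<le> C"
    then have "\<And>C. \<exists>x\<in>S. C < q x" by (meson not_le)
    from seminorm_resonance[OF q(1,2) this]
    obtain f where f: "linear f" "\<And>x. \<bar>f x\<bar> \<le> 2 * q x" "\<And>C. \<exists>x\<in>S. C < \<bar>f x\<bar>" by metis
    have lin: "linear_on (topspace X) f"
      using f(1) by (simp add: linear_on_def linear_add linear_scale)
    have "continuous_map X euclideanreal f"
    proof (rule continuous_map_linear[OF X locally_convex_space_euclideanreal lin])
      fix G :: "real set" assume "openin euclideanreal G" "0 \<in> G"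
      then obtain e where e: "e > 0" "ball 0 e \<subseteq> G" by (auto elim: openE)
      \<comment> \<open>The 4 combines the bound of \<open>f\<close> by 2 q with another factor 2
        for strictness: q x \<le> e / 4 gives \<bar>f x\<bar> \<le> e / 2.\<close>
      have "\<bar>f x\<bar> < e" if "(4 / e) *\<^sub>R x \<in> V" "x \<in> topspace X" for x
      proof -
        have "q ((4 / e) *\<^sub>R x) \<le> 1" using that g by (intro q(3)) (simp add: linear_scale)
        then have "4 * q x \<le> e" using e by (simp add: qs field_simps)
        then show ?thesis using f(2)[of x] e by linarith
      qed
      then have "f ` {x \<in> topspace X. (4 / e) *\<^sub>R x \<in> V} \<subseteq> G" using e by auto
      then show "\<exists>V. openin X V \<and> 0 \<in> V \<and> f ` V \<subseteq> G"
        using openin_scale[OF X V(1), of "4 / e"] V(2) subspace_0[OF sub]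
        by (intro exI[of _ "{x \<in> topspace X. (4 / e) *\<^sub>R x \<in> V}"]) auto
    qed simp
    then obtain C where "\<forall>x\<in>S. \<bar>f x\<bar> \<le> C" using weak[OF lin] by blast
    then show False using f(3)[of C] by force
  qed
  then obtain C where C: "\<And>x. x \<in> S \<Longrightarrow> q x \<le> C" by blast
  have "x \<in> (\<lambda>w. c *\<^sub>R w) ` W" if c: "\<bar>C\<bar> + 1 \<le> \<bar>c\<bar>" and x: "x \<in> S" for c x
  proof (rule image_eqI[of _ _ "(1 / c) *\<^sub>R x"])
    have c0: "c \<noteq> 0" using c by auto
    then show "x = c *\<^sub>R ((1 / c) *\<^sub>R x)" by simp
    have "q x < \<bar>c\<bar>" using C[OF x] c by linarith
    then have "q ((1 / c) *\<^sub>R x) < 1" using c0 by (simp add: qs)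
    then have "g ((1 / c) *\<^sub>R x) \<in> V" by (rule q(4))
    moreover have "g ((1 / c) *\<^sub>R x) = (1 / c) *\<^sub>R x" using S x by (intro g(3) subspace_scale[OF sub]) auto
    ultimately show "(1 / c) *\<^sub>R x \<in> W" using V(5) by auto
  qed
  then show "\<exists>r>0. \<forall>c. r \<le> \<bar>c\<bar> \<longrightarrow> S \<subseteq> (\<lambda>w. c *\<^sub>R w) ` W"
    by (intro exI[of _ "\<bar>C\<bar> + 1"]) auto
qed

section \<open>The mass norm\<close>

lemma nat_det_cong:
  assumes "\<And>i j. i < k \<Longrightarrow> j < k \<Longrightarrow> A i j = B i j"
  shows "nat_det k A = nat_det k B"
proof -
  have "(\<Prod>i<k. A i (\<pi> i)) = (\<Prod>i<k. B i (\<pi> i))" if "\<pi> permutes {..<k}" for \<pi>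
    using permutes_in_image[OF that] assms by (intro prod.cong) auto
  then show ?thesis unfolding nat_det_def by (intro sum.cong) auto
qed

lemma nat_det_transpose: "nat_det k (\<lambda>i j. A j i) = nat_det k A"
proof -
  let ?P = "{\<pi>. \<pi> permutes {..<k}}"
  have "(\<Prod>i<k. A (\<pi> i) i) = (\<Prod>i<k. A i (inv \<pi> i))" if "\<pi> permutes {..<k}" for \<pi>
    using prod.permute[OF that, of "\<lambda>i. A i (inv \<pi> i)"] that
    by (simp add: o_def permutes_inverses)
  then have "nat_det k (\<lambda>i j. A j i) = (\<Sum>\<pi>\<in>?P. of_int (sign (inv \<pi>)) * (\<Prod>i<k. A i (inv \<pi> i)))"
    unfolding nat_det_def by (intro sum.cong) (auto simp: sign_inverse permutes_imp_permutation[of "{..<k}"])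
  also have "\<dots> = nat_det k A"
    unfolding nat_det_def
    by (rule sum.reindex_bij_betw[OF bij_betw_byWitness[where f' = inv]])
      (auto simp: permutes_inv permutes_inv_inv)
  finally show ?thesis .
qed

lemma nat_det_permute_columns:
  assumes "\<sigma> permutes {..<k}"
  shows "nat_det k (\<lambda>i j. A i (\<sigma> j)) = of_int (sign \<sigma>) * nat_det k A"
proof -
  let ?P = "{\<pi>. \<pi> permutes {..<k}}"
  have "nat_det k (\<lambda>i j. A i (\<sigma> j)) =
      of_int (sign \<sigma>) * (\<Sum>\<pi>\<in>?P. of_int (sign (\<sigma> \<circ> \<pi>)) * (\<Prod>i<k. A i ((\<sigma> \<circ> \<pi>) i)))"
    unfolding nat_det_def sum_distrib_left using assms
    by (intro sum.cong)
      (auto simp: sign_compose permutes_imp_permutation[of "{..<k}"] simp flip: of_int_mult mult.assoc)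
  also have "(\<Sum>\<pi>\<in>?P. of_int (sign (\<sigma> \<circ> \<pi>)) * (\<Prod>i<k. A i ((\<sigma> \<circ> \<pi>) i))) = nat_det k A"
    unfolding nat_det_def
  proof (rule sum.reindex_bij_betw[OF bij_betw_byWitness[where f' = "\<lambda>\<pi>. inv \<sigma> \<circ> \<pi>"]])
    show "(\<lambda>\<pi>. \<sigma> \<circ> \<pi>) ` ?P \<subseteq> ?P" "(\<lambda>\<pi>. inv \<sigma> \<circ> \<pi>) ` ?P \<subseteq> ?P"
      using assms permutes_compose permutes_inv by blast+
  qed (use permutes_inverses[OF assms] in \<open>auto simp: fun_eq_iff\<close>)
  finally show ?thesis .
qed

text \<open>A form of the Cauchy--Binet formula which avoids sorting the indices: one sums over all
  functions instead of all \<open>k\<close>-subsets, at the price of a factor \<open>k!\<close>.\<close>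

lemma gram_det:
  fixes v :: "nat \<Rightarrow> real^'n::finite"
  shows "fact k * nat_det k (\<lambda>i j. v i \<bullet> v j) =
    (\<Sum>f\<in>{..<k} \<rightarrow>\<^sub>E UNIV. (nat_det k (\<lambda>i j. v i $ f j))\<^sup>2)"
proof -
  let ?P = "{\<pi>. \<pi> permutes {..<k}}" and ?F = "{..<k} \<rightarrow>\<^sub>E (UNIV :: 'n set)"
  define d where "d f = nat_det k (\<lambda>i j. v i $ f j)" for f
  have "nat_det k (\<lambda>i j. v i \<bullet> v j) =
      (\<Sum>\<pi>\<in>?P. of_int (sign \<pi>) * (\<Sum>f\<in>?F. \<Prod>i<k. v i $ f i * v (\<pi> i) $ f i))"
    unfolding nat_det_def inner_vec_def inner_real_def by (subst prod_sum_PiE) simp_all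
  also have "\<dots> = (\<Sum>f\<in>?F. (\<Prod>i<k. v i $ f i) * (\<Sum>\<pi>\<in>?P. of_int (sign \<pi>) * (\<Prod>i<k. v (\<pi> i) $ f i)))"
    unfolding sum_distrib_left by (subst sum.swap) (simp add: prod.distrib mult_ac)
  also have "\<dots> = (\<Sum>f\<in>?F. (\<Prod>i<k. v i $ f i) * d f)"
    using nat_det_transpose[of k "\<lambda>i j. v i $ _ j"] 
    by (simp add: d_def nat_det_def)
  finally have gram: "nat_det k (\<lambda>i j. v i \<bullet> v j) = (\<Sum>f\<in>?F. (\<Prod>i<k. v i $ f i) * d f)" .
  \<comment> \<open>Composing f with \<sigma> permutes the summation and multiplies
    \<open>d f\<close> by the sign of \<sigma>. The sum of these identities over all \<sigma> has k!
    equal left sides, and on the right the signed products assemble into a second factor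
    \<open>d f\<close>.\<close>
  have "nat_det k (\<lambda>i j. v i \<bullet> v j) = (\<Sum>f\<in>?F. (of_int (sign \<sigma>) * (\<Prod>i<k. v i $ f (\<sigma> i))) * d f)"
    if \<sigma>: "\<sigma> permutes {..<k}" for \<sigma>
  proof -
    have ext: "\<tau> i = i" if "\<tau> permutes {..<k}" "\<not> i < k" for \<tau> i
      using that by (auto simp: permutes_def)
    have mem: "f \<circ> \<tau> \<in> ?F" if "\<tau> permutes {..<k}" "f \<in> ?F" for \<tau> f
      using that(2) ext[OF that(1)] by (auto simp: PiE_def extensional_def)
    have "bij_betw (\<lambda>f. f \<circ> \<sigma>) ?F ?F"
      by (rule bij_betw_byWitness[where f' = "\<lambda>f. f \<circ> inv \<sigma>"])
        (use \<sigma> mem permutes_inv[OF \<sigma>] in \<open>auto simp: permutes_inv_o simp flip: o_assoc\<close>)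
    from sum.reindex_bij_betw[OF this, of "\<lambda>f. (\<Prod>i<k. v i $ f i) * d f"]
    moreover have "d (f \<circ> \<sigma>) = of_int (sign \<sigma>) * d f" for f
      using nat_det_permute_columns[OF \<sigma>, of "\<lambda>i j. v i $ f j"] by (simp add: d_def)
    ultimately show ?thesis unfolding gram by (simp add: mult_ac)
  qed
  then have "(\<Sum>\<sigma>\<in>?P. nat_det k (\<lambda>i j. v i \<bullet> v j)) =
      (\<Sum>\<sigma>\<in>?P. \<Sum>f\<in>?F. (of_int (sign \<sigma>) * (\<Prod>i<k. v i $ f (\<sigma> i))) * d f)"
    by (intro sum.cong) auto
  also have "\<dots> = (\<Sum>f\<in>?F. (d f)\<^sup>2)"
    by (subst sum.swap) (simp add: d_def nat_det_def power2_eq_square flip: sum_distrib_right)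
  finally show ?thesis by (simp add: d_def card_permutations[of "{..<k}" k])
qed

lemma gram_det_nonneg: "0 \<le> nat_det k (\<lambda>i j. v i \<bullet> (v j :: real^'n::finite))"
proof -
  have "0 \<le> fact k * nat_det k (\<lambda>i j. v i \<bullet> v j)" unfolding gram_det by (intro sum_nonneg) simp
  then show ?thesis using fact_gt_zero[of k, where 'a = real] by (simp add: zero_le_mult_iff)
qed

lemma kvolume_nonneg: "0 \<le> kvolume k v"
  by (simp add: kvolume_def gram_det_nonneg)

text \<open>The square of the coordinate at I is one summand on the right of
  \<open>gram_det\<close>, the one whose f lists I in order. The factor \<open>sqrt (fact k)\<close>
  is the price of that formula; it is harmless because it is independent of v.\<close>

lemma wedge_le_kvolume: "\<bar>wedge k v $ I\<bar> \<le> sqrt (fact k) * kvolume k v"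
proof (cases "card I = k")
  case True
  define f where "f = restrict (\<lambda>j. sorted_key_list_of_set to_nat I ! j) {..<k}"
  have w: "wedge k v $ I = nat_det k (\<lambda>i j. v i $ f j)"
    using True by (simp add: wedge_def f_def cong: nat_det_cong)
  have "(wedge k v $ I)\<^sup>2 \<le> fact k * nat_det k (\<lambda>i j. v i \<bullet> v j)"
    unfolding gram_det w by (rule member_le_sum) (auto simp: f_def split: if_splits intro: finite_PiE)
  then have "sqrt ((wedge k v $ I)\<^sup>2) \<le> sqrt (fact k * nat_det k (\<lambda>i j. v i \<bullet> v j))"
    by (rule real_sqrt_le_mono)
  then show ?thesis by (simp add: real_sqrt_mult kvolume_def)
next
  case False
  then show ?thesis by (simp add: wedge_def kvolume_nonneg)
qed

section \<open>Positivity and homogeneity of the mass norm\<close>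

definition mass_set :: "nat \<Rightarrow> real^('n::finite set) \<Rightarrow> real set" where
  "mass_set k \<alpha> = {\<Sum>i<m. \<bar>c i\<bar> * kvolume k (v i) | (m::nat) c v. \<alpha> = (\<Sum>i<m. c i *\<^sub>R wedge k (v i))}"

lemma mass_norm_eq: "mass_norm k \<alpha> = Inf (mass_set k \<alpha>)"
  by (simp add: mass_norm_def mass_set_def)

text \<open>All representations of \<alpha> share its coordinates, so their volumes have a common
  lower bound. It keeps the infimum away from 0 when \<alpha> \<noteq> 0, see
  \<open>mass_norm_pos\<close>.\<close>

lemma mass_set_lower:
  assumes "r \<in> mass_set k \<alpha>"
  shows "\<bar>\<alpha> $ I\<bar> \<le> sqrt (fact k) * r"
proof -
  obtain m c v where r: "r = (\<Sum>i<(m::nat). \<bar>c i\<bar> * kvolume k (v i))" "\<alpha> = (\<Sum>i<m. c i *\<^sub>R wedge k (v i))"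
    using assms by (auto simp: mass_set_def)
  have "\<bar>\<alpha> $ I\<bar> \<le> (\<Sum>i<m. \<bar>c i\<bar> * \<bar>wedge k (v i) $ I\<bar>)"
    unfolding r by (auto simp flip: abs_mult intro: sum_abs)
  also have "\<dots> \<le> (\<Sum>i<m. \<bar>c i\<bar> * (sqrt (fact k) * kvolume k (v i)))"
    by (intro sum_mono mult_left_mono wedge_le_kvolume) auto
  finally show ?thesis unfolding r by (simp add: sum_distrib_left mult_ac)
qed

lemma nat_det_delta: "nat_det k (\<lambda>i j. if i = j then 1 else 0) = 1"
proof -
  have "(\<Prod>i<k. if i = \<pi> i then 1 else (0::real)) = (if \<pi> = id then 1 else 0)" if "\<pi> permutes {..<k}" for \<pi>
  proof (cases "\<pi> = id")
    case False
    then obtain i where "\<pi> i \<noteq> i" by (auto simp: fun_eq_iff)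
    then have "i < k" using that by (auto simp: permutes_def)
    then show ?thesis using False \<open>\<pi> i \<noteq> i\<close> by (auto intro!: bexI[of _ i])
  qed simp
  then have "nat_det k (\<lambda>i j. if i = j then 1 else 0) =
      (\<Sum>\<pi> | \<pi> permutes {..<k}. of_int (sign \<pi>) * (if \<pi> = id then 1 else 0))"
    unfolding nat_det_def by (intro sum.cong) auto
  also have "\<dots> = (\<Sum>\<pi> | \<pi> permutes {..<k}. if \<pi> = id then 1 else 0)"
    by (intro sum.cong) auto
  also have "\<dots> = 1" using finite_permutations[of "{..<k}"] permutes_id[of "{..<k}"] by (simp add: sum.delta)
  finally show ?thesis .
qed

lemma nat_det_zero_row:
  assumes "i < k" "\<And>j. j < k \<Longrightarrow> A i j = 0"
  shows "nat_det k A = 0"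
proof -
  have "(\<Prod>i<k. A i (\<pi> i)) = 0" if "\<pi> permutes {..<k}" for \<pi>
    using assms permutes_in_image[OF that, of i] by (intro prod_zero) auto
  then show ?thesis unfolding nat_det_def by (intro sum.neutral) auto
qed

text \<open>Covers the key \<open>to_nat\<close>, so that the coordinates in \<open>wedge\<close>
  and the matrices in \<open>wedge_axis\<close> run through each index of I exactly once.\<close>

lemma (in linorder) sorted_key_list_of_set_inj:
  assumes "inj f" "finite A"
  shows "distinct (sorted_key_list_of_set f A)" "set (sorted_key_list_of_set f A) = A"
    "length (sorted_key_list_of_set f A) = card A"
proof -
  interpret folding_insort_key less_eq less UNIV f
    by unfold_locales (rule assms)
  show "distinct (sorted_key_list_of_set f A)" "set (sorted_key_list_of_set f A) = A"
    "length (sorted_key_list_of_set f A) = card A"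
    using distinct_sorted_key_list_of_set[of A] assms(2) by (auto simp: distinct_map)
qed

text \<open>For J = I the matrix is the identity. For another J of size k some index in I lies
  outside J, and its axis vector contributes a zero row. So each basis k-vector is simple.\<close>

lemma wedge_axis:
  fixes I J :: "'n::finite set"
  assumes "card I = k"
  shows "wedge k (\<lambda>i. axis (sorted_key_list_of_set to_nat I ! i) 1) $ J = (if J = I then 1 else 0)"
proof -
  let ?l = "sorted_key_list_of_set (to_nat :: 'n \<Rightarrow> nat)"
  have l: "distinct (?l K)" "set (?l K) = K" "length (?l K) = card K" for K
    using sorted_key_list_of_set_inj[of "to_nat :: 'n \<Rightarrow> nat" K] by auto
  consider "card J \<noteq> k" | "J = I" | "card J = k" "J \<noteq> I" by blast
  then show ?thesis
  proof cases
    case 1 then show ?thesis using assms by (auto simp: wedge_def)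
  next
    case 2
    have "nat_det k (\<lambda>i j. axis (?l I ! i) 1 $ (?l I ! j)) = nat_det k (\<lambda>i j. if i = j then 1 else (0::real))"
      using l[of I] assms by (intro nat_det_cong) (auto simp: axis_def nth_eq_iff_index_eq)
    then show ?thesis using 2 assms by (simp add: wedge_def nat_det_delta)
  next
    case 3
    then have "\<not> I \<subseteq> J" using assms card_subset_eq[of J I] by auto
    then obtain a where a: "a \<in> I" "a \<notin> J" by blast
    then obtain i where i: "i < k" "?l I ! i = a" using l[of I] assms by (metis in_set_conv_nth)
    have "nat_det k (\<lambda>i j. axis (?l I ! i) 1 $ (?l J ! j)) = (0::real)"
    proof (rule nat_det_zero_row[OF i(1)])
      fix j assume "j < k"
      then have "?l J ! j \<in> J" using l[of J] 3 by (metis nth_mem)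
      then show "axis (?l I ! i) 1 $ (?l J ! j) = (0::real)" using a i by (auto simp: axis_def)
    qed
    then show ?thesis using 3 by (simp add: wedge_def)
  qed
qed

text \<open>Without a representation the infimum in \<open>mass_norm\<close> would be that of the
  empty set; the expansion in basis k-vectors provides one.\<close>

lemma mass_set_nonempty:
  fixes \<alpha> :: "real^('n::finite set)"
  assumes "\<alpha> \<in> kvectors k"
  shows "mass_set k \<alpha> \<noteq> {}"
proof -
  obtain h :: "nat \<Rightarrow> 'n set" and m where h: "bij_betw h {..<m} {I. card I = k}"
    using ex_bij_betw_nat_finite[of "{I :: 'n set. card I = k}"] by (auto simp: atLeast0LessThan)
  define v where "v I i = (axis (sorted_key_list_of_set to_nat I ! i) 1 :: real^'n)" for I i
  have wv: "wedge k (v I) $ J = (if J = I then 1 else 0)" if "card I = k" for I J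
    unfolding v_def[abs_def] using that by (rule wedge_axis)
  have "\<alpha> $ J = (\<Sum>i<m. \<alpha> $ h i *\<^sub>R wedge k (v (h i))) $ J" for J
  proof -
    have "(\<Sum>i<m. \<alpha> $ h i *\<^sub>R wedge k (v (h i))) $ J = (\<Sum>I | card I = k. \<alpha> $ I * wedge k (v I) $ J)"
      using sum.reindex_bij_betw[OF h, of "\<lambda>I. \<alpha> $ I * wedge k (v I) $ J"] by simp
    also have "\<dots> = (\<Sum>I | card I = k. if J = I then \<alpha> $ I else 0)"
      by (intro sum.cong) (auto simp: wv)
    also have "\<dots> = \<alpha> $ J" using assms by (auto simp: kvectors_def)
    finally show ?thesis by simp
  qed
  then have "\<alpha> = (\<Sum>i<m. \<alpha> $ h i *\<^sub>R wedge k (v (h i)))" unfolding vec_eq_iff by blast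
  then have "(\<Sum>i<m. \<bar>\<alpha> $ h i\<bar> * kvolume k (v (h i))) \<in> mass_set k \<alpha>"
    unfolding mass_set_def mem_Collect_eq
    by (intro exI[of _ m] exI[of _ "\<lambda>i. \<alpha> $ h i"] exI[of _ "\<lambda>i. v (h i)"] conjI refl)
  then show ?thesis by blast
qed

lemma mass_norm_nonneg:
  assumes "\<alpha> \<in> kvectors k"
  shows "mass_norm k \<alpha> \<ge> 0"
  unfolding mass_norm_eq
  by (intro cInf_greatest mass_set_nonempty[OF assms]) (auto simp: mass_set_def kvolume_nonneg intro!: sum_nonneg)

lemma mass_norm_pos:
  assumes "\<alpha> \<in> kvectors k" "\<alpha> \<noteq> 0"
  shows "mass_norm k \<alpha> > 0"
proof -
  obtain I where I: "\<alpha> $ I \<noteq> 0" using assms(2) by (auto simp: vec_eq_iff)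
  have "\<bar>\<alpha> $ I\<bar> / sqrt (fact k) \<le> mass_norm k \<alpha>"
    unfolding mass_norm_eq
    using mass_set_lower[of _ k \<alpha> I] by (intro cInf_greatest mass_set_nonempty[OF assms(1)]) (simp add: field_simps)
  moreover have "\<bar>\<alpha> $ I\<bar> / sqrt (fact k) > 0" using I by simp
  ultimately show ?thesis by linarith
qed

lemma mass_norm_scale:
  assumes "\<alpha> \<in> kvectors k" "c > 0"
  shows "mass_norm k (c *\<^sub>R \<alpha>) = c * mass_norm k \<alpha>"
proof -
  have le: "mass_norm k (c *\<^sub>R \<alpha>) \<le> c * mass_norm k \<alpha>" if \<alpha>: "\<alpha> \<in> kvectors k" and c: "c > 0"
    for \<alpha> :: "real^('a set)" and c
  proof -
    have "mass_norm k (c *\<^sub>R \<alpha>) / c \<le> r" if r: "r \<in> mass_set k \<alpha>" for r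
    proof -
      obtain m d v where d: "r = (\<Sum>i<(m::nat). \<bar>d i\<bar> * kvolume k (v i))" "\<alpha> = (\<Sum>i<m. d i *\<^sub>R wedge k (v i))"
        using r by (auto simp: mass_set_def)
      have "c * r = (\<Sum>i<m. \<bar>c * d i\<bar> * kvolume k (v i))" "c *\<^sub>R \<alpha> = (\<Sum>i<m. (c * d i) *\<^sub>R wedge k (v i))"
        using c by (simp_all add: d sum_distrib_left scaleR_sum_right abs_mult mult_ac)
      then have "c * r \<in> mass_set k (c *\<^sub>R \<alpha>)"
        unfolding mass_set_def mem_Collect_eq by (intro exI[of _ m] exI[of _ "\<lambda>i. c * d i"] exI[of _ v]) simp
      moreover have "bdd_below (mass_set k (c *\<^sub>R \<alpha>))"
        by (rule bdd_belowI[of _ 0]) (auto simp: mass_set_def kvolume_nonneg intro!: sum_nonneg)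
      ultimately have "mass_norm k (c *\<^sub>R \<alpha>) \<le> c * r" unfolding mass_norm_eq by (rule cInf_lower)
      then show ?thesis using c by (simp add: field_simps)
    qed
    then have "mass_norm k (c *\<^sub>R \<alpha>) / c \<le> mass_norm k \<alpha>"
      unfolding mass_norm_eq[of k \<alpha>] by (intro cInf_greatest mass_set_nonempty[OF \<alpha>]) auto
    then show ?thesis using c by (simp add: field_simps)
  qed
  \<comment> \<open>The reverse inequality is the same one for \<open>c *\<^sub>R \<alpha>\<close>
    and the factor 1 / c.\<close>
  have "c *\<^sub>R \<alpha> \<in> kvectors k" using assms by (simp add: kvectors_def)
  from le[OF this, of "1 / c"] le[OF assms] assms(2) show ?thesis by (simp add: field_simps)
qed

section \<open>Smooth forms\<close>

lemma subspace_kvectors: "subspace (kvectors k)"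
  by (auto simp: subspace_def kvectors_def)

text \<open>Obtained by normalising \<alpha>, which requires the mass norm to be positive off 0. The
  homogeneous form is the one that can be summed over a chain and compared with
  \<open>chain_mass\<close>.\<close>

lemma bounded_form_mass_bound:
  assumes "bounded_form k U \<omega>" and lin: "\<And>p. p \<in> U \<Longrightarrow> linear_on (kvectors k) (\<omega> p)"
  shows "\<exists>C\<ge>0. \<forall>p\<in>U. \<forall>\<alpha>\<in>kvectors k. \<bar>\<omega> p \<alpha>\<bar> \<le> C * mass_norm k \<alpha>"
proof -
  obtain C where C: "\<And>p \<alpha>. p \<in> U \<Longrightarrow> \<alpha> \<in> kvectors k \<Longrightarrow> mass_norm k \<alpha> = 1 \<Longrightarrow> \<bar>\<omega> p \<alpha>\<bar> \<le> C"
    using assms(1) unfolding bounded_form_def by blast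
  have "\<bar>\<omega> p \<alpha>\<bar> \<le> \<bar>C\<bar> * mass_norm k \<alpha>" if p: "p \<in> U" and \<alpha>: "\<alpha> \<in> kvectors k" for p \<alpha>
  proof (cases "\<alpha> = 0")
    case True
    have "\<omega> p 0 = 0" using linear_on_scaleR[OF lin[OF p] \<alpha>, of 0] by simp
    then show ?thesis using True mass_norm_nonneg[OF \<alpha>] by simp
  next
    case False
    define m where "m = mass_norm k \<alpha>"
    have m: "m > 0" using mass_norm_pos[OF \<alpha> False] by (simp add: m_def)
    have "(1 / m) *\<^sub>R \<alpha> \<in> kvectors k" using \<alpha> subspace_kvectors by (intro subspace_scale)
    moreover have "mass_norm k ((1 / m) *\<^sub>R \<alpha>) = 1" using mass_norm_scale[OF \<alpha>, of "1 / m"] m by (simp add: m_def)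
    ultimately have "\<bar>\<omega> p ((1 / m) *\<^sub>R \<alpha>)\<bar> \<le> C" by (rule C[OF p])
    then have "\<bar>\<omega> p \<alpha>\<bar> / m \<le> C" using linear_on_scaleR[OF lin[OF p] \<alpha>, of "1 / m"] m by (simp add: abs_mult)
    then have "\<bar>\<omega> p \<alpha>\<bar> \<le> C * m" using m by (simp add: field_simps)
    also have "\<dots> \<le> \<bar>C\<bar> * m" using m by (intro mult_right_mono) auto
    finally show ?thesis by (simp add: m_def)
  qed
  then show ?thesis by (intro exI[of _ "\<bar>C\<bar>"]) auto
qed

section \<open>Regularity from directional derivatives\<close>

lemma Ck_on_cong:
  assumes U: "open U"
  shows "(\<And>x. x \<in> U \<Longrightarrow> f x = g x) \<Longrightarrow> Ck_on r U f \<Longrightarrow> Ck_on r U g"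
proof (induction r arbitrary: f g)
  case 0
  then show ?case using continuous_on_cong[of U U f g] by simp
next
  case (Suc r)
  have d: "f differentiable (at x)" if "x \<in> U" for x using Suc.prems(2) that by simp
  have "g differentiable (at x)" if x: "x \<in> U" for x
    using has_derivative_transform_within_open[OF _ U x, of f] d[OF x] Suc.prems(1)
    unfolding differentiable_def by blast
  moreover have "Ck_on r U (\<lambda>x. frechet_derivative g (at x) v)" for v
  proof (rule Suc.IH)
    show "Ck_on r U (\<lambda>x. frechet_derivative f (at x) v)" using Suc.prems(2) by simp
    show "frechet_derivative f (at x) v = frechet_derivative g (at x) v" if x: "x \<in> U" for x
      using frechet_derivative_transform_within_open[OF d[OF x] U x Suc.prems(1)] by simp
  qed
  ultimately show ?case by simp
qed

text \<open>A relation, with no differentiability behind it: limits of difference quotients along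
  one line are all that a functional on chains provides, and neither linearity nor continuity in v
  is built in.\<close>

definition has_dir_deriv :: "('a::real_normed_vector \<Rightarrow> real) \<Rightarrow> 'a \<Rightarrow> 'a \<Rightarrow> real \<Rightarrow> bool" where
  "has_dir_deriv f v x d \<longleftrightarrow> ((\<lambda>t. f (x + t *\<^sub>R v)) has_real_derivative d) (at 0)"

lemma has_dir_deriv_unique: "has_dir_deriv f v x d \<Longrightarrow> has_dir_deriv f v x d' \<Longrightarrow> d = d'"
  unfolding has_dir_deriv_def by (rule DERIV_unique)

lemma has_dir_deriv_along:
  assumes "has_dir_deriv f v (x + t *\<^sub>R v) d"
  shows "((\<lambda>t. f (x + t *\<^sub>R v)) has_real_derivative d) (at t)"
proof -
  have "((\<lambda>s. f (x + (s + t) *\<^sub>R v)) has_real_derivative d) (at 0)"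
    using assms by (simp add: has_dir_deriv_def algebra_simps)
  then show ?thesis using DERIV_shift[of "\<lambda>t. f (x + t *\<^sub>R v)" d 0 t] by simp
qed

lemma has_dir_deriv_scale:
  assumes "has_dir_deriv f v x d"
  shows "has_dir_deriv f (c *\<^sub>R v) x (c * d)"
proof -
  have "((\<lambda>t. t * c) has_real_derivative c) (at 0)" by (auto intro!: derivative_eq_intros)
  moreover have "((\<lambda>t. f (x + t *\<^sub>R v)) has_real_derivative d) (at (0 * c))"
    using assms by (simp add: has_dir_deriv_def)
  ultimately have "((\<lambda>t. f (x + (t * c) *\<^sub>R v)) has_real_derivative d * c) (at 0)"
    using DERIV_chain2[of "\<lambda>t. f (x + t *\<^sub>R v)" d "\<lambda>t. t * c"] by blast
  then show ?thesis by (simp add: has_dir_deriv_def mult.commute)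
qed

lemma has_dir_deriv_cong:
  assumes "has_dir_deriv f v x d" "open U" "x \<in> U" "\<And>y. y \<in> U \<Longrightarrow> f y = g y"
  shows "has_dir_deriv g v x d"
proof -
  have "open ((\<lambda>t::real. x + t *\<^sub>R v) -` U)"
    by (intro continuous_open_vimage assms(2) continuous_intros)
  then show ?thesis
    using assms unfolding has_dir_deriv_def
    by (auto intro: has_field_derivative_transform_within_open[of _ _ _ "(\<lambda>t::real. x + t *\<^sub>R v) -` U"])
qed

lemma has_dir_deriv_frechet:
  assumes "(f has_derivative f') (at x)"
  shows "has_dir_deriv f v x (f' v)"
proof -
  have "((\<lambda>t::real. x + t *\<^sub>R v) has_derivative (\<lambda>t. t *\<^sub>R v)) (at 0)"
    by (auto intro!: derivative_eq_intros)
  moreover have "(f has_derivative f') (at (x + 0 *\<^sub>R v))" using assms by simp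
  ultimately have "((\<lambda>t. f (x + t *\<^sub>R v)) has_derivative (\<lambda>t. f' (t *\<^sub>R v))) (at 0)"
    using has_derivative_compose[of "\<lambda>t::real. x + t *\<^sub>R v" _ 0 UNIV f f'] by simp
  then show ?thesis
    using linear_scale[OF has_derivative_linear[OF assms]]
    by (simp add: has_dir_deriv_def has_field_derivative_def mult_commute_abs)
qed

text \<open>The increment is estimated along a path that is parallel to the axes, because no bound
  uniform in the direction is available.\<close>

lemma partial_derivatives_increment:
  fixes f :: "real^'n \<Rightarrow> real"
  assumes g: "\<And>i x. x \<in> ball p e \<Longrightarrow> has_dir_deriv f (axis i 1) x (g i x)"
    and M: "\<And>i x. x \<in> ball p e \<Longrightarrow> \<bar>g i x - c i\<bar> \<le> M i"
    and h: "norm h < e"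
  shows "\<bar>f (p + h) - f p - (\<Sum>i\<in>UNIV. h $ i * c i)\<bar> \<le> (\<Sum>i\<in>UNIV. \<bar>h $ i\<bar> * M i)"
proof -
  \<comment> \<open>The points p + \<open>hS S\<close>, for S growing by one index at a time, are
    the corners of the axis-parallel path from p to p + h. No coordinate exceeds that of h in
    absolute value, so the path stays in the ball.\<close>
  define hS where "hS S = (\<chi> i. if i \<in> S then h $ i else 0)" for S
  have path: "\<bar>f (p + hS S) - f p - (\<Sum>i\<in>S. h $ i * c i)\<bar> \<le> (\<Sum>i\<in>S. \<bar>h $ i\<bar> * M i)" if "finite S" for S
    using that
  proof (induction S)
    case empty
    have "hS {} = 0" by (simp add: hS_def vec_eq_iff)
    then show ?case by simp
  next
    case (insert j S)
    define x where "x = p + hS S"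
    have step: "p + hS (insert j S) = x + (h $ j) *\<^sub>R axis j 1"
      using insert.hyps by (auto simp: x_def hS_def vec_eq_iff axis_def)
    have inball: "x + (t * h $ j) *\<^sub>R axis j 1 \<in> ball p e" if "0 \<le> t" "t \<le> 1" for t
    proof -
      have "norm (hS S + (t * h $ j) *\<^sub>R axis j 1) \<le> norm h"
      proof (rule norm_le_componentwise_cart)
        fix i
        show "norm ((hS S + (t * h $ j) *\<^sub>R axis j 1) $ i) \<le> norm (h $ i)"
          using insert.hyps that mult_left_le_one_le[of "\<bar>h $ j\<bar>" t]
          by (auto simp: hS_def axis_def abs_mult)
      qed
      then have "dist (p + (hS S + (t * h $ j) *\<^sub>R axis j 1)) p < e" using h by (simp add: dist_norm)
      then show ?thesis by (simp add: x_def dist_commute add.assoc)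
    qed
    have "((\<lambda>t. f (x + (t * h $ j) *\<^sub>R axis j 1)) has_real_derivative
        g j (x + (t * h $ j) *\<^sub>R axis j 1) * h $ j) (at t)" if "0 \<le> t" "t \<le> 1" for t
    proof (rule DERIV_chain2[of "\<lambda>s. f (x + s *\<^sub>R axis j 1)"])
      show "((\<lambda>s. f (x + s *\<^sub>R axis j 1)) has_real_derivative g j (x + (t * h $ j) *\<^sub>R axis j 1)) (at (t * h $ j))"
        by (intro has_dir_deriv_along g inball that)
      show "((\<lambda>t. t * h $ j) has_real_derivative h $ j) (at t)" by (auto intro!: derivative_eq_intros)
    qed
    then obtain t where t: "0 < t" "t < 1"
      "f (x + (1 * h $ j) *\<^sub>R axis j 1) - f (x + (0 * h $ j) *\<^sub>R axis j 1) =
        (1 - 0) * (g j (x + (t * h $ j) *\<^sub>R axis j 1) * h $ j)"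
      using MVT2[of 0 1 "\<lambda>t. f (x + (t * h $ j) *\<^sub>R axis j 1)"
          "\<lambda>t. g j (x + (t * h $ j) *\<^sub>R axis j 1) * h $ j"] by auto
    define y where "y = x + (t * h $ j) *\<^sub>R axis j 1"
    have "f (p + hS (insert j S)) - f p - (\<Sum>i\<in>insert j S. h $ i * c i) =
        h $ j * (g j y - c j) + (f (p + hS S) - f p - (\<Sum>i\<in>S. h $ i * c i))"
      using t(3) insert.hyps unfolding step by (simp add: y_def x_def algebra_simps)
    moreover have "\<bar>h $ j * (g j y - c j)\<bar> \<le> \<bar>h $ j\<bar> * M j"
      unfolding abs_mult using M inball t by (intro mult_left_mono) (auto simp: y_def)
    ultimately show ?case using insert by simp
  qed
  have "hS UNIV = h" by (simp add: hS_def vec_eq_iff)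
  then show ?thesis using path[of UNIV] by simp
qed

text \<open>Directional derivatives alone would not give continuity. Here the partial derivatives
  belong to \<G> as well, hence are bounded on U, and the increment along axis-parallel paths is at
  most a constant times the size of h.\<close>

lemma derivative_closed_family_continuous:
  fixes \<G> :: "(real^'n \<Rightarrow> real) set"
  assumes U: "open U"
    and bdd: "\<And>g. g \<in> \<G> \<Longrightarrow> \<exists>C. \<forall>x\<in>U. \<bar>g x\<bar> \<le> C"
    and closed: "\<And>g v. g \<in> \<G> \<Longrightarrow> \<exists>g'\<in>\<G>. \<forall>x\<in>U. has_dir_deriv g v x (g' x)"
    and g: "g \<in> \<G>" and p: "p \<in> U"
  shows "isCont g p"
proof -
  have "\<forall>i. \<exists>g'. g' \<in> \<G> \<and> (\<forall>x\<in>U. has_dir_deriv g (axis i 1) x (g' x))" using closed[OF g] by blast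
  then obtain g' where g': "\<And>i. g' i \<in> \<G>" "\<And>i x. x \<in> U \<Longrightarrow> has_dir_deriv g (axis i 1) x (g' i x)"
    by metis
  have "\<forall>i. \<exists>C. \<forall>x\<in>U. \<bar>g' i x\<bar> \<le> C" using bdd[OF g'(1)] by blast
  then obtain C where C: "\<And>i x. x \<in> U \<Longrightarrow> \<bar>g' i x\<bar> \<le> C i" by metis
  obtain e where e: "e > 0" "ball p e \<subseteq> U" using U p open_contains_ball by blast
  have "\<bar>g (p + h) - g p\<bar> \<le> (\<Sum>i\<in>UNIV. \<bar>h $ i\<bar> * C i)" if "norm h < e" for h
    using partial_derivatives_increment[of p e g g' "\<lambda>_. 0" C h] g' C subsetD[OF e(2)] that
    by (simp del: mem_ball)
  then have "\<forall>\<^sub>F h in at 0. norm (g (p + h) - g p) \<le> (\<Sum>i\<in>UNIV. \<bar>h $ i\<bar> * C i)"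
    using e(1) by (auto simp: eventually_at dist_norm intro!: exI[of _ e])
  moreover have "((\<lambda>h. \<Sum>i\<in>UNIV. \<bar>h $ i\<bar> * C i) \<longlongrightarrow> (\<Sum>i\<in>UNIV. \<bar>(0::real^'n) $ i\<bar> * C i)) (at 0)"
    by (intro tendsto_intros)
  then have "((\<lambda>h::real^'n. \<Sum>i\<in>UNIV. \<bar>h $ i\<bar> * C i) \<longlongrightarrow> 0) (at 0)" by simp
  ultimately have "((\<lambda>h. g (p + h) - g p) \<longlongrightarrow> 0) (at 0)" by (rule Lim_null_comparison)
  then show ?thesis unfolding isCont_iff by (rule LIM_zero_cancel)
qed

text \<open>The partial derivatives agree on U with members of \<G>, which are continuous by the
  preceding lemma; continuous partial derivatives give Frechet differentiability. The derivatives in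
  fixed directions are again members of \<G> over U, and the induction continues with them.\<close>

lemma derivative_closed_family_smooth:
  fixes \<G> :: "(real^'n \<Rightarrow> real) set"
  assumes U: "open U"
    and bdd: "\<And>g. g \<in> \<G> \<Longrightarrow> \<exists>C. \<forall>x\<in>U. \<bar>g x\<bar> \<le> C"
    and closed: "\<And>g v. g \<in> \<G> \<Longrightarrow> \<exists>g'\<in>\<G>. \<forall>x\<in>U. has_dir_deriv g v x (g' x)"
  shows "g \<in> \<G> \<Longrightarrow> Ck_on r U g"
proof (induction r arbitrary: g)
  case 0
  then show ?case
    using derivative_closed_family_continuous[OF U bdd closed] by (simp add: continuous_at_imp_continuous_on)
next
  case (Suc r)
  have "\<exists>g'\<in>\<G>. \<forall>x\<in>U. has_dir_deriv g v x (g' x)" for v using closed[OF Suc.prems] .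
  then obtain g' where g': "\<And>v. g' v \<in> \<G>" "\<And>v x. x \<in> U \<Longrightarrow> has_dir_deriv g v x (g' v x)"
    by metis
  have diff: "(g has_derivative (\<lambda>h. \<Sum>i\<in>UNIV. h $ i * g' (axis i 1) p)) (at p)" if p: "p \<in> U" for p
    unfolding has_derivative_at_alt
  proof (intro conjI allI impI)
    show "bounded_linear (\<lambda>h. \<Sum>i\<in>UNIV. h $ i * g' (axis i 1) p)"
      by (intro bounded_linear_sum bounded_linear_mult_left[THEN bounded_linear_compose] bounded_linear_vec_nth)
    fix e :: real assume e: "e > 0"
    \<comment> \<open>The error d is incurred once for each of the \<open>CARD('n)\<close>
      coordinates.\<close>
    define d where "d = e / CARD('n)"
    have d: "d > 0" using e by (simp add: d_def)
    have "\<forall>\<^sub>F x in nhds p. \<bar>g' (axis i 1) x - g' (axis i 1) p\<bar> < d" for i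
    proof -
      have "(g' (axis i 1) \<longlongrightarrow> g' (axis i 1) p) (nhds p)"
        using derivative_closed_family_continuous[OF U bdd closed g'(1) p, of "axis i 1"]
        unfolding isCont_def tendsto_at_iff_tendsto_nhds .
      from tendstoD[OF this d] show ?thesis by (simp add: dist_real_def)
    qed
    then have "\<forall>\<^sub>F x in nhds p. \<forall>i. \<bar>g' (axis i 1) x - g' (axis i 1) p\<bar> < d"
      by (intro eventually_all_finite)
    then have "\<forall>\<^sub>F x in nhds p. x \<in> U \<and> (\<forall>i. \<bar>g' (axis i 1) x - g' (axis i 1) p\<bar> < d)"
      using eventually_nhds_in_open[OF U p] by (simp add: eventually_conj_iff)
    then obtain r where r: "r > 0" "\<And>x. x \<in> ball p r \<Longrightarrow> x \<in> U \<and> (\<forall>i. \<bar>g' (axis i 1) x - g' (axis i 1) p\<bar> < d)"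
      unfolding eventually_nhds_metric by (metis dist_commute mem_ball)
    have "\<bar>g y - g p - (\<Sum>i\<in>UNIV. (y - p) $ i * g' (axis i 1) p)\<bar> \<le> e * norm (y - p)"
      if y: "norm (y - p) < r" for y
    proof -
      have "\<bar>g (p + (y - p)) - g p - (\<Sum>i\<in>UNIV. (y - p) $ i * g' (axis i 1) p)\<bar> \<le>
          (\<Sum>i\<in>UNIV. \<bar>(y - p) $ i\<bar> * d)"
        using r(2) g' y by (intro partial_derivatives_increment[where g = "\<lambda>i. g' (axis i 1)" and e = r])
          (auto simp: less_imp_le)
      also have "\<dots> \<le> (\<Sum>i::'n\<in>UNIV. norm (y - p) * d)"
        using d by (intro sum_mono mult_right_mono component_le_norm_cart) auto
      also have "\<dots> = e * norm (y - p)" by (simp add: d_def)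
      finally show ?thesis by simp
    qed
    then show "\<exists>d>0. \<forall>y. norm (y - p) < d \<longrightarrow>
        norm (g y - g p - (\<Sum>i\<in>UNIV. (y - p) $ i * g' (axis i 1) p)) \<le> e * norm (y - p)"
      using r(1) by auto
  qed
  have "Ck_on r U (\<lambda>x. frechet_derivative g (at x) v)" for v
  proof (rule Ck_on_cong[OF U _ Suc.IH[OF g'(1)[of v]]])
    fix x assume x: "x \<in> U"
    have "(g has_derivative frechet_derivative g (at x)) (at x)"
      using diff[OF x] unfolding frechet_derivative_works[symmetric] differentiable_def by blast
    from has_dir_deriv_frechet[OF this] show "g' v x = frechet_derivative g (at x) v"
      using g'(2)[OF x] has_dir_deriv_unique by blast
  qed
  then show ?case using diff by (auto simp: differentiable_def)
qed

text \<open>The family need not consist of derivatives of one form, so it can be used for the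
  functionals of a topology as well as for the multiples of derivatives in
  \<open>B_forms_dir_deriv\<close>. Boundedness of all Lie derivatives is inherited because they
  agree with members of \<Phi>.\<close>

lemma derivative_closed_family_B_forms:
  fixes \<Phi> :: "'n::finite form set"
  assumes U: "open U"
    and lin: "\<And>\<phi> p. \<phi> \<in> \<Phi> \<Longrightarrow> p \<in> U \<Longrightarrow> linear_on (kvectors k) (\<phi> p)"
    and bdd: "\<And>\<phi>. \<phi> \<in> \<Phi> \<Longrightarrow> bounded_form k U \<phi>"
    and closed: "\<And>\<phi> v. \<phi> \<in> \<Phi> \<Longrightarrow>
      \<exists>\<phi>'\<in>\<Phi>. \<forall>p\<in>U. \<forall>\<alpha>\<in>kvectors k. has_dir_deriv (\<lambda>p. \<phi> p \<alpha>) v p (\<phi>' p \<alpha>)"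
  shows "\<Phi> \<subseteq> B_forms k U"
proof
  fix \<phi> assume \<phi>: "\<phi> \<in> \<Phi>"
  have "Ck_on r U (\<lambda>p. \<phi> p \<alpha>)" if \<alpha>: "\<alpha> \<in> kvectors k" for \<alpha> r
  proof (rule derivative_closed_family_smooth[OF U, where \<G> = "(\<lambda>\<phi> p. \<phi> p \<alpha>) ` \<Phi>"])
    fix g assume "g \<in> (\<lambda>\<phi> p. \<phi> p \<alpha>) ` \<Phi>"
    then obtain \<psi> where \<psi>: "\<psi> \<in> \<Phi>" "g = (\<lambda>p. \<psi> p \<alpha>)" by blast
    show "\<exists>C. \<forall>x\<in>U. \<bar>g x\<bar> \<le> C"
      using bounded_form_mass_bound[OF bdd[OF \<psi>(1)] lin[OF \<psi>(1)]] \<alpha> \<psi>(2) by blast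
    show "\<exists>g'\<in>(\<lambda>\<phi> p. \<phi> p \<alpha>) ` \<Phi>. \<forall>x\<in>U. has_dir_deriv g v x (g' x)" for v
      using closed[OF \<psi>(1), of v] \<alpha> \<psi>(2) by fastforce
  qed (use \<phi> in blast)
  then have "smooth_form k U \<phi>" using lin[OF \<phi>] by (simp add: smooth_form_def)
  moreover have "bounded_form k U (foldr lie_deriv vs \<phi>)" for vs
  proof -
    \<comment> \<open>Agreement is claimed only over U and on \<open>kvectors k\<close>: values of
      forms elsewhere are arbitrary, and the members of \<Phi> need not equal Lie derivatives
      there.\<close>
    have "\<exists>\<psi>\<in>\<Phi>. \<forall>p\<in>U. \<forall>\<alpha>\<in>kvectors k. foldr lie_deriv vs \<phi> p \<alpha> = \<psi> p \<alpha>"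
    proof (induction vs)
      case Nil
      then show ?case using \<phi> by auto
    next
      case (Cons v vs)
      then obtain \<psi> where \<psi>: "\<psi> \<in> \<Phi>" "\<And>p \<alpha>. p \<in> U \<Longrightarrow> \<alpha> \<in> kvectors k \<Longrightarrow> \<psi> p \<alpha> = foldr lie_deriv vs \<phi> p \<alpha>"
        by metis
      obtain \<psi>' where \<psi>': "\<psi>' \<in> \<Phi>" "\<And>p \<alpha>. p \<in> U \<Longrightarrow> \<alpha> \<in> kvectors k \<Longrightarrow> has_dir_deriv (\<lambda>p. \<psi> p \<alpha>) v p (\<psi>' p \<alpha>)"
        using closed[OF \<psi>(1), of v] by blast
      have "lie_deriv v (foldr lie_deriv vs \<phi>) p \<alpha> = \<psi>' p \<alpha>" if p: "p \<in> U" and \<alpha>: "\<alpha> \<in> kvectors k" for p \<alpha>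
      proof -
        have "has_dir_deriv (\<lambda>p. foldr lie_deriv vs \<phi> p \<alpha>) v p (\<psi>' p \<alpha>)"
          by (rule has_dir_deriv_cong[OF \<psi>'(2)[OF p \<alpha>] U p]) (rule \<psi>(2)[OF _ \<alpha>])
        then show ?thesis unfolding lie_deriv_def has_dir_deriv_def by (rule DERIV_imp_deriv)
      qed
      then show ?case using \<psi>'(1) by auto
    qed
    then show ?thesis using bdd unfolding bounded_form_def by metis
  qed
  ultimately show "\<phi> \<in> B_forms k U" by (simp add: B_forms_def)
qed

text \<open>\<open>lie_deriv\<close> is defined by the total operator \<open>deriv\<close>;
  smoothness identifies it with the Frechet derivative in direction v. Linearity in \<alpha> then
  follows from uniqueness of derivatives along a line.\<close>

lemma smooth_form_lie_deriv:
  fixes U :: "(real^'n::finite) set"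
  assumes U: "open U" and \<omega>: "smooth_form k U \<omega>"
  shows "smooth_form k U (lie_deriv v \<omega>)"
    and "\<And>p \<alpha>. p \<in> U \<Longrightarrow> \<alpha> \<in> kvectors k \<Longrightarrow> has_dir_deriv (\<lambda>p. \<omega> p \<alpha>) v p (lie_deriv v \<omega> p \<alpha>)"
proof -
  have Ck: "Ck_on r U (\<lambda>p. \<omega> p \<alpha>)" if "\<alpha> \<in> kvectors k" for r \<alpha>
    using \<omega> that by (simp add: smooth_form_def)
  have fr: "has_dir_deriv (\<lambda>p. \<omega> p \<alpha>) v p (frechet_derivative (\<lambda>p. \<omega> p \<alpha>) (at p) v)"
    if "p \<in> U" "\<alpha> \<in> kvectors k" for p \<alpha>
    using Ck[OF that(2), of 1] that(1) by (intro has_dir_deriv_frechet) (simp add: frechet_derivative_works)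
  have eq: "lie_deriv v \<omega> p \<alpha> = frechet_derivative (\<lambda>p. \<omega> p \<alpha>) (at p) v" if "p \<in> U" "\<alpha> \<in> kvectors k" for p \<alpha>
    unfolding lie_deriv_def using fr[OF that] by (intro DERIV_imp_deriv) (simp add: has_dir_deriv_def)
  show D: "has_dir_deriv (\<lambda>p. \<omega> p \<alpha>) v p (lie_deriv v \<omega> p \<alpha>)" if "p \<in> U" "\<alpha> \<in> kvectors k" for p \<alpha>
    using fr[OF that] eq[OF that] by simp
  have "Ck_on r U (\<lambda>p. lie_deriv v \<omega> p \<alpha>)" if \<alpha>: "\<alpha> \<in> kvectors k" for r \<alpha>
  proof (rule Ck_on_cong[OF U])
    show "Ck_on r U (\<lambda>x. frechet_derivative (\<lambda>p. \<omega> p \<alpha>) (at x) v)" using Ck[OF \<alpha>, of "Suc r"] by simp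
    show "frechet_derivative (\<lambda>p. \<omega> p \<alpha>) (at x) v = lie_deriv v \<omega> x \<alpha>" if "x \<in> U" for x
      using eq[OF that \<alpha>] by simp
  qed
  moreover have "linear_on (kvectors k) (lie_deriv v \<omega> p)" if p: "p \<in> U" for p
    unfolding linear_on_def
  proof (intro conjI ballI allI)
    have lin: "linear_on (kvectors k) (\<omega> q)" if "q \<in> U" for q using \<omega> that by (simp add: smooth_form_def)
    fix \<alpha> :: "real^('n set)" assume \<alpha>: "\<alpha> \<in> kvectors k"
    show "lie_deriv v \<omega> p (\<alpha> + \<beta>) = lie_deriv v \<omega> p \<alpha> + lie_deriv v \<omega> p \<beta>" if \<beta>: "\<beta> \<in> kvectors k" for \<beta>
    proof (rule has_dir_deriv_unique)
      show "has_dir_deriv (\<lambda>q. \<omega> q (\<alpha> + \<beta>)) v p (lie_deriv v \<omega> p (\<alpha> + \<beta>))"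
        using \<alpha> \<beta> by (intro D[OF p] subspace_add[OF subspace_kvectors])
      have "has_dir_deriv (\<lambda>q. \<omega> q \<alpha> + \<omega> q \<beta>) v p (lie_deriv v \<omega> p \<alpha> + lie_deriv v \<omega> p \<beta>)"
        using D[OF p \<alpha>] D[OF p \<beta>] unfolding has_dir_deriv_def by (rule DERIV_add)
      then show "has_dir_deriv (\<lambda>q. \<omega> q (\<alpha> + \<beta>)) v p (lie_deriv v \<omega> p \<alpha> + lie_deriv v \<omega> p \<beta>)"
        by (rule has_dir_deriv_cong[OF _ U p]) (simp add: linear_on_add[OF lin \<alpha> \<beta>])
    qed
    show "lie_deriv v \<omega> p (c *\<^sub>R \<alpha>) = c *\<^sub>R lie_deriv v \<omega> p \<alpha>" for c
    proof (rule has_dir_deriv_unique)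
      show "has_dir_deriv (\<lambda>q. \<omega> q (c *\<^sub>R \<alpha>)) v p (lie_deriv v \<omega> p (c *\<^sub>R \<alpha>))"
        using \<alpha> by (intro D[OF p] subspace_scale[OF subspace_kvectors])
      have "has_dir_deriv (\<lambda>q. c * \<omega> q \<alpha>) v p (c * lie_deriv v \<omega> p \<alpha>)"
        using D[OF p \<alpha>] unfolding has_dir_deriv_def by (rule DERIV_cmult)
      then show "has_dir_deriv (\<lambda>q. \<omega> q (c *\<^sub>R \<alpha>)) v p (c *\<^sub>R lie_deriv v \<omega> p \<alpha>)"
        unfolding real_scaleR_def
        by (rule has_dir_deriv_cong[OF _ U p]) (simp add: linear_on_scaleR[OF lin \<alpha>])
    qed
  qed
  ultimately show "smooth_form k U (lie_deriv v \<omega>)" by (simp add: smooth_form_def)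
qed

text \<open>\<open>B_forms\<close> speaks of unit vectors only, so a general direction is written as
  a multiple of one. The multiples of the iterated Lie derivatives of \<omega> form a
  derivative-closed family, which puts the derivative into \<open>B_forms\<close>.\<close>

lemma B_forms_dir_deriv:
  fixes U :: "(real^'n::finite) set"
  assumes U: "open U" and \<omega>: "\<omega> \<in> B_forms k U"
  shows "\<exists>\<omega>'\<in>B_forms k U. \<forall>p\<in>U. \<forall>\<alpha>\<in>kvectors k. has_dir_deriv (\<lambda>p. \<omega> p \<alpha>) v p (\<omega>' p \<alpha>)"
proof -
  define \<Phi> where "\<Phi> = {(\<lambda>p \<alpha>. c * foldr lie_deriv vs \<omega> p \<alpha>) | c vs. \<forall>v\<in>set vs. norm v = 1}"
  have sm: "smooth_form k U (foldr lie_deriv vs \<omega>)" for vs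
    using \<omega> by (induction vs) (auto simp: B_forms_def smooth_form_lie_deriv[OF U])
  have closed: "\<exists>\<phi>'\<in>\<Phi>. \<forall>p\<in>U. \<forall>\<alpha>\<in>kvectors k. has_dir_deriv (\<lambda>p. \<phi> p \<alpha>) v p (\<phi>' p \<alpha>)" if \<phi>: "\<phi> \<in> \<Phi>" for \<phi> v
  proof -
    obtain c vs where cv: "\<phi> = (\<lambda>p \<alpha>. c * foldr lie_deriv vs \<omega> p \<alpha>)" "\<forall>v\<in>set vs. norm v = 1"
      using \<phi> by (auto simp: \<Phi>_def)
    \<comment> \<open>For v = 0 any unit vector will do, since its coefficient \<open>norm v\<close>
      is 0.\<close>
    obtain u where u: "norm u = 1" "v = norm v *\<^sub>R u"
    proof (cases "v = 0")
      case True
      then show ?thesis using that[of "axis undefined 1"] by simp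
    next
      case False
      then show ?thesis using that[of "(1 / norm v) *\<^sub>R v"] by simp
    qed
    have "(\<lambda>p \<alpha>. (norm v * c) * foldr lie_deriv (u # vs) \<omega> p \<alpha>) \<in> \<Phi>"
      unfolding \<Phi>_def mem_Collect_eq using u cv(2) by (intro exI[of _ "norm v * c"] exI[of _ "u # vs"]) auto
    moreover have "has_dir_deriv (\<lambda>p. \<phi> p \<alpha>) v p ((norm v * c) * foldr lie_deriv (u # vs) \<omega> p \<alpha>)"
      if "p \<in> U" "\<alpha> \<in> kvectors k" for p \<alpha>
    proof -
      have "has_dir_deriv (\<lambda>p. \<phi> p \<alpha>) u p (c * foldr lie_deriv (u # vs) \<omega> p \<alpha>)"
        using smooth_form_lie_deriv(2)[OF U sm[of vs] that, of u]
        unfolding cv has_dir_deriv_def by (simp add: DERIV_cmult)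
      from has_dir_deriv_scale[OF this, of "norm v"] show ?thesis by (simp only: u(2)[symmetric] mult.assoc)
    qed
    ultimately show ?thesis by (intro bexI[of _ "\<lambda>p \<alpha>. (norm v * c) * foldr lie_deriv (u # vs) \<omega> p \<alpha>"]) blast+
  qed
  have "\<Phi> \<subseteq> B_forms k U"
  proof (rule derivative_closed_family_B_forms[OF U _ _ closed])
    fix \<phi> assume "\<phi> \<in> \<Phi>"
    then obtain c vs where cv: "\<phi> = (\<lambda>p \<alpha>. c * foldr lie_deriv vs \<omega> p \<alpha>)" "\<forall>v\<in>set vs. norm v = 1"
      by (auto simp: \<Phi>_def)
    show "linear_on (kvectors k) (\<phi> p)" if "p \<in> U" for p
      using sm[of vs] that by (auto simp: cv smooth_form_def linear_on_def algebra_simps)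
    obtain C where "\<forall>p\<in>U. \<forall>\<alpha>\<in>kvectors k. mass_norm k \<alpha> = 1 \<longrightarrow> \<bar>foldr lie_deriv vs \<omega> p \<alpha>\<bar> \<le> C"
      using \<omega> cv(2) by (auto simp: B_forms_def bounded_form_def)
    then have "\<forall>p\<in>U. \<forall>\<alpha>\<in>kvectors k. mass_norm k \<alpha> = 1 \<longrightarrow> \<bar>\<phi> p \<alpha>\<bar> \<le> \<bar>c\<bar> * C"
      by (simp add: cv abs_mult mult_left_mono)
    then show "bounded_form k U \<phi>" unfolding bounded_form_def by blast
  qed
  moreover have "\<omega> \<in> \<Phi>"
    unfolding \<Phi>_def mem_Collect_eq by (intro exI[of _ 1] exI[of _ "[]"]) simp
  ultimately show ?thesis using closed by (meson subsetD)
qed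

section \<open>Uniform Taylor estimates for forms\<close>

lemma B_forms_linear: "\<omega> \<in> B_forms k U \<Longrightarrow> p \<in> U \<Longrightarrow> linear_on (kvectors k) (\<omega> p)"
  by (simp add: B_forms_def smooth_form_def)

lemma B_forms_bounded: "\<omega> \<in> B_forms k U \<Longrightarrow> bounded_form k U \<omega>"
proof -
  assume "\<omega> \<in> B_forms k U"
  then have "bounded_form k U (foldr lie_deriv [] \<omega>)"
    unfolding B_forms_def mem_Collect_eq by (elim conjE allE[of _ "[]"]) simp
  then show ?thesis by simp
qed

text \<open>Two applications of the mean value inequality along the segment, the first to \<omega>'.
  The segment has to be assumed inside U, which need not be convex; the interval is symmetric so
  that both signs of t are covered. What matters later is that C is independent of p, \<alpha> and
  t.\<close>

lemma B_forms_taylor: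
  fixes U :: "(real^'n::finite) set"
  assumes U: "open U" and \<omega>: "\<omega> \<in> B_forms k U"
  shows "\<exists>\<omega>'\<in>B_forms k U. \<exists>C\<ge>0. \<forall>p \<alpha> t. \<alpha> \<in> kvectors k \<longrightarrow> (\<forall>s. \<bar>s\<bar> \<le> \<bar>t\<bar> \<longrightarrow> p + s *\<^sub>R v \<in> U) \<longrightarrow>
    \<bar>\<omega> (p + t *\<^sub>R v) \<alpha> - \<omega> p \<alpha> - t * \<omega>' p \<alpha>\<bar> \<le> C * t\<^sup>2 * mass_norm k \<alpha>"
proof -
  obtain \<omega>' where \<omega>': "\<omega>' \<in> B_forms k U"
    "\<And>p \<alpha>. p \<in> U \<Longrightarrow> \<alpha> \<in> kvectors k \<Longrightarrow> has_dir_deriv (\<lambda>p. \<omega> p \<alpha>) v p (\<omega>' p \<alpha>)"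
    using B_forms_dir_deriv[OF U \<omega>] by blast
  obtain \<omega>'' where \<omega>'': "\<omega>'' \<in> B_forms k U"
    "\<And>p \<alpha>. p \<in> U \<Longrightarrow> \<alpha> \<in> kvectors k \<Longrightarrow> has_dir_deriv (\<lambda>p. \<omega>' p \<alpha>) v p (\<omega>'' p \<alpha>)"
    using B_forms_dir_deriv[OF U \<omega>'(1)] by blast
  obtain C where C: "C \<ge> 0" "\<And>p \<alpha>. p \<in> U \<Longrightarrow> \<alpha> \<in> kvectors k \<Longrightarrow> \<bar>\<omega>'' p \<alpha>\<bar> \<le> C * mass_norm k \<alpha>"
    using bounded_form_mass_bound[OF B_forms_bounded[OF \<omega>''(1)] B_forms_linear[OF \<omega>''(1)]] by blast
  have times_const: "((\<lambda>s. s * c) has_real_derivative c) (at z)" for c z :: real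
    by (auto intro!: derivative_eq_intros)
  have "\<bar>\<omega> (p + t *\<^sub>R v) \<alpha> - \<omega> p \<alpha> - t * \<omega>' p \<alpha>\<bar> \<le> C * t\<^sup>2 * mass_norm k \<alpha>"
    if \<alpha>: "\<alpha> \<in> kvectors k" and inU: "\<And>s. \<bar>s\<bar> \<le> \<bar>t\<bar> \<Longrightarrow> p + s *\<^sub>R v \<in> U" for p \<alpha> t
  proof -
    let ?S = "{-\<bar>t\<bar>..\<bar>t\<bar>}" and ?m = "C * mass_norm k \<alpha>"
    have U: "p + s *\<^sub>R v \<in> U" if "s \<in> ?S" for s using inU that by auto
    have m: "?m \<ge> 0" using C(1) mass_norm_nonneg[OF \<alpha>] by simp
    have 1: "\<bar>\<omega>' (p + s *\<^sub>R v) \<alpha> - \<omega>' p \<alpha>\<bar> \<le> ?m * \<bar>t\<bar>" if s: "s \<in> ?S" for s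
    proof -
      have "norm (\<omega>' (p + s *\<^sub>R v) \<alpha> - \<omega>' (p + 0 *\<^sub>R v) \<alpha>) \<le> ?m * norm (s - 0)"
      proof (rule field_differentiable_bound[of ?S])
        show "((\<lambda>s. \<omega>' (p + s *\<^sub>R v) \<alpha>) has_real_derivative \<omega>'' (p + z *\<^sub>R v) \<alpha>) (at z within ?S)" if "z \<in> ?S" for z
          using has_dir_deriv_along[OF \<omega>''(2)[OF U[OF that] \<alpha>]] has_field_derivative_at_within by blast
        show "norm (\<omega>'' (p + z *\<^sub>R v) \<alpha>) \<le> ?m" if "z \<in> ?S" for z using C(2)[OF U[OF that] \<alpha>] by simp
      qed (use s in auto)
      also have "\<dots> \<le> ?m * \<bar>t\<bar>" using s m by (intro mult_left_mono) auto
      finally show ?thesis by simp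
    qed
    have "norm ((\<omega> (p + t *\<^sub>R v) \<alpha> - t * \<omega>' p \<alpha>) - (\<omega> (p + 0 *\<^sub>R v) \<alpha> - 0 * \<omega>' p \<alpha>)) \<le> (?m * \<bar>t\<bar>) * norm (t - 0)"
    proof (rule field_differentiable_bound[of ?S])
      show "((\<lambda>s. \<omega> (p + s *\<^sub>R v) \<alpha> - s * \<omega>' p \<alpha>) has_real_derivative \<omega>' (p + z *\<^sub>R v) \<alpha> - \<omega>' p \<alpha>) (at z within ?S)"
        if "z \<in> ?S" for z
        using has_dir_deriv_along[OF \<omega>'(2)[OF U[OF that] \<alpha>]]
        by (rule has_field_derivative_at_within[OF DERIV_diff[OF _ times_const]])
      show "norm (\<omega>' (p + z *\<^sub>R v) \<alpha> - \<omega>' p \<alpha>) \<le> ?m * \<bar>t\<bar>" if "z \<in> ?S" for z using 1[OF that] by simp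
    qed auto
    also have "(?m * \<bar>t\<bar>) * norm (t - 0) = C * t\<^sup>2 * mass_norm k \<alpha>"
      by (simp add: power2_eq_square abs_mult_self_eq mult_ac)
    finally show ?thesis by (simp add: algebra_simps)
  qed
  then show ?thesis using \<omega>'(1) C(1) by (intro bexI[of _ \<omega>'] exI[of _ C]) auto
qed

section \<open>Limits in locally convex spaces\<close>

lemma linear_on_zero: "linear_on S f \<Longrightarrow> subspace S \<Longrightarrow> f 0 = 0"
  using linear_on_scaleR[of S f 0 0] subspace_0[of S] by simp

lemma linear_on_diff:
  assumes "linear_on S f" "subspace S" "x \<in> S" "y \<in> S"
  shows "f (x - y) = f x - f y"
  using linear_on_add[OF assms(1,3), of "(- 1) *\<^sub>R y"] linear_on_scaleR[OF assms(1,4), of "- 1"]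
    subspace_scale[OF assms(2,4), of "- 1"] by simp

lemma linear_on_sum:
  assumes "linear_on S f" "subspace S" "finite I" "\<And>i. i \<in> I \<Longrightarrow> x i \<in> S"
  shows "f (\<Sum>i\<in>I. x i) = (\<Sum>i\<in>I. f (x i))"
  using assms(3,4)
proof (induction I)
  case empty
  then show ?case using linear_on_zero[OF assms(1,2)] by simp
next
  case (insert i I)
  then show ?case
    using linear_on_add[OF assms(1), of "x i" "sum x I"] subspace_sum[OF assms(2), of I x] by simp
qed

lemma limitin_linear_add:
  assumes Y: "locally_convex_space Y" and "limitin Y f l F" "limitin Y g m F"
  shows "limitin Y (\<lambda>t. f t + g t) (l + m) F"
proof -
  have "limitin (prod_topology Y Y) (\<lambda>t. (f t, g t)) (l, m) F"
    using assms(2,3) by (simp add: limitin_pairwise o_def)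
  moreover have "continuous_map (prod_topology Y Y) Y (\<lambda>(x, y). x + y)"
    using Y by (simp add: locally_convex_space_def)
  ultimately show ?thesis using continuous_map_limit by (fastforce simp: o_def)
qed

lemma limitin_linear_scale:
  assumes Y: "locally_convex_space Y" and "limitin Y f l F"
  shows "limitin Y (\<lambda>t. c *\<^sub>R f t) (c *\<^sub>R l) F"
proof -
  have "limitin (prod_topology euclideanreal Y) (\<lambda>t. (c, f t)) (c, l) F"
    using assms(2) by (simp add: limitin_pairwise o_def)
  moreover have "continuous_map (prod_topology euclideanreal Y) Y (\<lambda>(c, x). c *\<^sub>R x)"
    using Y by (simp add: locally_convex_space_def)
  ultimately show ?thesis using continuous_map_limit by (fastforce simp: o_def)
qed

lemma limitin_linear_sum:
  assumes Y: "locally_convex_space Y" and "finite I" "\<And>i. i \<in> I \<Longrightarrow> limitin Y (f i) (l i) F"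
  shows "limitin Y (\<lambda>t. \<Sum>i\<in>I. f i t) (\<Sum>i\<in>I. l i) F"
  using assms(2,3)
proof (induction I)
  case empty
  then show ?case using subspace_0[OF locally_convex_space_subspace[OF Y]] by (simp add: limitin_const_iff)
next
  case (insert i I)
  then show ?case by (simp add: limitin_linear_add[OF Y])
qed

lemma limitin_linear_nbhd:
  assumes Y: "locally_convex_space Y" and l: "limitin Y f l F" and V: "openin Y V" "0 \<in> V"
  shows "\<forall>\<^sub>F t in F. f t \<in> topspace Y \<and> f t - l \<in> V"
proof -
  note sub = locally_convex_space_subspace[OF Y]
  have lY: "l \<in> topspace Y" using l by (rule limitin_topspace)
  have "openin Y {y \<in> topspace Y. - l + y \<in> V}"
    using lY by (intro openin_translate[OF Y _ V(1)] subspace_neg[OF sub])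
  moreover have "l \<in> {y \<in> topspace Y. - l + y \<in> V}" using lY V(2) by simp
  ultimately have "\<forall>\<^sub>F t in F. f t \<in> {y \<in> topspace Y. - l + y \<in> V}" using l unfolding limitin_def by blast
  then show ?thesis by (rule eventually_mono) simp
qed

text \<open>A Cauchy criterion whose approximate limit l may change with e. In
  \<open>functional_derivative\<close> the value of f at one difference quotient serves as l, so the
  limit need not be guessed.\<close>

lemma limit_at_0_real_Cauchy:
  fixes f :: "real \<Rightarrow> real"
  assumes "\<And>e. e > 0 \<Longrightarrow> \<exists>l. \<forall>\<^sub>F t in at 0. \<bar>f t - l\<bar> < e"
  shows "\<exists>L. (f \<longlongrightarrow> L) (at 0)"
proof -
  have "cauchy_filter (filtermap f (at 0))"
    unfolding cauchy_filter_metric_filtermap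
  proof (intro allI impI)
    fix e :: real assume "e > 0"
    then obtain l where "\<forall>\<^sub>F t in at 0. \<bar>f t - l\<bar> < e / 2" using assms[of "e / 2"] by auto
    moreover have "dist (f s) (f t) < e" if "\<bar>f s - l\<bar> < e / 2" "\<bar>f t - l\<bar> < e / 2" for s t
      using that unfolding dist_real_def by linarith
    ultimately show "\<exists>P. eventually P (at 0) \<and> (\<forall>x y. P x \<and> P y \<longrightarrow> dist (f x) (f y) < e)"
      by (intro exI[of _ "\<lambda>t. \<bar>f t - l\<bar> < e / 2"]) auto
  qed
  moreover have "complete (UNIV :: real set)"
    by (meson Cauchy_convergent UNIV_I complete_def convergent_def)
  ultimately show ?thesis
    using complete_uniform[where S = "UNIV :: real set"] by (force simp: filterlim_def)
qed

section \<open>Difference quotients of chains\<close>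

lemma pointed_chainsD:
  assumes "A \<in> pointed_chains k U"
  shows "finite {p. A p \<noteq> 0}" "\<And>p. A p \<noteq> 0 \<Longrightarrow> p \<in> U" "\<And>p. A p \<in> kvectors k"
  using assms by (auto simp: pointed_chains_def)

lemma subspace_pointed_chains: "subspace (pointed_chains k U)"
  unfolding subspace_def
proof (intro conjI ballI allI)
  show "0 \<in> pointed_chains k U" using subspace_0[OF subspace_kvectors] by (auto simp: pointed_chains_def)
  fix A B :: "'a chain" assume AB: "A \<in> pointed_chains k U" "B \<in> pointed_chains k U"
  have "{p. (A + B) p \<noteq> 0} \<subseteq> {p. A p \<noteq> 0} \<union> {p. B p \<noteq> 0}" by auto
  then have "finite {p. (A + B) p \<noteq> 0}" "{p. (A + B) p \<noteq> 0} \<subseteq> U"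
    using AB finite_subset[of "{p. (A + B) p \<noteq> 0}" "{p. A p \<noteq> 0} \<union> {p. B p \<noteq> 0}"]
    by (auto simp: pointed_chains_def)
  then show "A + B \<in> pointed_chains k U"
    using subspace_add[OF subspace_kvectors pointed_chainsD(3)[OF AB(1)] pointed_chainsD(3)[OF AB(2)]]
    by (auto simp: pointed_chains_def)
next
  fix c and A :: "'a chain" assume A: "A \<in> pointed_chains k U"
  have "{p. (c *\<^sub>R A) p \<noteq> 0} \<subseteq> {p. A p \<noteq> 0}" by auto
  then have "finite {p. (c *\<^sub>R A) p \<noteq> 0}" "{p. (c *\<^sub>R A) p \<noteq> 0} \<subseteq> U"
    using A finite_subset[of "{p. (c *\<^sub>R A) p \<noteq> 0}" "{p. A p \<noteq> 0}"] by (auto simp: pointed_chains_def)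
  then show "c *\<^sub>R A \<in> pointed_chains k U"
    using subspace_scale[OF subspace_kvectors pointed_chainsD(3)[OF A]] by (auto simp: pointed_chains_def)
qed

lemma element_in_pointed_chains:
  assumes "p \<in> U" "\<alpha> \<in> kvectors k"
  shows "element p \<alpha> \<in> pointed_chains k U"
proof -
  have "{q. element p \<alpha> q \<noteq> 0} \<subseteq> {p}" by (auto simp: element_def)
  then show ?thesis
    using assms subspace_0[OF subspace_kvectors, of k] finite_subset[of _ "{p}"]
    by (auto simp: pointed_chains_def element_def split: if_splits)
qed

lemma element_add: "element p (\<alpha> + \<beta>) = element p \<alpha> + element p \<beta>"
  by (auto simp: element_def fun_eq_iff)

lemma element_scale: "element p (c *\<^sub>R \<alpha>) = c *\<^sub>R element p \<alpha>"
  by (auto simp: element_def fun_eq_iff)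

lemma sum_fun_apply: "(\<Sum>i\<in>I. f i) x = (\<Sum>i\<in>I. f i x)"
  by (induction I rule: infinite_finite_induct) auto

lemma chain_eq_sum_element:
  assumes "A \<in> pointed_chains k U"
  shows "(\<Sum>p | A p \<noteq> 0. element p (A p)) = A"
proof
  fix q
  have "(\<Sum>p | A p \<noteq> 0. element p (A p)) q = (\<Sum>p | A p \<noteq> 0. element p (A p) q)"
    by (rule sum_fun_apply)
  also have "\<dots> = (\<Sum>p | A p \<noteq> 0. if q = p then A p else 0)" by (simp add: element_def)
  also have "\<dots> = A q" using pointed_chainsD(1)[OF assms] by simp
  finally show "(\<Sum>p | A p \<noteq> 0. element p (A p)) q = A q" .
qed

text \<open>Algebraically, every linear functional on chains is integration against a form that is
  linear in each fibre. For a continuous functional only the regularity of this form remains to be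
  shown.\<close>

lemma chain_integral_functional:
  assumes f: "linear_on (pointed_chains k U) f" and A: "A \<in> pointed_chains k U"
  shows "chain_integral A (\<lambda>p \<alpha>. f (element p \<alpha>)) = f A"
proof -
  have "f A = f (\<Sum>p | A p \<noteq> 0. element p (A p))" by (simp add: chain_eq_sum_element[OF A])
  also have "\<dots> = (\<Sum>p | A p \<noteq> 0. f (element p (A p)))"
    using pointed_chainsD[OF A]
    by (intro linear_on_sum[OF f subspace_pointed_chains]) (auto intro: element_in_pointed_chains)
  finally show ?thesis by (simp add: chain_integral_def)
qed

text \<open>Supports change under sums and multiples through cancellation. A fixed finite set
  containing all supports involved makes integrals comparable term by term.\<close>

lemma chain_integral_superset:
  assumes "\<And>p. p \<in> U \<Longrightarrow> linear_on (kvectors k) (\<omega> p)"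
    and "finite T" "T \<subseteq> U" "{p. A p \<noteq> 0} \<subseteq> T"
  shows "chain_integral A \<omega> = (\<Sum>p\<in>T. \<omega> p (A p))"
  unfolding chain_integral_def
proof (rule sum.mono_neutral_left[OF assms(2,4)])
  show "\<forall>p\<in>T - {p. A p \<noteq> 0}. \<omega> p (A p) = 0"
    using linear_on_zero[OF assms(1) subspace_kvectors] assms(3) by auto
qed

lemma linear_on_chain_integral:
  fixes U :: "(real^'n::finite) set"
  assumes lin: "\<And>p. p \<in> U \<Longrightarrow> linear_on (kvectors k) (\<omega> p)"
  shows "linear_on (pointed_chains k U) (\<lambda>A. chain_integral A \<omega>)"
  unfolding linear_on_def
proof (intro conjI ballI allI)
  fix A B :: "'n chain" and c assume A: "A \<in> pointed_chains k U"
  note A' = pointed_chainsD[OF A]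
  show "chain_integral (A + B) \<omega> = chain_integral A \<omega> + chain_integral B \<omega>" if B: "B \<in> pointed_chains k U"
  proof -
    note B' = pointed_chainsD[OF B]
    let ?T = "{p. A p \<noteq> 0} \<union> {p. B p \<noteq> 0}"
    have T: "finite ?T" "?T \<subseteq> U" using A' B' by auto
    have "chain_integral (A + B) \<omega> = (\<Sum>p\<in>?T. \<omega> p ((A + B) p))"
      by (rule chain_integral_superset[OF lin T]) auto
    also have "\<dots> = (\<Sum>p\<in>?T. \<omega> p (A p) + \<omega> p (B p))"
      using T(2) linear_on_add[OF lin] A'(3) B'(3) by (intro sum.cong) auto
    also have "\<dots> = chain_integral A \<omega> + chain_integral B \<omega>"
      using chain_integral_superset[OF lin T, where A = A] chain_integral_superset[OF lin T, where A = B]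
      by (simp add: sum.distrib)
    finally show ?thesis .
  qed
  show "chain_integral (c *\<^sub>R A) \<omega> = c *\<^sub>R chain_integral A \<omega>" for c
  proof -
    let ?T = "{p. A p \<noteq> 0}"
    have T: "finite ?T" "?T \<subseteq> U" using A' by auto
    have "chain_integral (c *\<^sub>R A) \<omega> = (\<Sum>p\<in>?T. \<omega> p ((c *\<^sub>R A) p))"
      by (rule chain_integral_superset[OF lin T]) auto
    also have "\<dots> = (\<Sum>p\<in>?T. c * \<omega> p (A p))"
      using T(2) linear_on_scaleR[OF lin] A'(3) by (intro sum.cong) auto
    finally show ?thesis by (simp add: chain_integral_def sum_distrib_left)
  qed
qed

lemma chain_integral_element:
  assumes "\<And>p. p \<in> U \<Longrightarrow> linear_on (kvectors k) (\<omega> p)" "p \<in> U"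
  shows "chain_integral (element p \<alpha>) \<omega> = \<omega> p \<alpha>"
proof -
  have "chain_integral (element p \<alpha>) \<omega> = (\<Sum>q\<in>{p}. \<omega> q (element p \<alpha> q))"
    by (rule chain_integral_superset[OF assms(1)]) (use assms(2) in \<open>auto simp: element_def\<close>)
  then show ?thesis by (simp add: element_def)
qed

text \<open>Written for whole chains, so that linearity is immediate; on elements it is the
  expression in condition (3), see \<open>diff_quot_element\<close>. The value at t = 0 is 0, and
  for large t the support may leave U.\<close>

definition diff_quot :: "real^'n::finite \<Rightarrow> real \<Rightarrow> 'n chain \<Rightarrow> 'n chain" where
  "diff_quot v t A = (\<lambda>q. (A (q - t *\<^sub>R v) - A q) /\<^sub>R t)"

lemma linear_diff_quot: "linear (diff_quot v t)"
  by (rule linearI) (auto simp: diff_quot_def fun_eq_iff algebra_simps)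

lemma diff_quot_element:
  "diff_quot v t (element p \<alpha>) = element (p + t *\<^sub>R v) (\<alpha> /\<^sub>R t) - element p (\<alpha> /\<^sub>R t)"
  by (auto simp: diff_quot_def element_def fun_eq_iff algebra_simps)

lemma diff_quot_eq_sum:
  assumes "A \<in> pointed_chains k U"
  shows "diff_quot v t A = (\<Sum>p | A p \<noteq> 0. diff_quot v t (element p (A p)))"
  using linear_sum[OF linear_diff_quot, of v t "\<lambda>p. element p (A p)" "{p. A p \<noteq> 0}"]
  by (simp add: chain_eq_sum_element[OF assms])

lemma diff_quot_element_mem:
  assumes "p \<in> U" "p + t *\<^sub>R v \<in> U" "\<alpha> \<in> kvectors k"
  shows "diff_quot v t (element p \<alpha>) \<in> pointed_chains k U"
  unfolding diff_quot_element using assms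
  by (intro subspace_diff[OF subspace_pointed_chains] element_in_pointed_chains subspace_scale[OF subspace_kvectors])

lemma diff_quot_mem:
  assumes A: "A \<in> pointed_chains k U" and "\<And>p. A p \<noteq> 0 \<Longrightarrow> p + t *\<^sub>R v \<in> U"
  shows "diff_quot v t A \<in> pointed_chains k U"
  unfolding diff_quot_eq_sum[OF A] using assms(2) pointed_chainsD[OF A]
  by (intro subspace_sum[OF subspace_pointed_chains] diff_quot_element_mem) auto

lemma chain_integral_diff_quot:
  assumes A: "A \<in> pointed_chains k U" and t: "\<And>p. A p \<noteq> 0 \<Longrightarrow> p + t *\<^sub>R v \<in> U"
    and lin: "\<And>p. p \<in> U \<Longrightarrow> linear_on (kvectors k) (\<omega> p)"
  shows "chain_integral (diff_quot v t A) \<omega> = (\<Sum>p | A p \<noteq> 0. (\<omega> (p + t *\<^sub>R v) (A p) - \<omega> p (A p)) / t)"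
proof -
  note A' = pointed_chainsD[OF A]
  have 1: "chain_integral (diff_quot v t (element p (A p))) \<omega> = (\<omega> (p + t *\<^sub>R v) (A p) - \<omega> p (A p)) / t"
    if p: "A p \<noteq> 0" for p
  proof -
    have K: "A p /\<^sub>R t \<in> kvectors k" using A'(3) by (rule subspace_scale[OF subspace_kvectors])
    have "chain_integral (diff_quot v t (element p (A p))) \<omega> = \<omega> (p + t *\<^sub>R v) (A p /\<^sub>R t) - \<omega> p (A p /\<^sub>R t)"
      unfolding diff_quot_element using A'(2)[OF p] t[OF p] K
      by (subst linear_on_diff[OF linear_on_chain_integral[OF lin] subspace_pointed_chains])
        (auto simp: chain_integral_element[OF lin] intro: element_in_pointed_chains)
    then show ?thesis
      using A' t[OF p] p linear_on_scaleR[OF lin] by (simp add: divide_inverse mult.commute right_diff_distrib)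
  qed
  have "chain_integral (diff_quot v t A) \<omega> = (\<Sum>p | A p \<noteq> 0. chain_integral (diff_quot v t (element p (A p))) \<omega>)"
    unfolding diff_quot_eq_sum[OF A] using A' t
    by (intro linear_on_sum[OF linear_on_chain_integral[OF lin] subspace_pointed_chains] diff_quot_element_mem) auto
  then show ?thesis using 1 by simp
qed

definition chain_mass :: "nat \<Rightarrow> 'n::finite chain \<Rightarrow> real" where
  "chain_mass k A = (\<Sum>p | A p \<noteq> 0. mass_norm k (A p))"

text \<open>Whole segments rather than end points are kept in U, since Taylor's formula is applied
  along them.\<close>

definition chain_room :: "(real^'n::finite) set \<Rightarrow> real^'n \<Rightarrow> 'n chain \<Rightarrow> real \<Rightarrow> bool" where
  "chain_room U v A e \<longleftrightarrow> (\<forall>p s. A p \<noteq> 0 \<and> \<bar>s\<bar> < e \<longrightarrow> p + s *\<^sub>R v \<in> U)"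

lemma chain_room_exists:
  assumes U: "open U" and A: "A \<in> pointed_chains k U"
  obtains e where "e > 0" "chain_room U v A e"
proof -
  have "\<exists>e>0. \<forall>s. \<bar>s\<bar> < e \<longrightarrow> p + s *\<^sub>R v \<in> U" if "A p \<noteq> 0" for p
  proof -
    have "open ((\<lambda>s. p + s *\<^sub>R v) -` U)" by (intro continuous_open_vimage U continuous_intros)
    moreover have "0 \<in> (\<lambda>s. p + s *\<^sub>R v) -` U" using pointed_chainsD(2)[OF A that] by simp
    ultimately obtain e where "e > 0" "ball 0 e \<subseteq> (\<lambda>s. p + s *\<^sub>R v) -` U" by (rule openE)
    then show ?thesis by (intro exI[of _ e]) auto
  qed
  then obtain e where e: "\<And>p. A p \<noteq> 0 \<Longrightarrow> e p > 0" "\<And>p s. A p \<noteq> 0 \<Longrightarrow> \<bar>s\<bar> < e p \<Longrightarrow> p + s *\<^sub>R v \<in> U"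
    by metis
  \<comment> \<open>The 1 provides a minimum for the zero chain, whose support is empty.\<close>
  define m where "m = Min (insert 1 (e ` {p. A p \<noteq> 0}))"
  have fin: "finite (insert 1 (e ` {p. A p \<noteq> 0}))" using pointed_chainsD(1)[OF A] by simp
  have "m > 0" unfolding m_def using fin e(1) by (subst Min_gr_iff) auto
  moreover have "m \<le> e p" if "A p \<noteq> 0" for p unfolding m_def using fin that by (intro Min_le) auto
  then have "chain_room U v A m" unfolding chain_room_def using e(2) by fastforce
  ultimately show thesis by (rule that)
qed

lemma chain_room_diff_quot_mem:
  assumes "A \<in> pointed_chains k U" "chain_room U v A e" "\<bar>t\<bar> < e"
  shows "diff_quot v t A \<in> pointed_chains k U"
  using assms by (intro diff_quot_mem) (auto simp: chain_room_def)

text \<open>All dependence on the chain sits in \<open>chain_mass\<close> and in the admissible size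
  of t; \<omega>' and C are chosen before A. This order is what permits steps that vary with the
  chain in \<open>weakly_bounded_diff_quot\<close>.\<close>

lemma chain_integral_diff_quot_taylor:
  fixes U :: "(real^'n::finite) set"
  assumes U: "open U" and \<omega>: "\<omega> \<in> B_forms k U"
  shows "\<exists>\<omega>'\<in>B_forms k U. \<exists>C\<ge>0. \<forall>A t e. A \<in> pointed_chains k U \<longrightarrow> chain_room U v A e \<longrightarrow> t \<noteq> 0 \<longrightarrow> \<bar>t\<bar> < e \<longrightarrow>
    \<bar>chain_integral (diff_quot v t A) \<omega> - chain_integral A \<omega>'\<bar> \<le> C * \<bar>t\<bar> * chain_mass k A"
proof -
  obtain \<omega>' C where \<omega>': "\<omega>' \<in> B_forms k U" "C \<ge> 0"
    "\<And>p \<alpha> t. \<alpha> \<in> kvectors k \<Longrightarrow> (\<And>s. \<bar>s\<bar> \<le> \<bar>t\<bar> \<Longrightarrow> p + s *\<^sub>R v \<in> U) \<Longrightarrow>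
      \<bar>\<omega> (p + t *\<^sub>R v) \<alpha> - \<omega> p \<alpha> - t * \<omega>' p \<alpha>\<bar> \<le> C * t\<^sup>2 * mass_norm k \<alpha>"
    using B_forms_taylor[OF U \<omega>, of v] by metis
  have "\<bar>chain_integral (diff_quot v t A) \<omega> - chain_integral A \<omega>'\<bar> \<le> C * \<bar>t\<bar> * chain_mass k A"
    if A: "A \<in> pointed_chains k U" and e: "chain_room U v A e" and t: "t \<noteq> 0" "\<bar>t\<bar> < e" for A t e
  proof -
    have 1: "\<bar>(\<omega> (p + t *\<^sub>R v) (A p) - \<omega> p (A p)) / t - \<omega>' p (A p)\<bar> \<le> C * \<bar>t\<bar> * mass_norm k (A p)"
      if p: "A p \<noteq> 0" for p
    proof -
      have "\<bar>\<omega> (p + t *\<^sub>R v) (A p) - \<omega> p (A p) - t * \<omega>' p (A p)\<bar> \<le> C * t\<^sup>2 * mass_norm k (A p)"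
        using e t p by (intro \<omega>'(3) pointed_chainsD(3)[OF A]) (auto simp: chain_room_def)
      then have "\<bar>\<omega> (p + t *\<^sub>R v) (A p) - \<omega> p (A p) - t * \<omega>' p (A p)\<bar> / \<bar>t\<bar> \<le> C * t\<^sup>2 * mass_norm k (A p) / \<bar>t\<bar>"
        by (rule divide_right_mono) simp
      also have "C * t\<^sup>2 * mass_norm k (A p) / \<bar>t\<bar> = C * \<bar>t\<bar> * mass_norm k (A p)"
        using t(1) by (cases "0 \<le> t") (simp_all add: power2_eq_square)
      finally show ?thesis using t(1) by (simp add: diff_divide_distrib flip: abs_divide)
    qed
    have "chain_integral (diff_quot v t A) \<omega> - chain_integral A \<omega>' =
        (\<Sum>p | A p \<noteq> 0. (\<omega> (p + t *\<^sub>R v) (A p) - \<omega> p (A p)) / t - \<omega>' p (A p))"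
      using chain_integral_diff_quot[OF A _ B_forms_linear[OF \<omega>], of t v] e t
      by (simp add: chain_room_def chain_integral_def sum_subtractf)
    also have "\<bar>\<dots>\<bar> \<le> (\<Sum>p | A p \<noteq> 0. C * \<bar>t\<bar> * mass_norm k (A p))"
      using 1 by (intro order_trans[OF sum_abs] sum_mono) auto
    finally show ?thesis by (simp add: chain_mass_def sum_distrib_left)
  qed
  then show ?thesis using \<omega>'(1,2) by blast
qed

section \<open>The bornological topology of the weakly bounded sets\<close>

definition weakly_bounded :: "nat \<Rightarrow> (real^'n::finite) set \<Rightarrow> 'n chain set \<Rightarrow> bool" where
  "weakly_bounded k U S \<longleftrightarrow> S \<subseteq> pointed_chains k U \<and>
     (\<forall>\<omega>\<in>B_forms k U. \<exists>C. \<forall>A\<in>S. \<bar>chain_integral A \<omega>\<bar> \<le> C)"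

text \<open>One r for each S suffices: convexity and symmetry of W extend the inclusion to all
  smaller positive r.\<close>

definition bornivores :: "nat \<Rightarrow> (real^'n::finite) set \<Rightarrow> 'n chain set set" where
  "bornivores k U = {W. W \<subseteq> pointed_chains k U \<and> 0 \<in> W \<and> convex W \<and> (\<forall>A\<in>W. - A \<in> W) \<and>
     (\<forall>S. weakly_bounded k U S \<longrightarrow> (\<exists>r>0. \<forall>A\<in>S. r *\<^sub>R A \<in> W))}"

text \<open>Spelled exactly as the topology in \<open>locally_convex_space_from_base\<close>, so
  that this lemma can be folded.\<close>

definition bornological_topology :: "nat \<Rightarrow> (real^'n::finite) set \<Rightarrow> 'n chain topology" where
  "bornological_topology k U =
     topology (\<lambda>G. G \<subseteq> pointed_chains k U \<and> (\<forall>x\<in>G. \<exists>A\<in>bornivores k U. \<forall>a\<in>A. x + a \<in> G))"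

lemma bornivore_scale: "W \<in> bornivores k U \<Longrightarrow> x \<in> W \<Longrightarrow> \<bar>c\<bar> \<le> 1 \<Longrightarrow> c *\<^sub>R x \<in> W"
  unfolding bornivores_def by (blast intro: convex_symmetric_scale)

lemma linear_on_B_form:
  "\<omega> \<in> B_forms k U \<Longrightarrow> linear_on (pointed_chains k U) (\<lambda>A. chain_integral A \<omega>)"
  by (rule linear_on_chain_integral) (rule B_forms_linear)

lemma weakly_bounded_singleton: "A \<in> pointed_chains k U \<Longrightarrow> weakly_bounded k U {A}"
  by (auto simp: weakly_bounded_def)

lemma bornological_topology:
  fixes U :: "(real^'n::finite) set"
  shows openin_bornological: "\<And>G. openin (bornological_topology k U) G \<longleftrightarrow>
      G \<subseteq> pointed_chains k U \<and> (\<forall>x\<in>G. \<exists>A\<in>bornivores k U. \<forall>a\<in>A. x + a \<in> G)"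
    and topspace_bornological: "topspace (bornological_topology k U) = pointed_chains k U"
    and bornivore_nbhd: "\<And>W. W \<in> bornivores k U \<Longrightarrow>
      \<exists>G. openin (bornological_topology k U) G \<and> 0 \<in> G \<and> G \<subseteq> W"
    and locally_convex_space_bornological: "locally_convex_space (bornological_topology k U)"
proof -
  let ?P = "pointed_chains k U" and ?B = "bornivores k U"
  have "?P \<in> ?B"
    unfolding bornivores_def mem_Collect_eq
  proof (intro conjI allI impI)
    fix S assume "weakly_bounded k U S"
    then show "\<exists>r>0. \<forall>A\<in>S. r *\<^sub>R A \<in> ?P" by (intro exI[of _ 1]) (auto simp: weakly_bounded_def)
  qed (use subspace_pointed_chains in \<open>auto intro: subspace_0 subspace_imp_convex subspace_neg\<close>)
  then have 1: "?B \<noteq> {}" by blast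
  have 2: "W \<subseteq> ?P \<and> 0 \<in> W \<and> convex W \<and> (\<forall>A\<in>W. - A \<in> W)" if "W \<in> ?B" for W
    using that by (simp add: bornivores_def)
  have absorbs: "\<exists>r>0. \<forall>A\<in>S. r *\<^sub>R A \<in> W" if "W \<in> ?B" "weakly_bounded k U S" for W S
    using that by (simp add: bornivores_def)
  have 3: "\<exists>V\<in>?B. V \<subseteq> W \<and> V \<subseteq> W'" if W: "W \<in> ?B" "W' \<in> ?B" for W W'
  proof (intro bexI[of _ "W \<inter> W'"] conjI)
    have "\<exists>r>0. \<forall>A\<in>S. r *\<^sub>R A \<in> W \<inter> W'" if S: "weakly_bounded k U S" for S
    proof -
      obtain r where r: "r > 0" "\<forall>A\<in>S. r *\<^sub>R A \<in> W" using absorbs[OF W(1) S] by blast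
      obtain s where s: "s > 0" "\<forall>A\<in>S. s *\<^sub>R A \<in> W'" using absorbs[OF W(2) S] by blast
      have "min r s *\<^sub>R A \<in> W \<inter> W'" if A: "A \<in> S" for A
        using bornivore_scale[OF W(1), of "r *\<^sub>R A" "min r s / r"] bornivore_scale[OF W(2), of "s *\<^sub>R A" "min r s / s"] r s A by simp
      then show ?thesis using r s by (intro exI[of _ "min r s"]) auto
    qed
    then show "W \<inter> W' \<in> ?B"
      using 2[OF W(1)] 2[OF W(2)] unfolding bornivores_def by (auto intro: convex_Int)
  qed auto
  have 4: "\<exists>V\<in>?B. \<forall>x\<in>V. \<forall>y\<in>V. x + y \<in> W" if W: "W \<in> ?B" for W
  proof -
    let ?V = "(\<lambda>x. (1/2) *\<^sub>R x) ` W"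
    have "\<exists>r>0. \<forall>A\<in>S. r *\<^sub>R A \<in> ?V" if S: "weakly_bounded k U S" for S
    proof -
      obtain r where r: "r > 0" "\<forall>A\<in>S. r *\<^sub>R A \<in> W" using absorbs[OF W S] by blast
      have "(r / 2) *\<^sub>R A \<in> ?V" if "A \<in> S" for A
        using r(2) that by (intro image_eqI[of _ _ "r *\<^sub>R A"]) auto
      then show ?thesis using r by (intro exI[of _ "r / 2"]) auto
    qed
    moreover have "?V \<subseteq> ?P" using 2[OF W] by (auto intro: subspace_scale[OF subspace_pointed_chains])
    moreover have "convex ?V" using 2[OF W] by (intro convex_scaling) auto
    moreover have "0 \<in> ?V" using 2[OF W] by (intro image_eqI[of _ _ 0]) auto
    moreover have "\<forall>A\<in>?V. - A \<in> ?V" using 2[OF W] by (auto intro!: image_eqI[of _ _ "- _"])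
    ultimately have "?V \<in> ?B" by (simp add: bornivores_def)
    moreover have "x + y \<in> W" if xy: "x \<in> ?V" "y \<in> ?V" for x y
    proof -
      obtain a b where "a \<in> W" "b \<in> W" "x = (1/2) *\<^sub>R a" "y = (1/2) *\<^sub>R b" using xy by blast
      then show ?thesis using convexD[of W a b "1/2" "1/2"] 2[OF W] by simp
    qed
    ultimately show ?thesis by (intro bexI[of _ ?V] ballI)
  qed
  have 5: "\<exists>r>0. r *\<^sub>R x \<in> W" if "W \<in> ?B" "x \<in> ?P" for W x
    using absorbs[OF that(1) weakly_bounded_singleton[OF that(2)]] by simp
  note base = locally_convex_space_from_base[OF subspace_pointed_chains 1 2 3 4 5, folded bornological_topology_def]
  show "openin (bornological_topology k U) G \<longleftrightarrow>
      G \<subseteq> ?P \<and> (\<forall>x\<in>G. \<exists>A\<in>?B. \<forall>a\<in>A. x + a \<in> G)" for G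
    by (rule base(1))
  show "topspace (bornological_topology k U) = ?P" by (rule base(2))
  show "locally_convex_space (bornological_topology k U)" by (rule base(4))
  have "\<exists>G. openin (bornological_topology k U) G \<and> x \<in> G \<and> (\<forall>g\<in>G. g - x \<in> W)" if "x \<in> ?P" "W \<in> ?B" for x W
    by (rule base(3)) (use that in blast)+
  from this[OF subspace_0[OF subspace_pointed_chains]]
  show "\<exists>G. openin (bornological_topology k U) G \<and> 0 \<in> G \<and> G \<subseteq> W" if "W \<in> ?B" for W
    using that by fastforce
qed

lemma openin_bornological_absorbs:
  assumes "openin (bornological_topology k U) W" "0 \<in> W"
  shows "\<exists>V\<in>bornivores k U. V \<subseteq> W"
  using assms unfolding openin_bornological by fastforce

lemma weakly_bounded_imp_vn_bounded_bornological:
  assumes S: "weakly_bounded k U S"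
  shows "vn_bounded (bornological_topology k U) S"
  unfolding vn_bounded_def
proof (intro conjI allI impI)
  show "S \<subseteq> topspace (bornological_topology k U)"
    using S by (simp add: weakly_bounded_def topspace_bornological)
  fix W assume "openin (bornological_topology k U) W \<and> 0 \<in> W"
  then obtain V where V: "V \<in> bornivores k U" "V \<subseteq> W" using openin_bornological_absorbs by blast
  obtain r where r: "r > 0" "\<forall>A\<in>S. r *\<^sub>R A \<in> V" using V(1) S by (auto simp: bornivores_def)
  have "A \<in> (\<lambda>w. c *\<^sub>R w) ` W" if c: "1 / r \<le> \<bar>c\<bar>" and A: "A \<in> S" for c A
  proof (rule image_eqI[of _ _ "(1 / c) *\<^sub>R A"])
    have c0: "c \<noteq> 0" using c r by auto
    then show "A = c *\<^sub>R ((1 / c) *\<^sub>R A)" by simp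
    have "(1 / (c * r)) *\<^sub>R (r *\<^sub>R A) \<in> V"
      by (rule bornivore_scale[OF V(1)]) (use r A c in \<open>auto simp: abs_mult field_simps\<close>)
    then show "(1 / c) *\<^sub>R A \<in> W" using r(1) V(2) by auto
  qed
  then show "\<exists>r>0. \<forall>c. r \<le> \<bar>c\<bar> \<longrightarrow> S \<subseteq> (\<lambda>w. c *\<^sub>R w) ` W" using r(1) by (intro exI[of _ "1 / r"]) auto
qed

text \<open>The preimage of an absolutely convex neighbourhood under T absorbs every weakly bounded
  set, hence is a bornivore. This yields condition (1), the continuity of forms and, for the
  identity map, the comparison of topologies.\<close>

lemma continuous_map_bornological:
  assumes F: "locally_convex_space F" and T: "linear_on (pointed_chains k U) T"
    and bd: "\<And>S. weakly_bounded k U S \<Longrightarrow> vn_bounded F (T ` S)"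
  shows "continuous_map (bornological_topology k U) F T"
proof (rule continuous_map_linear[OF locally_convex_space_bornological F])
  let ?P = "pointed_chains k U"
  show "linear_on (topspace (bornological_topology k U)) T" using T by (simp add: topspace_bornological)
  show sub: "T ` topspace (bornological_topology k U) \<subseteq> topspace F"
    using bd[OF weakly_bounded_singleton] by (auto simp: topspace_bornological vn_bounded_def)
  fix W assume "openin F W" "0 \<in> W"
  then obtain V where V: "openin F V" "0 \<in> V" "convex V" "\<forall>x\<in>V. - x \<in> V" "V \<subseteq> W"
    using locally_convex_space_absconvex_nbhd[OF F] by metis
  note [simp] = linear_on_add[OF T] linear_on_scaleR[OF T] linear_on_zero[OF T subspace_pointed_chains]
  note subP = subspace_pointed_chains[of k U]
  let ?V = "{A \<in> ?P. T A \<in> V}"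
  have "\<exists>r>0. \<forall>A\<in>S. r *\<^sub>R A \<in> ?V" if S: "weakly_bounded k U S" for S
  proof -
    have SP: "S \<subseteq> ?P" using S by (simp add: weakly_bounded_def)
    obtain r where r: "r > 0" "\<And>c. \<bar>c\<bar> \<ge> r \<Longrightarrow> T ` S \<subseteq> (\<lambda>w. c *\<^sub>R w) ` V"
      using bd[OF S] V(1,2) unfolding vn_bounded_def by blast
    have "(1 / r) *\<^sub>R A \<in> ?V" if A: "A \<in> S" for A
    proof -
      obtain w where "w \<in> V" "T A = r *\<^sub>R w" using r(2)[of r] A by fastforce
      moreover have "A \<in> ?P" using A SP by blast
      ultimately show ?thesis using r(1) by (simp add: subspace_scale[OF subP])
    qed
    then show ?thesis using r(1) by (intro exI[of _ "1 / r"]) auto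
  qed
  moreover have "convex ?V"
    unfolding convex_def using convexD[OF V(3)]
    by (simp add: subspace_add[OF subP] subspace_scale[OF subP])
  moreover have "- A \<in> ?V" if "A \<in> ?V" for A
    using that V(4) linear_on_scaleR[OF T, of A "- 1"] by (simp add: subspace_neg[OF subP])
  ultimately have "?V \<in> bornivores k U"
    using V(2) by (simp add: bornivores_def subspace_0[OF subP])
  from bornivore_nbhd[OF this] obtain G where "openin (bornological_topology k U) G" "0 \<in> G" "G \<subseteq> ?V" by blast
  then show "\<exists>G. openin (bornological_topology k U) G \<and> 0 \<in> G \<and> T ` G \<subseteq> W" using V(5) by blast
qed

lemma continuous_map_B_form:
  assumes \<omega>: "\<omega> \<in> B_forms k U"
  shows "continuous_map (bornological_topology k U) euclideanreal (\<lambda>A. chain_integral A \<omega>)"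
proof (rule continuous_map_bornological[OF locally_convex_space_euclideanreal linear_on_B_form[OF \<omega>]])
  fix S assume "weakly_bounded k U S"
  then obtain C where "\<forall>A\<in>S. \<bar>chain_integral A \<omega>\<bar> \<le> C" using \<omega> by (auto simp: weakly_bounded_def)
  then show "vn_bounded euclideanreal ((\<lambda>A. chain_integral A \<omega>) ` S)"
    by (intro vn_bounded_euclideanreal[of _ C]) auto
qed

text \<open>The weakly bounded sets are bounded by construction. Conversely the forms are
  continuous, so no further sets have become bounded; this is why boundedness of maps in condition
  (1) can be tested on weakly bounded sets.\<close>

lemma vn_bounded_bornological_iff:
  "vn_bounded (bornological_topology k U) S \<longleftrightarrow> weakly_bounded k U S"
proof
  assume S: "vn_bounded (bornological_topology k U) S"
  have "\<exists>C. \<forall>A\<in>S. \<bar>chain_integral A \<omega>\<bar> \<le> C" if "\<omega> \<in> B_forms k U" for \<omega>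
    using linear_on_B_form[OF that]
    by (intro vn_bounded_functional[OF locally_convex_space_bornological _ continuous_map_B_form[OF that] S])
      (simp add: topspace_bornological)
  then show "weakly_bounded k U S" using S by (simp add: weakly_bounded_def vn_bounded_def topspace_bornological)
qed (rule weakly_bounded_imp_vn_bounded_bornological)

lemma bounded_maps_continuous_bornological:
  "bounded_maps_continuous TYPE('f::real_vector) (bornological_topology k U)"
  unfolding bounded_maps_continuous_def bounded_map_def vn_bounded_bornological_iff
  by (auto simp: topspace_bornological intro: continuous_map_bornological)

lemma weakly_bounded_unit_elements: "weakly_bounded k U (unit_elements k U)"
  unfolding weakly_bounded_def
proof (intro conjI ballI)
  show "unit_elements k U \<subseteq> pointed_chains k U"
    by (auto simp: unit_elements_def element_in_pointed_chains)
  fix \<omega> assume \<omega>: "\<omega> \<in> B_forms k U"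
  obtain C where "\<forall>p\<in>U. \<forall>\<alpha>\<in>kvectors k. mass_norm k \<alpha> = 1 \<longrightarrow> \<bar>\<omega> p \<alpha>\<bar> \<le> C"
    using B_forms_bounded[OF \<omega>] by (auto simp: bounded_form_def)
  moreover have "chain_integral (element p \<alpha>) \<omega> = \<omega> p \<alpha>" if "p \<in> U" for p \<alpha>
    by (rule chain_integral_element[OF _ that]) (rule B_forms_linear[OF \<omega>])
  ultimately show "\<exists>C. \<forall>A\<in>unit_elements k U. \<bar>chain_integral A \<omega>\<bar> \<le> C"
    by (intro exI[of _ C]) (auto simp: unit_elements_def)
qed

text \<open>Differences of difference quotients of a fixed chain are \<open>O(\<bar>s\<bar> + \<bar>t\<bar>)\<close> against every form.\<close>

lemma diff_quot_Cauchy: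
  fixes U :: "(real^'n::finite) set"
  assumes U: "open U" and A: "A \<in> pointed_chains k U"
    and W: "openin (bornological_topology k U) W" "0 \<in> W"
  shows "\<exists>d>0. chain_room U v A d \<and> (\<forall>s t. s \<noteq> 0 \<longrightarrow> \<bar>s\<bar> < d \<longrightarrow> t \<noteq> 0 \<longrightarrow> \<bar>t\<bar> < d \<longrightarrow>
    diff_quot v s A - diff_quot v t A \<in> W)"
proof -
  let ?P = "pointed_chains k U"
  obtain V where V: "V \<in> bornivores k U" "V \<subseteq> W" using openin_bornological_absorbs[OF W] by blast
  obtain e where e: "e > 0" "chain_room U v A e" using chain_room_exists[OF U A] by blast
  \<comment> \<open>Dividing by \<bar>s\<bar> + \<bar>t\<bar> turns the error estimate into weak
    boundedness of S. A bornivore absorbs S, and multiplying back gives small differences: a weak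
    estimate with a rate yields the Cauchy property in the finer topology.\<close>
  define S where "S = {(1 / (\<bar>s\<bar> + \<bar>t\<bar>)) *\<^sub>R (diff_quot v s A - diff_quot v t A) | s t.
    s \<noteq> 0 \<and> \<bar>s\<bar> < e \<and> t \<noteq> 0 \<and> \<bar>t\<bar> < e}"
  have mem: "diff_quot v t A \<in> ?P" if "\<bar>t\<bar> < e" for t
    using chain_room_diff_quot_mem[OF A e(2) that] .
  have "weakly_bounded k U S"
    unfolding weakly_bounded_def
  proof (intro conjI ballI)
    show "S \<subseteq> ?P"
      by (auto simp: S_def intro!: mem subspace_scale[OF subspace_pointed_chains] subspace_diff[OF subspace_pointed_chains])
    fix \<omega> assume \<omega>: "\<omega> \<in> B_forms k U"
    obtain \<omega>' C where C: "C \<ge> 0" "\<And>t. t \<noteq> 0 \<Longrightarrow> \<bar>t\<bar> < e \<Longrightarrow>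
        \<bar>chain_integral (diff_quot v t A) \<omega> - chain_integral A \<omega>'\<bar> \<le> C * \<bar>t\<bar> * chain_mass k A"
      using chain_integral_diff_quot_taylor[OF U \<omega>, of v] A e(2) by meson
    have "\<bar>chain_integral ((1 / (\<bar>s\<bar> + \<bar>t\<bar>)) *\<^sub>R (diff_quot v s A - diff_quot v t A)) \<omega>\<bar> \<le> C * chain_mass k A"
      if st: "s \<noteq> 0" "\<bar>s\<bar> < e" "t \<noteq> 0" "\<bar>t\<bar> < e" for s t
    proof -
      have pos: "\<bar>s\<bar> + \<bar>t\<bar> > 0" using st by linarith
      have "\<bar>chain_integral (diff_quot v s A) \<omega> - chain_integral (diff_quot v t A) \<omega>\<bar>
          \<le> C * \<bar>s\<bar> * chain_mass k A + C * \<bar>t\<bar> * chain_mass k A"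
        using C(2)[OF st(1,2)] C(2)[OF st(3,4)] by linarith
      also have "\<dots> = (C * chain_mass k A) * (\<bar>s\<bar> + \<bar>t\<bar>)" by (simp add: algebra_simps)
      finally have "\<bar>chain_integral (diff_quot v s A) \<omega> - chain_integral (diff_quot v t A) \<omega>\<bar> / (\<bar>s\<bar> + \<bar>t\<bar>)
          \<le> C * chain_mass k A"
        using pos by (simp add: pos_divide_le_eq)
      moreover have "chain_integral ((1 / (\<bar>s\<bar> + \<bar>t\<bar>)) *\<^sub>R (diff_quot v s A - diff_quot v t A)) \<omega> =
          (chain_integral (diff_quot v s A) \<omega> - chain_integral (diff_quot v t A) \<omega>) / (\<bar>s\<bar> + \<bar>t\<bar>)"
        using linear_on_scaleR[OF linear_on_B_form[OF \<omega>] subspace_diff[OF subspace_pointed_chains mem[OF st(2)] mem[OF st(4)]]]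
          linear_on_diff[OF linear_on_B_form[OF \<omega>] subspace_pointed_chains mem[OF st(2)] mem[OF st(4)]]
        by simp
      ultimately show ?thesis using pos by (simp add: abs_divide)
    qed
    then show "\<exists>C. \<forall>A\<in>S. \<bar>chain_integral A \<omega>\<bar> \<le> C" unfolding S_def by blast
  qed
  then obtain r where r: "r > 0" "\<And>B. B \<in> S \<Longrightarrow> r *\<^sub>R B \<in> V"
    using V(1) unfolding bornivores_def by blast
  \<comment> \<open>With both steps below r / 2, the factor (\<bar>s\<bar> + \<bar>t\<bar>) / r is
    at most 1.\<close>
  define d where "d = min e (r / 2)"
  have "diff_quot v s A - diff_quot v t A \<in> W" if st: "s \<noteq> 0" "\<bar>s\<bar> < d" "t \<noteq> 0" "\<bar>t\<bar> < d" for s t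
  proof -
    have pos: "\<bar>s\<bar> + \<bar>t\<bar> > 0" using st by linarith
    have "(1 / (\<bar>s\<bar> + \<bar>t\<bar>)) *\<^sub>R (diff_quot v s A - diff_quot v t A) \<in> S"
      using st unfolding S_def d_def by auto
    from r(2)[OF this] have "((\<bar>s\<bar> + \<bar>t\<bar>) / r) *\<^sub>R r *\<^sub>R (1 / (\<bar>s\<bar> + \<bar>t\<bar>)) *\<^sub>R (diff_quot v s A - diff_quot v t A) \<in> V"
      by (rule bornivore_scale[OF V(1)]) (use st r(1) in \<open>auto simp: d_def\<close>)
    then show ?thesis using pos r(1) V(2) by auto
  qed
  moreover have "d > 0" using e r by (simp add: d_def)
  moreover have "chain_room U v A d" using e(2) by (simp add: chain_room_def d_def)
  ultimately show ?thesis by blast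
qed

text \<open>Each step is at most the inverse mass of its chain, so the Taylor error against \<omega>
  is at most C throughout S. What remains is the integral of A itself against \<omega>', which is
  bounded on S since \<omega>' is again in \<open>B_forms\<close>.\<close>

lemma weakly_bounded_diff_quot:
  fixes U :: "(real^'n::finite) set"
  assumes U: "open U" and S: "weakly_bounded k U S"
    and room: "\<And>A. A \<in> S \<Longrightarrow> chain_room U v A (e A)"
    and t: "\<And>A. A \<in> S \<Longrightarrow> \<tau> A \<noteq> 0 \<and> \<bar>\<tau> A\<bar> < e A \<and> \<bar>\<tau> A\<bar> * chain_mass k A \<le> 1"
  shows "weakly_bounded k U ((\<lambda>A. diff_quot v (\<tau> A) A) ` S)"
  unfolding weakly_bounded_def
proof (intro conjI ballI)
  have SP: "A \<in> pointed_chains k U" if "A \<in> S" for A using S that by (auto simp: weakly_bounded_def)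
  show "(\<lambda>A. diff_quot v (\<tau> A) A) ` S \<subseteq> pointed_chains k U"
    using chain_room_diff_quot_mem[OF SP room] t by blast
  fix \<omega> assume \<omega>: "\<omega> \<in> B_forms k U"
  obtain \<omega>' C where \<omega>': "\<omega>' \<in> B_forms k U" and C: "C \<ge> 0" "\<And>A t e. A \<in> pointed_chains k U \<Longrightarrow> chain_room U v A e \<Longrightarrow> t \<noteq> 0 \<Longrightarrow> \<bar>t\<bar> < e \<Longrightarrow>
      \<bar>chain_integral (diff_quot v t A) \<omega> - chain_integral A \<omega>'\<bar> \<le> C * \<bar>t\<bar> * chain_mass k A"
    using chain_integral_diff_quot_taylor[OF U \<omega>, of v] by blast
  obtain D where D: "\<And>A. A \<in> S \<Longrightarrow> \<bar>chain_integral A \<omega>'\<bar> \<le> D"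
    using S \<omega>' unfolding weakly_bounded_def by blast
  have "\<bar>chain_integral (diff_quot v (\<tau> A) A) \<omega>\<bar> \<le> C + D" if A: "A \<in> S" for A
  proof -
    have "\<bar>chain_integral (diff_quot v (\<tau> A) A) \<omega> - chain_integral A \<omega>'\<bar> \<le> C * (\<bar>\<tau> A\<bar> * chain_mass k A)"
      using C(2)[OF SP[OF A] room[OF A]] t[OF A] by (simp add: mult.assoc)
    also have "\<dots> \<le> C * 1" using t[OF A] C(1) by (intro mult_left_mono) auto
    finally show ?thesis using D[OF A] by linarith
  qed
  then show "\<exists>C. \<forall>A\<in>(\<lambda>A. diff_quot v (\<tau> A) A) ` S. \<bar>chain_integral A \<omega>\<bar> \<le> C" by blast
qed

section \<open>Prederivatives\<close>

lemma eventually_diff_quot_mem: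
  assumes "open U" "A \<in> pointed_chains k U"
  shows "\<forall>\<^sub>F t in at 0. diff_quot v t A \<in> pointed_chains k U"
proof -
  obtain e where "e > 0" "chain_room U v A e" using chain_room_exists[OF assms] by blast
  then show ?thesis
    using chain_room_diff_quot_mem[OF assms(2)] by (auto simp: eventually_at intro!: exI[of _ e])
qed

text \<open>The estimate in \<open>diff_quot_Cauchy\<close> concerns the carrier; pulling
  neighbourhoods of Y back along \<iota> makes it a Cauchy condition in the completion. Only steps
  within the room of A count, where the quotients are chains in U and \<iota> is linear.\<close>

lemma diff_quot_limit_exists:
  fixes U :: "(real^'n::finite) set"
  assumes U: "open U" and compl: "is_completion (bornological_topology k U) Y \<iota>"
    and A: "A \<in> pointed_chains k U"
  shows "\<exists>l. limitin Y (\<lambda>t. \<iota> (diff_quot v t A)) l (at 0)"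
proof -
  let ?P = "pointed_chains k U" and ?F = "filtermap (\<lambda>t. \<iota> (diff_quot v t A)) (at 0)"
  have Y: "complete_lcs Y" and \<iota>: "linear_on ?P \<iota>" "\<iota> ` ?P \<subseteq> topspace Y"
    and pb: "bornological_topology k U = pullback_topology ?P \<iota> Y"
    using compl by (simp_all add: is_completion_def topspace_bornological)
  have "cauchy_filter_in Y ?F"
    unfolding cauchy_filter_in_def
  proof (intro conjI allI impI)
    show "?F \<noteq> bot" by (simp add: filtermap_bot_iff)
    show "\<forall>\<^sub>F x in ?F. x \<in> topspace Y"
      unfolding eventually_filtermap using eventually_diff_quot_mem[OF U A]
      by (rule eventually_mono) (use \<iota>(2) in blast)
    fix W assume W: "openin Y W \<and> 0 \<in> W"
    have "openin (bornological_topology k U) (\<iota> -` W \<inter> ?P)"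
      unfolding pb openin_pullback_topology using W by blast
    moreover have "0 \<in> \<iota> -` W \<inter> ?P"
      using W linear_on_zero[OF \<iota>(1) subspace_pointed_chains] subspace_0[OF subspace_pointed_chains, of k U] by simp
    ultimately obtain d where d: "d > 0" "chain_room U v A d"
      "\<And>s t. s \<noteq> 0 \<Longrightarrow> \<bar>s\<bar> < d \<Longrightarrow> t \<noteq> 0 \<Longrightarrow> \<bar>t\<bar> < d \<Longrightarrow> diff_quot v s A - diff_quot v t A \<in> \<iota> -` W \<inter> ?P"
      using diff_quot_Cauchy[OF U A] by metis
    let ?S = "(\<lambda>t. \<iota> (diff_quot v t A)) ` {t. t \<noteq> 0 \<and> \<bar>t\<bar> < d}"
    have "\<forall>\<^sub>F x in ?F. x \<in> ?S"
      unfolding eventually_filtermap eventually_at using d(1) by (intro exI[of _ d]) auto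
    moreover have "\<forall>x\<in>?S. \<forall>y\<in>?S. x - y \<in> W"
    proof (intro ballI)
      fix x y assume "x \<in> ?S" "y \<in> ?S"
      then obtain s t where st: "s \<noteq> 0" "\<bar>s\<bar> < d" "x = \<iota> (diff_quot v s A)"
        "t \<noteq> 0" "\<bar>t\<bar> < d" "y = \<iota> (diff_quot v t A)" by blast
      have "x - y = \<iota> (diff_quot v s A - diff_quot v t A)"
        unfolding st(3,6)
        by (rule linear_on_diff[OF \<iota>(1) subspace_pointed_chains, symmetric])
          (use chain_room_diff_quot_mem[OF A d(2)] st in auto)
      then show "x - y \<in> W" using d(3)[OF st(1,2,4,5)] by simp
    qed
    ultimately show "\<exists>S. (\<forall>\<^sub>F x in ?F. x \<in> S) \<and> (\<forall>x\<in>S. \<forall>y\<in>S. x - y \<in> W)" by blast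
  qed
  then obtain l where "limitin Y (\<lambda>x. x) l ?F" using Y by (auto simp: complete_lcs_def)
  then show ?thesis by (auto simp: limitin_def eventually_filtermap)
qed

lemma prederivatives_bounded_bornological:
  fixes U :: "(real^'n::finite) set"
  assumes U: "open U"
  shows "prederivatives_bounded k U (bornological_topology k U)"
proof -
  let ?P = "pointed_chains k U"
  obtain Y :: "('n chain set \<Rightarrow> 'n chain) topology" and \<iota> where compl: "is_completion (bornological_topology k U) Y \<iota>"
    using completion_exists[OF locally_convex_space_bornological] by blast
  have Y: "locally_convex_space Y" "Hausdorff_space Y" and \<iota>: "linear_on ?P \<iota>" "\<iota> ` ?P \<subseteq> topspace Y"
    and pb: "bornological_topology k U = pullback_topology ?P \<iota> Y"
    using compl by (simp_all add: is_completion_def complete_lcs_def topspace_bornological)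
  have "\<exists>P. is_prederivative k U Y \<iota> v P \<and> bounded_map (bornological_topology k U) Y P" for v
  proof -
    \<comment> \<open>P is chosen on all chains at once; uniqueness of limits, from the Hausdorff
      property of Y, then makes it linear.\<close>
    obtain P where P: "\<And>A. A \<in> ?P \<Longrightarrow> limitin Y (\<lambda>t. \<iota> (diff_quot v t A)) (P A) (at 0)"
      using bchoice[of ?P "\<lambda>A l. limitin Y (\<lambda>t. \<iota> (diff_quot v t A)) l (at 0)"]
        diff_quot_limit_exists[OF U compl] by blast
    have uniq: "P A = l" if "A \<in> ?P" "limitin Y (\<lambda>t. \<iota> (diff_quot v t A)) l (at 0)" for A l
      using limitin_Hausdorff_unique[OF P[OF that(1)] that(2) _ Y(2)] by simp
    have "linear_on ?P P"
      unfolding linear_on_def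
    proof (intro conjI ballI allI)
      fix A B c assume A: "A \<in> ?P"
      show "P (A + B) = P A + P B" if B: "B \<in> ?P"
      proof (rule uniq)
        show "A + B \<in> ?P" using A B by (rule subspace_add[OF subspace_pointed_chains])
        have "\<forall>\<^sub>F t in at 0. \<iota> (diff_quot v t A) + \<iota> (diff_quot v t B) = \<iota> (diff_quot v t (A + B))"
          using eventually_diff_quot_mem[OF U A, of v] eventually_diff_quot_mem[OF U B, of v]
          by eventually_elim (simp add: linear_add[OF linear_diff_quot] linear_on_add[OF \<iota>(1)])
        then show "limitin Y (\<lambda>t. \<iota> (diff_quot v t (A + B))) (P A + P B) (at 0)"
          by (rule limitin_transform_eventually) (intro limitin_linear_add Y P A B)
      qed
      show "P (c *\<^sub>R A) = c *\<^sub>R P A"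
      proof (rule uniq)
        show "c *\<^sub>R A \<in> ?P" using A by (rule subspace_scale[OF subspace_pointed_chains])
        have "\<forall>\<^sub>F t in at 0. c *\<^sub>R \<iota> (diff_quot v t A) = \<iota> (diff_quot v t (c *\<^sub>R A))"
          using eventually_diff_quot_mem[OF U A, of v]
          by eventually_elim (simp add: linear_scale[OF linear_diff_quot] linear_on_scaleR[OF \<iota>(1)])
        then show "limitin Y (\<lambda>t. \<iota> (diff_quot v t (c *\<^sub>R A))) (c *\<^sub>R P A) (at 0)"
          by (rule limitin_transform_eventually) (intro limitin_linear_scale Y P A)
      qed
    qed
    then have "is_prederivative k U Y \<iota> v P"
      using P[OF element_in_pointed_chains] by (simp add: is_prederivative_def diff_quot_element)
    moreover have "vn_bounded Y (P ` S)" if S: "weakly_bounded k U S" for S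
      unfolding vn_bounded_def
    proof (intro conjI allI impI)
      have SP: "A \<in> ?P" if "A \<in> S" for A using S that by (auto simp: weakly_bounded_def)
      show "P ` S \<subseteq> topspace Y" using limitin_topspace[OF P[OF SP]] by blast
      fix W assume "openin Y W \<and> 0 \<in> W"
      then obtain V where V: "openin Y V" "0 \<in> V" "convex V" "\<forall>x\<in>V. - x \<in> V"
        "\<And>x y. x \<in> V \<Longrightarrow> y \<in> V \<Longrightarrow> x + y \<in> W"
        using locally_convex_space_absconvex_nbhd[OF Y(1)] by metis
      \<comment> \<open>The neighbourhood V is fixed before t, so t may be chosen for each A: close
        enough to the limit for V, within the room of A, and small against its mass.\<close>
      have "\<forall>A\<in>S. \<exists>e t. chain_room U v A e \<and> t \<noteq> 0 \<and> \<bar>t\<bar> < e \<and> \<bar>t\<bar> * chain_mass k A \<le> 1 \<and>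
          \<iota> (diff_quot v t A) - P A \<in> V"
      proof
        fix A assume A: "A \<in> S"
        obtain e where e: "e > 0" "chain_room U v A e" using chain_room_exists[OF U SP[OF A]] by blast
        have "\<forall>\<^sub>F t in at 0. \<iota> (diff_quot v t A) - P A \<in> V"
          using limitin_linear_nbhd[OF Y(1) P[OF SP[OF A]] V(1,2)] by (rule eventually_mono) blast
        moreover have "\<forall>\<^sub>F t in at 0. \<bar>t\<bar> * chain_mass k A < 1"
        proof (rule order_tendstoD(2))
          show "((\<lambda>t. \<bar>t\<bar> * chain_mass k A) \<longlongrightarrow> \<bar>0\<bar> * chain_mass k A) (at 0)" by (intro tendsto_intros)
        qed simp
        moreover have "\<forall>\<^sub>F t in at 0. \<bar>t\<bar> < e"
          using e(1) by (auto simp: eventually_at intro!: exI[of _ e])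
        moreover have "\<forall>\<^sub>F t::real in at 0. t \<noteq> 0" by (simp add: eventually_at_filter)
        ultimately have "\<forall>\<^sub>F t in at 0. t \<noteq> 0 \<and> \<bar>t\<bar> < e \<and> \<bar>t\<bar> * chain_mass k A \<le> 1 \<and> \<iota> (diff_quot v t A) - P A \<in> V"
          by eventually_elim auto
        from eventually_happens'[OF _ this] e(2)
        show "\<exists>e t. chain_room U v A e \<and> t \<noteq> 0 \<and> \<bar>t\<bar> < e \<and> \<bar>t\<bar> * chain_mass k A \<le> 1 \<and>
            \<iota> (diff_quot v t A) - P A \<in> V"
          by auto
      qed
      from this[THEN bchoice] obtain e where "\<forall>A\<in>S. \<exists>t. chain_room U v A (e A) \<and> t \<noteq> 0 \<and> \<bar>t\<bar> < e A \<and>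
          \<bar>t\<bar> * chain_mass k A \<le> 1 \<and> \<iota> (diff_quot v t A) - P A \<in> V" by blast
      from this[THEN bchoice] obtain \<tau> where \<tau>: "\<And>A. A \<in> S \<Longrightarrow> chain_room U v A (e A)"
        "\<And>A. A \<in> S \<Longrightarrow> \<tau> A \<noteq> 0 \<and> \<bar>\<tau> A\<bar> < e A \<and> \<bar>\<tau> A\<bar> * chain_mass k A \<le> 1"
        "\<And>A. A \<in> S \<Longrightarrow> \<iota> (diff_quot v (\<tau> A) A) - P A \<in> V"
        by blast
      have "vn_bounded (bornological_topology k U) ((\<lambda>A. diff_quot v (\<tau> A) A) ` S)"
        by (rule weakly_bounded_imp_vn_bounded_bornological[OF weakly_bounded_diff_quot[OF U S \<tau>(1,2)]])
      moreover have "openin (bornological_topology k U) (\<iota> -` V \<inter> ?P)"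
        unfolding pb openin_pullback_topology using V(1) by blast
      moreover have "0 \<in> \<iota> -` V \<inter> ?P"
        using V(2) linear_on_zero[OF \<iota>(1) subspace_pointed_chains] subspace_0[OF subspace_pointed_chains, of k U] by simp
      ultimately obtain r where r: "r > 0"
        "\<And>c. \<bar>c\<bar> \<ge> r \<Longrightarrow> (\<lambda>A. diff_quot v (\<tau> A) A) ` S \<subseteq> (\<lambda>w. c *\<^sub>R w) ` (\<iota> -` V \<inter> ?P)"
        unfolding vn_bounded_def by blast
      \<comment> \<open>\<open>r\<close> absorbs the difference quotients; the 1 ensures that the
        error divided by c stays in V. Then P A is c times a sum of two elements of V, and such sums
        lie in W.\<close>
      have "P A \<in> (\<lambda>w. c *\<^sub>R w) ` W" if c: "max r 1 \<le> \<bar>c\<bar>" and A: "A \<in> S" for c A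
      proof -
        obtain w where w: "\<iota> w \<in> V" "w \<in> ?P" "diff_quot v (\<tau> A) A = c *\<^sub>R w" using r(2)[of c] c A by fastforce
        define x where "x = \<iota> (diff_quot v (\<tau> A) A) - P A"
        have c0: "c \<noteq> 0" using c by auto
        have "(- 1 / c) *\<^sub>R x \<in> V"
          by (rule convex_symmetric_scale[OF V(3,4)]) (use \<tau>(3)[OF A] c in \<open>auto simp: x_def\<close>)
        then have "\<iota> w + (- 1 / c) *\<^sub>R x \<in> W" using V(5) w(1) by blast
        moreover have "P A = c *\<^sub>R (\<iota> w + (- 1 / c) *\<^sub>R x)"
          using c0 linear_on_scaleR[OF \<iota>(1) w(2), of c] by (simp add: x_def w(3) scaleR_diff_right)
        ultimately show ?thesis by blast
      qed
      then show "\<exists>r>0. \<forall>c. r \<le> \<bar>c\<bar> \<longrightarrow> P ` S \<subseteq> (\<lambda>w. c *\<^sub>R w) ` W"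
        by (intro exI[of _ "max r 1"]) auto
    qed
    ultimately show ?thesis by (auto simp: bounded_map_def vn_bounded_bornological_iff)
  qed
  then show ?thesis using compl unfolding prederivatives_bounded_def by blast
qed

theorem chain_topology_conditions_bornological:
  assumes "open U"
  shows "chain_topology_conditions TYPE('f::real_vector) k U (bornological_topology k U)"
  unfolding chain_topology_conditions_def
  by (intro conjI locally_convex_space_bornological topspace_bornological bounded_maps_continuous_bornological
      weakly_bounded_imp_vn_bounded_bornological weakly_bounded_unit_elements
      prederivatives_bounded_bornological assms)

section \<open>The dual of a topology with the characterising properties\<close>

text \<open>The derivative \<open>g\<close> is the composition of the prederivative with the extension of \<open>f\<close> to the
  completion; it is a bounded functional, hence continuous.\<close>

lemma functional_derivative:
  fixes U :: "(real^'n::finite) set"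
  assumes U: "open U" and \<mu>: "chain_topology_conditions TYPE('n chain) k U \<mu>"
    and f: "linear_on (pointed_chains k U) f" "continuous_map \<mu> euclideanreal f"
  shows "\<exists>g. linear_on (pointed_chains k U) g \<and> continuous_map \<mu> euclideanreal g \<and>
    (\<forall>A\<in>pointed_chains k U. ((\<lambda>t. f (diff_quot v t A)) \<longlongrightarrow> g A) (at 0))"
proof -
  let ?P = "pointed_chains k U"
  have lcs: "locally_convex_space \<mu>" and top: "topspace \<mu> = ?P"
    and bmc: "bounded_maps_continuous TYPE('n chain) \<mu>" and pre: "prederivatives_bounded k U \<mu>"
    using \<mu> by (simp_all add: chain_topology_conditions_def)
  obtain Y :: "('n chain set \<Rightarrow> 'n chain) topology" and \<iota> P
    where compl: "is_completion \<mu> Y \<iota>" and P: "is_prederivative k U Y \<iota> v P" "bounded_map \<mu> Y P"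
    using pre unfolding prederivatives_bounded_def by metis
  have Y: "locally_convex_space Y" and \<iota>: "linear_on ?P \<iota>" and pb: "\<mu> = pullback_topology ?P \<iota> Y"
    using compl by (simp_all add: is_completion_def complete_lcs_def top)
  note linP = P(1)[unfolded is_prederivative_def, THEN conjunct1]
  \<comment> \<open>Condition (3) gives the limit only at single elements; linearity carries it to
    chains, which are finite sums of these.\<close>
  have lim: "limitin Y (\<lambda>t. \<iota> (diff_quot v t A)) (P A) (at 0)" if A: "A \<in> ?P" for A
  proof -
    let ?T = "{p. A p \<noteq> 0}"
    note A' = pointed_chainsD[OF A]
    have el: "element p (A p) \<in> ?P" if "p \<in> ?T" for p using A' that by (auto intro: element_in_pointed_chains)
    have "limitin Y (\<lambda>t. \<Sum>p\<in>?T. \<iota> (diff_quot v t (element p (A p)))) (\<Sum>p\<in>?T. P (element p (A p))) (at 0)"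
      using P(1) A' by (intro limitin_linear_sum[OF Y]) (auto simp: is_prederivative_def diff_quot_element)
    then have "limitin Y (\<lambda>t. \<Sum>p\<in>?T. \<iota> (diff_quot v t (element p (A p)))) (P A) (at 0)"
      using linear_on_sum[OF linP subspace_pointed_chains A'(1), of "\<lambda>p. element p (A p)"] el
      by (simp add: chain_eq_sum_element[OF A])
    moreover have "\<forall>\<^sub>F t in at 0. (\<Sum>p\<in>?T. \<iota> (diff_quot v t (element p (A p)))) = \<iota> (diff_quot v t A)"
    proof -
      have "\<forall>\<^sub>F t in at 0. \<forall>p\<in>?T. diff_quot v t (element p (A p)) \<in> ?P"
        using A'(1) eventually_diff_quot_mem[OF U el] by (intro eventually_ball_finite) auto
      then show ?thesis
      proof eventually_elim
        case (elim t)
        then show ?case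
          using linear_on_sum[OF \<iota> subspace_pointed_chains A'(1), of "\<lambda>p. diff_quot v t (element p (A p))"]
          by (simp add: diff_quot_eq_sum[OF A, of v t])
      qed
    qed
    ultimately show ?thesis by (rule limitin_transform_eventually[rotated])
  qed
  \<comment> \<open>Since \<mu> is the pullback along \<iota>, continuity of f becomes a condition
    on \<iota> x. This stands in for the extension of f to the completion.\<close>
  have nbhd: "\<exists>W. openin Y W \<and> 0 \<in> W \<and> (\<forall>x\<in>?P. \<iota> x \<in> W \<longrightarrow> \<bar>f x\<bar> < e)" if "e > 0" for e
  proof -
    have "openin \<mu> {x \<in> ?P. \<bar>f x\<bar> < e}" "0 \<in> {x \<in> ?P. \<bar>f x\<bar> < e}"
      using continuous_functional_nbhd[OF lcs _ f(2) that] f(1) by (simp_all add: top)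
    then obtain W where "openin Y W" "{x \<in> ?P. \<bar>f x\<bar> < e} = \<iota> -` W \<inter> ?P"
      unfolding pb openin_pullback_topology by blast
    moreover then have "0 \<in> W"
      using linear_on_zero[OF \<iota> subspace_pointed_chains] \<open>0 \<in> {x \<in> ?P. \<bar>f x\<bar> < e}\<close> by auto
    ultimately show ?thesis by blast
  qed
  have "\<exists>L. ((\<lambda>t. f (diff_quot v t A)) \<longlongrightarrow> L) (at 0)" if A: "A \<in> ?P" for A
  proof (rule limit_at_0_real_Cauchy)
    fix e :: real assume e: "e > 0"
    obtain W where W: "openin Y W" "0 \<in> W" "\<And>x. x \<in> ?P \<Longrightarrow> \<iota> x \<in> W \<Longrightarrow> \<bar>f x\<bar> < e"
      using nbhd[OF e] by blast
    obtain V where V: "openin Y V" "0 \<in> V" "\<forall>x\<in>V. - x \<in> V" "\<And>x y. x \<in> V \<Longrightarrow> y \<in> V \<Longrightarrow> x + y \<in> W"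
      using locally_convex_space_absconvex_nbhd[OF Y W(1,2)] by metis
    have ev: "\<forall>\<^sub>F t in at 0. diff_quot v t A \<in> ?P \<and> \<iota> (diff_quot v t A) - P A \<in> V"
      using limitin_linear_nbhd[OF Y lim[OF A] V(1,2)] eventually_diff_quot_mem[OF U A, of v]
      by eventually_elim auto
    then obtain s where s: "diff_quot v s A \<in> ?P" "\<iota> (diff_quot v s A) - P A \<in> V"
      using eventually_happens'[OF _ ev] by auto
    from ev have "\<forall>\<^sub>F t in at 0. \<bar>f (diff_quot v t A) - f (diff_quot v s A)\<bar> < e"
    proof eventually_elim
      case (elim t)
      have "(\<iota> (diff_quot v t A) - P A) + - (\<iota> (diff_quot v s A) - P A) \<in> W"
        using elim s V(3,4) by blast
      then have "\<iota> (diff_quot v t A - diff_quot v s A) \<in> W"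
        using elim s by (simp add: linear_on_diff[OF \<iota> subspace_pointed_chains])
      then have "\<bar>f (diff_quot v t A - diff_quot v s A)\<bar> < e"
        using elim s by (intro W(3) subspace_diff[OF subspace_pointed_chains]) auto
      then show ?case using elim s by (simp add: linear_on_diff[OF f(1) subspace_pointed_chains])
    qed
    then show "\<exists>l. \<forall>\<^sub>F t in at 0. \<bar>f (diff_quot v t A) - l\<bar> < e" by blast
  qed
  then obtain g where g: "\<And>A. A \<in> ?P \<Longrightarrow> ((\<lambda>t. f (diff_quot v t A)) \<longlongrightarrow> g A) (at 0)"
    using bchoice[of ?P "\<lambda>A l. ((\<lambda>t. f (diff_quot v t A)) \<longlongrightarrow> l) (at 0)"] by blast
  have uniq: "g A = l" if "A \<in> ?P" "((\<lambda>t. f (diff_quot v t A)) \<longlongrightarrow> l) (at 0)" for A l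
    using tendsto_unique[OF _ g[OF that(1)] that(2)] by simp
  have ling: "linear_on ?P g"
    unfolding linear_on_def
  proof (intro conjI ballI allI)
    fix A B c assume A: "A \<in> ?P"
    show "g (A + B) = g A + g B" if B: "B \<in> ?P"
    proof (rule uniq)
      show "A + B \<in> ?P" using A B by (rule subspace_add[OF subspace_pointed_chains])
      have "\<forall>\<^sub>F t in at 0. f (diff_quot v t A) + f (diff_quot v t B) = f (diff_quot v t (A + B))"
        using eventually_diff_quot_mem[OF U A, of v] eventually_diff_quot_mem[OF U B, of v]
        by eventually_elim (simp add: linear_add[OF linear_diff_quot] linear_on_add[OF f(1)])
      then show "((\<lambda>t. f (diff_quot v t (A + B))) \<longlongrightarrow> g A + g B) (at 0)"
        by (rule Lim_transform_eventually[rotated]) (intro tendsto_add g A B)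
    qed
    show "g (c *\<^sub>R A) = c *\<^sub>R g A"
    proof (rule uniq)
      show "c *\<^sub>R A \<in> ?P" using A by (rule subspace_scale[OF subspace_pointed_chains])
      have "\<forall>\<^sub>F t in at 0. c *\<^sub>R f (diff_quot v t A) = f (diff_quot v t (c *\<^sub>R A))"
        using eventually_diff_quot_mem[OF U A, of v]
        by eventually_elim (simp add: linear_scale[OF linear_diff_quot] linear_on_scaleR[OF f(1)])
      then show "((\<lambda>t. f (diff_quot v t (c *\<^sub>R A))) \<longlongrightarrow> c *\<^sub>R g A) (at 0)"
        by (rule Lim_transform_eventually[rotated]) (intro tendsto_scaleR tendsto_const g A)
    qed
  qed
  have "bounded_map \<mu> euclideanreal g"
    unfolding bounded_map_def
  proof (intro allI impI)
    fix S assume S: "vn_bounded \<mu> S"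
    obtain W where W: "openin Y W" "0 \<in> W" "\<And>x. x \<in> ?P \<Longrightarrow> \<iota> x \<in> W \<Longrightarrow> \<bar>f x\<bar> < 1"
      using nbhd[of 1] by auto
    obtain V where V: "openin Y V" "0 \<in> V" "convex V" "\<forall>x\<in>V. - x \<in> V" "\<And>x y. x \<in> V \<Longrightarrow> y \<in> V \<Longrightarrow> x + y \<in> W"
      using locally_convex_space_absconvex_nbhd[OF Y W(1,2)] by metis
    have "vn_bounded Y (P ` S)" using P(2) S by (simp add: bounded_map_def)
    then obtain r where r: "\<And>c. \<bar>c\<bar> \<ge> r \<Longrightarrow> P ` S \<subseteq> (\<lambda>w. c *\<^sub>R w) ` V"
      unfolding vn_bounded_def using V(1,2) by blast
    \<comment> \<open>Being at least r, c absorbs the image of S; being at least 1, it keeps the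
      error divided by c in V. The bound is independent of A and t and so passes to the
      limit.\<close>
    define c where "c = max r 1"
    have c: "c \<ge> 1" "c \<ge> r" by (auto simp: c_def)
    have "\<bar>g A\<bar> \<le> c" if A: "A \<in> S" for A
    proof -
      have AP: "A \<in> ?P" using S A top by (auto simp: vn_bounded_def)
      obtain w where w: "w \<in> V" "P A = c *\<^sub>R w" using r[of c] c A by fastforce
      have "\<forall>\<^sub>F t in at 0. \<bar>f (diff_quot v t A)\<bar> \<le> c"
        using limitin_linear_nbhd[OF Y lim[OF AP] V(1,2)] eventually_diff_quot_mem[OF U AP, of v]
      proof eventually_elim
        case (elim t)
        define x where "x = \<iota> (diff_quot v t A) - P A"
        have "(1 / c) *\<^sub>R x \<in> V"
          by (rule convex_symmetric_scale[OF V(3,4)]) (use elim c in \<open>auto simp: x_def\<close>)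
        then have "w + (1 / c) *\<^sub>R x \<in> W" using V(5) w(1) by blast
        also have "w + (1 / c) *\<^sub>R x = (1 / c) *\<^sub>R \<iota> (diff_quot v t A)"
          using c by (simp add: x_def w(2) scaleR_diff_right)
        also have "\<dots> = \<iota> ((1 / c) *\<^sub>R diff_quot v t A)"
          using linear_on_scaleR[OF \<iota>] elim by simp
        finally have "\<bar>f ((1 / c) *\<^sub>R diff_quot v t A)\<bar> < 1"
          using elim by (intro W(3) subspace_scale[OF subspace_pointed_chains]) auto
        then have "\<bar>f (diff_quot v t A)\<bar> / c < 1"
          using linear_on_scaleR[OF f(1), of "diff_quot v t A" "1 / c"] elim c by (simp add: abs_mult)
        then show ?case using c by simp
      qed
      then show ?thesis
        by (intro tendsto_upperbound[OF tendsto_rabs[OF g[OF AP]]]) auto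
    qed
    then show "vn_bounded euclideanreal (g ` S)" by (intro vn_bounded_euclideanreal[of _ c]) auto
  qed
  \<comment> \<open>Condition (1) is assumed for targets inside the type of chains; the transfer to
    the target \<open>real\<close> goes through a pullback topology on the chains.\<close>
  then have "continuous_map \<mu> euclideanreal g"
    using bounded_maps_continuous_any_type[OF lcs bmc, where 'f = real] locally_convex_space_euclideanreal ling
    by (simp add: bounded_maps_continuous_def top)
  then show ?thesis using ling g by blast
qed

theorem continuous_functional_is_form:
  fixes U :: "(real^'n::finite) set"
  assumes U: "open U" and \<mu>: "chain_topology_conditions TYPE('n chain) k U \<mu>"
    and f: "linear_on (pointed_chains k U) f" "continuous_map \<mu> euclideanreal f"
  shows "\<exists>\<omega>\<in>B_forms k U. \<forall>A\<in>pointed_chains k U. f A = chain_integral A \<omega>"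
proof -
  let ?P = "pointed_chains k U"
  have lcs: "locally_convex_space \<mu>" and top: "topspace \<mu> = ?P" and unit: "vn_bounded \<mu> (unit_elements k U)"
    using \<mu> by (simp_all add: chain_topology_conditions_def)
  \<comment> \<open>All continuous functionals are taken at once instead of the derivatives of a
    single one: the derivative g is merely known to be another continuous functional, and this alone
    closes the family.\<close>
  define \<Phi> where "\<Phi> = {(\<lambda>p \<alpha>. f (element p \<alpha>)) | f. linear_on ?P f \<and> continuous_map \<mu> euclideanreal f}"
  have "\<Phi> \<subseteq> B_forms k U"
  proof (rule derivative_closed_family_B_forms[OF U])
    fix \<phi> assume "\<phi> \<in> \<Phi>"
    then obtain f where f: "\<phi> = (\<lambda>p \<alpha>. f (element p \<alpha>))" "linear_on ?P f" "continuous_map \<mu> euclideanreal f"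
      by (auto simp: \<Phi>_def)
    show "linear_on (kvectors k) (\<phi> p)" if "p \<in> U" for p
      using that f(2) element_in_pointed_chains[OF that]
      by (auto simp: linear_on_def f(1) element_add element_scale)
    obtain C where "\<forall>A\<in>unit_elements k U. \<bar>f A\<bar> \<le> C"
      using vn_bounded_functional[OF lcs _ f(3) unit] f(2) top by auto
    then show "bounded_form k U \<phi>" unfolding bounded_form_def f(1) unit_elements_def by blast
    fix v
    obtain g where g: "linear_on ?P g" "continuous_map \<mu> euclideanreal g"
      "\<And>A. A \<in> ?P \<Longrightarrow> ((\<lambda>t. f (diff_quot v t A)) \<longlongrightarrow> g A) (at 0)"
      using functional_derivative[OF U \<mu> f(2,3)] by blast
    have "has_dir_deriv (\<lambda>p. \<phi> p \<alpha>) v p (g (element p \<alpha>))" if p: "p \<in> U" and \<alpha>: "\<alpha> \<in> kvectors k" for p \<alpha>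
    proof -
      have el: "element p \<alpha> \<in> ?P" using p \<alpha> by (rule element_in_pointed_chains)
      obtain e where e: "e > 0" "\<And>t. \<bar>t\<bar> < e \<Longrightarrow> p + t *\<^sub>R v \<in> U"
      proof -
        have "open ((\<lambda>t. p + t *\<^sub>R v) -` U)" by (intro continuous_open_vimage U continuous_intros)
        moreover have "0 \<in> (\<lambda>t. p + t *\<^sub>R v) -` U" using p by simp
        ultimately obtain e where "e > 0" "ball 0 e \<subseteq> (\<lambda>t. p + t *\<^sub>R v) -` U" by (rule openE)
        then show thesis using that[of e] by (simp add: subset_iff dist_real_def)
      qed
      have "\<forall>\<^sub>F t in at 0. \<bar>t\<bar> < e" using e(1) by (auto simp: eventually_at intro!: exI[of _ e])
      then have "\<forall>\<^sub>F t in at 0. f (diff_quot v t (element p \<alpha>)) = (\<phi> (p + t *\<^sub>R v) \<alpha> - \<phi> p \<alpha>) / t"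
      proof eventually_elim
        case (elim t)
        have *: "element (p + t *\<^sub>R v) \<alpha> \<in> ?P" using e(2)[OF elim] \<alpha> by (rule element_in_pointed_chains)
        have "diff_quot v t (element p \<alpha>) = (1 / t) *\<^sub>R (element (p + t *\<^sub>R v) \<alpha> - element p \<alpha>)"
          by (simp add: diff_quot_element element_scale scaleR_diff_right divide_inverse)
        then show ?case
          using linear_on_scaleR[OF f(2) subspace_diff[OF subspace_pointed_chains * el], of "1 / t"]
            linear_on_diff[OF f(2) subspace_pointed_chains * el] by (simp add: f(1))
      qed
      from Lim_transform_eventually[OF g(3)[OF el] this]
      show ?thesis by (simp add: has_dir_deriv_def DERIV_def)
    qed
    moreover have "(\<lambda>p \<alpha>. g (element p \<alpha>)) \<in> \<Phi>" using g(1,2) unfolding \<Phi>_def by blast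
    ultimately show "\<exists>\<phi>'\<in>\<Phi>. \<forall>p\<in>U. \<forall>\<alpha>\<in>kvectors k. has_dir_deriv (\<lambda>p. \<phi> p \<alpha>) v p (\<phi>' p \<alpha>)"
      by (intro bexI[of _ "\<lambda>p \<alpha>. g (element p \<alpha>)"]) auto
  qed
  moreover have "(\<lambda>p \<alpha>. f (element p \<alpha>)) \<in> \<Phi>" using f unfolding \<Phi>_def by blast
  ultimately show ?thesis
    using chain_integral_functional[OF f(1)] by (intro bexI[of _ "\<lambda>p \<alpha>. f (element p \<alpha>)"]) auto
qed

text \<open>Weakly bounded sets are bounded for \<mu> by Mackey's theorem, so the identity map from
  \<open>bornological_topology\<close> is continuous. The dual of \<mu> is only required to consist
  of forms, which covers both the compatible topologies and those with (1), (2), (3).\<close>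

theorem coarser_bornological:
  fixes U :: "(real^'n::finite) set"
  assumes lcs: "locally_convex_space \<mu>" and top: "topspace \<mu> = pointed_chains k U"
    and dual: "\<And>f. linear_on (pointed_chains k U) f \<Longrightarrow> continuous_map \<mu> euclideanreal f \<Longrightarrow>
      \<exists>\<omega>\<in>B_forms k U. \<forall>A\<in>pointed_chains k U. f A = chain_integral A \<omega>"
  shows "coarser \<mu> (bornological_topology k U)"
  unfolding coarser_def
proof (intro allI impI)
  let ?P = "pointed_chains k U"
  have "continuous_map (bornological_topology k U) \<mu> (\<lambda>A. A)"
  proof (rule continuous_map_bornological[OF lcs])
    show "linear_on ?P (\<lambda>A. A)" by (simp add: linear_on_def)
    fix S assume S: "weakly_bounded k U S"
    have "vn_bounded \<mu> S"
    proof (rule weakly_bounded_imp_vn_bounded[OF lcs])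
      show "S \<subseteq> topspace \<mu>" using S top by (simp add: weakly_bounded_def)
      fix f assume f: "linear_on (topspace \<mu>) f" "continuous_map \<mu> euclideanreal f"
      obtain \<omega> where "\<omega> \<in> B_forms k U" "\<forall>A\<in>?P. f A = chain_integral A \<omega>"
        using dual[OF f(1)[unfolded top] f(2)] by blast
      then show "\<exists>C. \<forall>A\<in>S. \<bar>f A\<bar> \<le> C" using S unfolding weakly_bounded_def by (metis subsetD)
    qed
    then show "vn_bounded \<mu> ((\<lambda>A. A) ` S)" by simp
  qed
  moreover fix G assume G: "openin \<mu> G"
  ultimately have "openin (bornological_topology k U) {A \<in> topspace (bornological_topology k U). A \<in> G}"
    by (rule openin_continuous_map_preimage)
  moreover have "{A \<in> topspace (bornological_topology k U). A \<in> G} = G"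
    using openin_subset[OF G] top by (auto simp: topspace_bornological)
  ultimately show "openin (bornological_topology k U) G" by simp
qed

lemma coarser_antisym: "coarser X Y \<Longrightarrow> coarser Y X \<Longrightarrow> X = Y"
  by (auto simp: coarser_def topology_eq)

theorem mackey_chain_topology_eq:
  fixes U :: "(real^'n::finite) set"
  assumes U: "open U"
  shows "mackey_chain_topology k U = bornological_topology k U"
proof -
  let ?P = "pointed_chains k U" and ?\<tau> = "bornological_topology k U"
  define D where "D = (\<lambda>\<omega>. restrict (\<lambda>A. chain_integral A \<omega>) ?P) ` B_forms k U"
  have "continuous_dual ?\<tau> = D"
  proof (intro set_eqI iffI)
    fix f assume "f \<in> continuous_dual ?\<tau>"
    then have f: "f \<in> extensional ?P" "linear_on ?P f" "continuous_map ?\<tau> euclideanreal f"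
      by (simp_all add: continuous_dual_def topspace_bornological)
    \<comment> \<open>The bornological topology satisfies (1), (2), (3) and so may take the place of
      \<mu>; this is how its dual is found to contain nothing but forms.\<close>
    obtain \<omega> where \<omega>: "\<omega> \<in> B_forms k U" "\<forall>A\<in>?P. f A = chain_integral A \<omega>"
      using continuous_functional_is_form[OF U chain_topology_conditions_bornological[OF U] f(2,3)] by blast
    have "f = restrict (\<lambda>A. chain_integral A \<omega>) ?P"
      using f(1) \<omega>(2) by (auto simp: fun_eq_iff extensional_def)
    then show "f \<in> D" using \<omega>(1) by (auto simp: D_def)
  next
    fix f assume "f \<in> D"
    then obtain \<omega> where \<omega>: "\<omega> \<in> B_forms k U" "f = restrict (\<lambda>A. chain_integral A \<omega>) ?P" by (auto simp: D_def)
    have "linear_on ?P f"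
      using linear_on_B_form[OF \<omega>(1)] subspace_add[OF subspace_pointed_chains, of _ k U]
        subspace_scale[OF subspace_pointed_chains, of _ k U]
      by (simp add: linear_on_def \<omega>(2))
    moreover have "continuous_map ?\<tau> euclideanreal f"
      using continuous_map_B_form[OF \<omega>(1)] by (rule continuous_map_eq) (simp add: \<omega>(2) topspace_bornological)
    ultimately show "f \<in> continuous_dual ?\<tau>"
      by (simp add: continuous_dual_def topspace_bornological \<omega>(2))
  qed
  then have compat: "compatible_topology ?P D ?\<tau>"
    by (simp add: compatible_topology_def locally_convex_space_bornological topspace_bornological)
  have finest: "coarser Y ?\<tau>" if "compatible_topology ?P D Y" for Y
  proof (rule coarser_bornological)
    show Y: "locally_convex_space Y" "topspace Y = ?P" using that by (simp_all add: compatible_topology_def)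
    fix f assume f: "linear_on ?P f" "continuous_map Y euclideanreal f"
    \<comment> \<open>The members of \<open>continuous_dual\<close> are extensional, so f has to be
      restricted before compatibility can be used.\<close>
    have "linear_on ?P (restrict f ?P)"
      using f(1) subspace_add[OF subspace_pointed_chains, of _ k U]
        subspace_scale[OF subspace_pointed_chains, of _ k U]
      by (simp add: linear_on_def)
    moreover have "continuous_map Y euclideanreal (restrict f ?P)"
      using f(2) by (rule continuous_map_eq) (simp add: Y)
    ultimately have "restrict f ?P \<in> D"
      using that by (auto simp: compatible_topology_def continuous_dual_def)
    then obtain \<omega> where "\<omega> \<in> B_forms k U" "restrict f ?P = restrict (\<lambda>A. chain_integral A \<omega>) ?P"
      by (auto simp: D_def)
    then show "\<exists>\<omega>\<in>B_forms k U. \<forall>A\<in>?P. f A = chain_integral A \<omega>"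
      by (metis restrict_apply')
  qed
  show ?thesis
    unfolding mackey_chain_topology_def mackey_topology_def D_def[symmetric]
    using compat finest by (intro the_equality) (auto intro: coarser_antisym)
qed

theorem theorem4p0p9:
  fixes U :: "(real^'n) set" and k :: nat
  assumes "open U" and "k \<le> CARD('n)"
  shows "chain_topology_conditions TYPE('f::real_vector) k U (mackey_chain_topology k U) \<and>
    (\<forall>\<mu>. chain_topology_conditions TYPE('n chain) k U \<mu> \<longrightarrow>
         coarser \<mu> (mackey_chain_topology k U))"
  unfolding mackey_chain_topology_eq[OF assms(1)]
proof (intro conjI allI impI)
  show "chain_topology_conditions TYPE('f) k U (bornological_topology k U)"
    by (rule chain_topology_conditions_bornological[OF assms(1)])
  fix \<mu> assume \<mu>: "chain_topology_conditions TYPE('n chain) k U \<mu>"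
  then show "coarser \<mu> (bornological_topology k U)"
    using continuous_functional_is_form[OF assms(1) \<mu>]
    by (intro coarser_bornological) (auto simp: chain_topology_conditions_def)
qed

end
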